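(* Let $c\ge2$ and $n_3=\lfloor(2c+1)/2\rfloor+1$. For each integer $k>n_3$ the following statements about the bands $\Gamma_{2k-1}$ and $\Gamma_{2k}$ of the spectrum of $H(c)$ hold. (a) There exists a unique $t_k\in(0,1)$ such that $\lambda_{2k-1}(t_k)$ is a multiple real eigenvalue (of $H_{t_k}(c)$) lying in $I_k=[\lambda_{2k-1}(0),\lambda_{2k}(0)]$. Its multiplicity is $2$ and $\lambda_{2k-1}(t_k)=\lambda_{2k}(t_k)$. (b) The real parts of the bands $\Gamma_{2k-1}$ and $\Gamma_{2k}$ are respectively the intervals $$\{\lambda_{2k-1}(t):t\in[0,t_k]\}=[\lambda_{2k-1}(0),\lambda_{2k-1}(t_k)],\qquad \{\lambda_{2k}(t):t\in[0,t_k]\}=[\lambda_{2k}(t_k),\lambda_{2k}(0)].$$ The nonreal parts of $\Gamma_{2k-1}$ and $\Gamma_{2k}$ are respectively the curves $\{\lambda_{2k-1}(t):t\in(t_k,1]\}$ and $\{\lambda_{2k}(t):t\in(t_k,1]\}$.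
   Context: $H(c)$ is the operator $-y''+(2ic\cos2x)y$ in $L_2(-\infty,\infty)$ with domain $W_2^2(-\infty,\infty)$; $H_t(c)$ is the operator generated in $L_2[0,\pi]$ by $-y''+(2ic\cos2x)y$ and $y(\pi)=e^{i\pi t}y(0)$, $y'(\pi)=e^{i\pi t}y'(0)$. Multiplicity of an eigenvalue is algebraic multiplicity (as a root of $F(\lambda)=2\cos\pi t$, $F$ the Hill discriminant). Numbering: let $n_1=\lfloor(c+1)/2\rfloor$. The eigenvalues of $H_0(c)$ (periodic eigenvalues) lying in the rectangle $\{|\operatorname{Im}\lambda|\le2c,\ -2c\le\operatorname{Re}\lambda\le(2n_1)^2+2c\}$ are denoted $\lambda_1(0),\dots,\lambda_{2n_1+1}(0)$ (counting multiplicity), and for $n>n_1$ the two eigenvalues of $H_0(c)$ in the disk $\{|\lambda-(2n)^2|\le2c\}$, which are real and simple, are denoted $\lambda_{2n}(0)<\lambda_{2n+1}(0)$; so $\lambda_{2n_1+2}(0)<\lambda_{2n_1+3}(0)<\cdots$. For $t\in(0,1]$ the eigenvalues of $H_t(c)$ are numbered so that each $\lambda_n(t)$ is continuous on $[0,1]$. One has $\lambda_n(-t)=\lambda_n(t)$, and the $n$-th band is $\Gamma_n=\{\lambda_n(t):t\in(-1,1]\}$. The real part of a band $\Gamma$ is $\Gamma\cap\mathbb R$ and its nonreal part is $\Gamma\setminus\mathbb R$. *)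

theory Defs
  imports "HOL-Complex_Analysis.Complex_Analysis"
begin

definition potential :: "real \<Rightarrow> real \<Rightarrow> complex" where
  "potential c x = 2 * \<i> * of_real c * of_real (cos (2 * x))"

text \<open>
  The function \<open>y\<close> belongs to the Sobolev space \<open>W\<^sub>2\<^sup>2[a,b]\<close>, with first derivative \<open>y1\<close>
  (absolutely continuous) and second derivative \<open>y2\<close> (square integrable, determined a.e.).
\<close>

definition W22 :: "real \<Rightarrow> real \<Rightarrow> (real \<Rightarrow> complex) \<Rightarrow> (real \<Rightarrow> complex) \<Rightarrow> (real \<Rightarrow> complex) \<Rightarrow> bool" where
  "W22 a b y y1 y2 \<longleftrightarrow>
     y2 \<in> borel_measurable (lebesgue_on {a..b}) \<and>
     integrable (lebesgue_on {a..b}) (\<lambda>x. (norm (y2 x))\<^sup>2) \<and>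
     (\<forall>x\<in>{a..b}. y1 x = y1 a + integral {a..x} y2) \<and>
     (\<forall>x\<in>{a..b}. y x = y a + integral {a..x} y1)"

text \<open>
  Eigenvalues of the operator \<open>H\<^sub>t(c)\<close> in \<open>L\<^sub>2[0,\<pi>]\<close>. Since \<open>y\<close> is continuous, it is a nonzero
  element of \<open>L\<^sub>2[0,\<pi>]\<close> iff it is nonzero at some point.
\<close>

definition is_eigenvalue :: "real \<Rightarrow> real \<Rightarrow> complex \<Rightarrow> bool" where
  "is_eigenvalue c t \<mu> \<longleftrightarrow>
     (\<exists>y y1 y2. W22 0 pi y y1 y2 \<and>
        y pi = exp (\<i> * of_real (pi * t)) * y 0 \<and>
        y1 pi = exp (\<i> * of_real (pi * t)) * y1 0 \<and>
        (AE x in lebesgue_on {0..pi}. - y2 x + potential c x * y x = \<mu> * y x) \<and>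
        (\<exists>x\<in>{0..pi}. y x \<noteq> 0))"

definition is_solution :: "real \<Rightarrow> complex \<Rightarrow> (real \<Rightarrow> complex) \<Rightarrow> (real \<Rightarrow> complex) \<Rightarrow> bool" where
  "is_solution c \<mu> y y1 \<longleftrightarrow>
     (\<forall>x. (y has_vector_derivative y1 x) (at x) \<and>
          (y1 has_vector_derivative (potential c x - \<mu>) * y x) (at x))"

text \<open>
  The Hill discriminant \<open>F(\<mu>) = \<theta>(\<pi>,\<mu>) + \<phi>'(\<pi>,\<mu>)\<close>, where \<open>\<theta>\<close> and \<open>\<phi>\<close> are the solutions of
  \<open>-y'' + (2ic cos 2x) y = \<mu> y\<close> with \<open>\<theta>(0) = \<phi>'(0) = 1\<close> and \<open>\<theta>'(0) = \<phi>(0) = 0\<close>.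
\<close>

definition hill_discriminant :: "real \<Rightarrow> complex \<Rightarrow> complex" where
  "hill_discriminant c \<mu> =
     (THE D. \<exists>\<theta> \<theta>1 \<phi> \<phi>1.
        is_solution c \<mu> \<theta> \<theta>1 \<and> \<theta> 0 = 1 \<and> \<theta>1 0 = 0 \<and>
        is_solution c \<mu> \<phi> \<phi>1 \<and> \<phi> 0 = 0 \<and> \<phi>1 0 = 1 \<and>
        D = \<theta> pi + \<phi>1 pi)"

text \<open>
  Algebraic multiplicity of an eigenvalue of \<open>H\<^sub>t(c)\<close>: its order as a root of
  \<open>F(\<mu>) = 2 cos(\<pi>t)\<close>. Meaningful only when \<open>\<mu>\<close> is an eigenvalue.
\<close>

definition alg_mult :: "real \<Rightarrow> real \<Rightarrow> complex \<Rightarrow> nat" where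
  "alg_mult c t \<mu> = nat (zorder (\<lambda>z. hill_discriminant c z - of_real (2 * cos (pi * t))) \<mu>)"

definition n1 :: "real \<Rightarrow> nat" where
  "n1 c = nat \<lfloor>(c + 1) / 2\<rfloor>"

definition n3 :: "real \<Rightarrow> nat" where
  "n3 c = nat \<lfloor>(2 * c + 1) / 2\<rfloor> + 1"

text \<open>
  \<open>eigenvalue_numbering c lam\<close>: the functions \<open>lam n\<close> for \<open>n \<ge> 1\<close> (the value at \<open>n = 0\<close> is irrelevant)
  are continuous on \<open>[0,1]\<close>, list for every \<open>t \<in> [0,1]\<close> the eigenvalues of \<open>H\<^sub>t(c)\<close> repeated according
  to algebraic multiplicity, are extended to negative \<open>t\<close> by evenness, and are numbered at \<open>t = 0\<close> by the
  rectangle/disk convention. As the disks are pairwise disjoint and disjoint from the rectangle, the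
  first \<open>2 n\<^sub>1 + 1\<close> values at \<open>t = 0\<close> are then exactly the periodic eigenvalues in the rectangle, and each
  disk with \<open>n > n\<^sub>1\<close> contains exactly the two simple eigenvalues \<open>lam (2n) 0 < lam (2n+1) 0\<close>.
\<close>

definition eigenvalue_numbering :: "real \<Rightarrow> (nat \<Rightarrow> real \<Rightarrow> complex) \<Rightarrow> bool" where
  "eigenvalue_numbering c lam \<longleftrightarrow>
     (\<forall>n\<ge>1. continuous_on {0..1} (lam n)) \<and>
     (\<forall>n\<ge>1. \<forall>t\<in>{0<..<1}. lam n (- t) = lam n t) \<and>
     (\<forall>t\<in>{0..1}. \<forall>n\<ge>1. is_eigenvalue c t (lam n t)) \<and>
     (\<forall>t\<in>{0..1}. \<forall>\<mu>. is_eigenvalue c t \<mu> \<longrightarrow>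
        finite {n. n \<ge> 1 \<and> lam n t = \<mu>} \<and> card {n. n \<ge> 1 \<and> lam n t = \<mu>} = alg_mult c t \<mu>) \<and>
     (\<forall>n\<in>{1..2 * n1 c + 1}.
        \<bar>Im (lam n 0)\<bar> \<le> 2 * c \<and>
        - 2 * c \<le> Re (lam n 0) \<and> Re (lam n 0) \<le> (2 * real (n1 c))\<^sup>2 + 2 * c) \<and>
     (\<forall>n>n1 c.
        lam (2 * n) 0 \<in> cball (of_real ((2 * real n)\<^sup>2)) (2 * c) \<and>
        lam (2 * n + 1) 0 \<in> cball (of_real ((2 * real n)\<^sup>2)) (2 * c) \<and>
        lam (2 * n) 0 \<in> \<real> \<and> lam (2 * n + 1) 0 \<in> \<real> \<and>
        Re (lam (2 * n) 0) < Re (lam (2 * n + 1) 0))"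

definition band :: "(nat \<Rightarrow> real \<Rightarrow> complex) \<Rightarrow> nat \<Rightarrow> complex set" where
  "band lam n = lam n ` {-1<..1}"

text \<open>
  The interval \<open>[a,b]\<close> of the real axis as a set of complex numbers, for real \<open>a\<close> and \<open>b\<close>.
\<close>

definition real_interval :: "complex \<Rightarrow> complex \<Rightarrow> complex set" where
  "real_interval a b = complex_of_real ` {Re a..Re b}"

definition multiple_real_at :: "real \<Rightarrow> (nat \<Rightarrow> real \<Rightarrow> complex) \<Rightarrow> nat \<Rightarrow> real \<Rightarrow> bool" where
  "multiple_real_at c lam k t \<longleftrightarrow>
     is_eigenvalue c t (lam (2 * k - 1) t) \<and>
     alg_mult c t (lam (2 * k - 1) t) \<ge> 2 \<and>
     lam (2 * k - 1) t \<in> \<real> \<and>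
     lam (2 * k - 1) t \<in> real_interval (lam (2 * k - 1) 0) (lam (2 * k) 0)"

end

theory Submission
  imports Defs
begin

text \<open>
  No property of the discriminant other than its symmetry \<open>F(cnj \<mu>) = cnj (F \<mu>)\<close> is needed. The rotated
  Fourier coefficients \<open>b\<^sub>n\<close> of an eigenfunction of \<open>H\<^sub>t(c)\<close> satisfy the real recurrence
  \<open>((2n + t)\<^sup>2 - \<mu>) b\<^sub>n = c (b\<^sub>n\<^sub>+\<^sub>1 - b\<^sub>n\<^sub>-\<^sub>1)\<close>. It puts every eigenvalue within \<open>2c\<close> of some
  center \<open>(2n + t)\<^sup>2\<close>; a nonreal one, for which \<open>\<Sum> (-1)\<^sup>n \<bar>b\<^sub>n\<bar>\<^sup>2 = 0\<close>, is close to both an even and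
  an odd center; and for \<open>t = 1\<close> no eigenvalue is real.

  For \<open>t \<le> 1/2\<close> the eigenvalues \<open>\<lambda>\<^sub>2\<^sub>j(t), \<lambda>\<^sub>2\<^sub>j\<^sub>+\<^sub>1(t)\<close> are alone near \<open>(2j)\<^sup>2\<close>, where both
  relevant centers have the parity of \<open>j\<close>, so they stay real; as one number is an eigenvalue for only
  one \<open>t \<in> [0,1]\<close>, they move monotonically apart. For \<open>t \<ge> 1/2\<close> the eigenvalues \<open>\<lambda>\<^sub>2\<^sub>k\<^sub>-\<^sub>1(t),
  \<lambda>\<^sub>2\<^sub>k(t)\<close> are alone between \<open>(2k - 2)\<^sup>2\<close> and \<open>(2k)\<^sup>2\<close>. Being nonreal and conjugate at \<open>t = 1\<close>,
  they collide at a first exit time \<open>t\<^sub>k\<close> from the real line. Until then they sweep out \<open>I\<^sub>k\<close>, and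
  thereafter no value in \<open>I\<^sub>k\<close> is available any more, so they never return to the real line.
\<close>

section \<open>Completeness of the trigonometric system\<close>

text \<open>The operator is not self-adjoint. The symmetry
  \<open>potential c (pi/2 - x) = cnj (potential c x)\<close> only yields conjugate pairs; reality
  needs the parity criterion. The antisymmetric coupling \<open>b (n+1) - b (n-1)\<close> is why the
  conserved form carries signs (-1)^n. The split at t = 1/2 follows the pairing of centers: for
  small t, (2j - t)^2 and (2j + t)^2 have indices -j and j of equal parity; near t = 1, (2k - 2 +
  t)^2 and (2k - t)^2 have indices k - 1 and -k of opposite parity, so a nonreal pair is possible.
  For t <= 1/2 neighbouring pairs are at least 4j + 2 apart, which has to exceed 4c; with j = k - 2
  this reads k > c + 3/2, and \<open>n3\<close> provides it. The radius 2c alone is too coarse to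
  show that the eigenvalues at t = 1/2 have left the periodic ones behind: the distance available
  there is 2j - 1/4, slightly more than 2c. Hence the sharper second bound, giving radius 2c/3 at t
  = 0 and 4c/3 for the relevant centers with t >= 1/2, with sum 2c. Multiplicity enters by counting
  indices: a conjugate eigenvalue of equal multiplicity must itself be some
  \<open>lam n t\<close>.\<close>

lemma image_cis_interval: "(\<lambda>x. cis (2 * x)) ` {0..pi} = sphere 0 1"
proof
  show "(\<lambda>x. cis (2 * x)) ` {0..pi} \<subseteq> sphere 0 1" by auto
  show "sphere 0 1 \<subseteq> (\<lambda>x. cis (2 * x)) ` {0..pi}"
  proof
    fix z :: complex assume "z \<in> sphere 0 1"
    then have z: "z = cis (2 * (Arg2pi z / 2))"
      using Arg2pi_eq[of z] by (simp add: cis_conv_exp mult.commute)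
    have "Arg2pi z / 2 \<in> {0..pi}" using Arg2pi_ge_0[of z] Arg2pi_lt_2pi[of z] by auto
    then show "z \<in> (\<lambda>x. cis (2 * x)) ` {0..pi}" using z by blast
  qed
qed

text \<open>The map \<open>cis (2 * x)\<close> identifies only the endpoints of the interval and, as
  a continuous surjection from a compact space onto a Hausdorff one, is a quotient map. So a
  periodic function descends to the circle, where Stone-Weierstrass applies.\<close>

lemma circle_lift:
  fixes f :: "real \<Rightarrow> complex"
  assumes cont: "continuous_on {0..pi} f" and per: "f pi = f 0"
  obtains g where "continuous_on (sphere 0 1) g" "\<And>x. x \<in> {0..pi} \<Longrightarrow> g (cis (2 * x)) = f x"
proof -
  define e where "e = (\<lambda>x::real. cis (2 * x))"
  define g where "g = (\<lambda>z. f (inv_into {0..pi} e z))"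
  have e_im: "e ` {0..pi} = sphere 0 1" using image_cis_interval by (simp add: e_def)
  have ge: "g (e x) = f x" if x: "x \<in> {0..pi}" for x
  proof -
    define u where "u = inv_into {0..pi} e (e x)"
    have u: "u \<in> {0..pi}" "e u = e x"
      using x by (auto simp: u_def intro: inv_into_into f_inv_into_f simp del: atLeastAtMost_iff)
    then have "exp (\<i> * complex_of_real (2 * u)) = exp (\<i> * complex_of_real (2 * x))"
      by (simp add: e_def cis_conv_exp)
    then obtain n :: int where "\<i> * complex_of_real (2 * u) = \<i> * complex_of_real (2 * x) + of_int (2 * n) * pi * \<i>"
      by (auto simp only: exp_eq)
    then have "Im (\<i> * complex_of_real (2 * u)) = Im (\<i> * complex_of_real (2 * x) + of_int (2 * n) * pi * \<i>)"
      by (rule arg_cong)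
    then have n': "u = x + pi * n" by (simp add: algebra_simps)
    have "\<bar>real_of_int n\<bar> * pi = \<bar>u - x\<bar>" by (simp add: n' abs_mult)
    then have "\<bar>real_of_int n\<bar> * pi \<le> 1 * pi" using u(1) x by auto
    then have "\<bar>real_of_int n\<bar> \<le> 1" by (simp only: mult_le_cancel_right_pos[OF pi_gt_zero])
    then have "n = 0 \<or> n = 1 \<or> n = -1" by linarith
    then have "f u = f x"
    proof (elim disjE)
      assume "n = 1" then have "u = pi" "x = 0" using n' u x by auto
      then show ?thesis using per by simp
    next
      assume "n = -1" then have "u = 0" "x = pi" using n' u x by auto
      then show ?thesis using per by simp
    qed (use n' in auto)
    then show ?thesis by (simp add: g_def u_def)
  qed
  have e_cont: "continuous_on {0..pi} e"
    unfolding e_def cis_conv_exp by (intro continuous_intros)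
  have "continuous_on (sphere 0 1) g"
    unfolding continuous_on_open_invariant
  proof (intro allI impI)
    fix B :: "complex set" assume B: "open B"
    let ?U = "sphere 0 1 \<inter> g -` B"
    have "{0..pi} \<inter> e -` ?U = {0..pi} \<inter> f -` B" using ge e_im by auto
    moreover have "openin (top_of_set {0..pi}) ({0..pi} \<inter> f -` B)"
      using cont B continuous_openin_preimage_gen by blast
    ultimately have "openin (top_of_set {0..pi}) ({0..pi} \<inter> e -` ?U)" by simp
    then have "openin (top_of_set (sphere 0 1)) ?U"
      using Abstract_Topology_2.continuous_imp_quotient_map[OF e_cont e_im compact_Icc, of ?U] by blast
    then show "\<exists>A. open A \<and> A \<inter> sphere 0 1 = g -` B \<inter> sphere 0 1"
      by (auto simp: openin_open Int_commute)
  qed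
  then show thesis using ge that by (auto simp: e_def)
qed

text \<open>On the unit circle a real-linear functional is a combination of z and
  \<open>cnj z\<close>, so multiplying by it only shifts frequencies by one. Keeping
  \<open>h\<close> arbitrary settles products: the hypothesis for the second factor is applied to
  \<open>h\<close> times the first.\<close>

lemma real_polynomial_function_orthogonal:
  assumes "real_polynomial_function p"
    and "continuous_on {0..pi} h"
    and "\<And>n::int. integral {0..pi} (\<lambda>x. h x * cis (2 * of_int n * x)) = 0"
  shows "continuous_on {0..pi} (\<lambda>x. h x * of_real (p (cis (2 * x)))) \<and>
    (\<forall>n::int. integral {0..pi} (\<lambda>x. h x * of_real (p (cis (2 * x))) * cis (2 * of_int n * x)) = 0)"
  using assms
proof (induction p arbitrary: h)
  case (linear p)
  have p: "p z = Re z * p 1 + Im z * p \<i>" for z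
  proof -
    have "z = Re z *\<^sub>R 1 + Im z *\<^sub>R \<i>" by (simp add: complex_eq_iff)
    then have "p z = p (Re z *\<^sub>R 1 + Im z *\<^sub>R \<i>)" by (rule arg_cong)
    also have "\<dots> = Re z * p 1 + Im z * p \<i>"
      using linear.hyps by (simp only: bounded_linear.linear linear_add linear_scale) simp
    finally show ?thesis .
  qed
  define \<alpha> \<beta> :: complex where "\<alpha> = (p 1 - \<i> * p \<i>) / 2" and "\<beta> = (p 1 + \<i> * p \<i>) / 2"
  have pe: "complex_of_real (p (cis a)) = \<alpha> * cis a + \<beta> * cis (- a)" for a
    by (subst p) (simp add: complex_eq_iff \<alpha>_def \<beta>_def field_simps)
  have cc: "continuous_on {0..pi} (\<lambda>x. cis (a * x))" for a
    unfolding cis_conv_exp by (intro continuous_intros)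
  have c1: "continuous_on {0..pi} (\<lambda>x. h x * of_real (p (cis (2 * x))))"
    unfolding pe using linear.prems(1) cc[of 2] cc[of "-2"] by (auto intro!: continuous_intros)
  have "integral {0..pi} (\<lambda>x. h x * of_real (p (cis (2 * x))) * cis (2 * of_int n * x)) = 0" for n :: int
  proof -
    have eq: "h x * of_real (p (cis (2 * x))) * cis (2 * of_int n * x) =
      \<alpha> * (h x * cis (2 * of_int (n + 1) * x)) + \<beta> * (h x * cis (2 * of_int (n - 1) * x))" for x
    proof -
      have "cis (2 * of_int (n + 1) * x) = cis (2 * x) * cis (2 * of_int n * x)"
        "cis (2 * of_int (n - 1) * x) = cis (- (2 * x)) * cis (2 * of_int n * x)"
        by (simp_all add: cis_mult algebra_simps)
      then show ?thesis unfolding pe by (simp add: algebra_simps)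
    qed
    have i: "(\<lambda>x. h x * cis (2 * of_int m * x)) integrable_on {0..pi}" for m :: int
      by (intro integrable_continuous_real continuous_intros linear.prems cc)
    show ?thesis unfolding eq
      using linear.prems(2) i[of "n+1"] i[of "n-1"]
      by (subst integral_add) (auto intro!: integrable_on_mult_right simp del: of_int_add of_int_diff)
  qed
  then show ?case using c1 by blast
next
  case (const c)
  show ?case
  proof (intro conjI allI)
    show "continuous_on {0..pi} (\<lambda>x. h x * of_real c)" using const by (intro continuous_intros)
    fix n :: int
    have "(\<lambda>x. h x * of_real c * cis (2 * of_int n * x)) = (\<lambda>x. of_real c * (h x * cis (2 * of_int n * x)))"
      by (auto simp: mult_ac)
    then show "integral {0..pi} (\<lambda>x. h x * of_real c * cis (2 * of_int n * x)) = 0"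
      using const by simp
  qed
next
  case (add p q)
  have cc: "continuous_on {0..pi} (\<lambda>x. cis (a * x))" for a
    unfolding cis_conv_exp by (intro continuous_intros)
  note P = add.IH(1)[OF add.prems] and Q = add.IH(2)[OF add.prems]
  have i: "(\<lambda>x. h x * of_real (p (cis (2 * x))) * cis (2 * of_int m * x)) integrable_on {0..pi}"
    "(\<lambda>x. h x * of_real (q (cis (2 * x))) * cis (2 * of_int m * x)) integrable_on {0..pi}" for m :: int
    using P Q cc by (auto intro!: integrable_continuous_real continuous_on_mult)
  show ?case
  proof (intro conjI allI)
    show "continuous_on {0..pi} (\<lambda>x. h x * of_real (p (cis (2 * x)) + q (cis (2 * x))))"
      using continuous_on_add[OF conjunct1[OF P] conjunct1[OF Q]] by (simp add: algebra_simps)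
    fix n :: int
    have "(\<lambda>x. h x * of_real (p (cis (2 * x)) + q (cis (2 * x))) * cis (2 * of_int n * x)) =
      (\<lambda>x. h x * of_real (p (cis (2 * x))) * cis (2 * of_int n * x)
         + h x * of_real (q (cis (2 * x))) * cis (2 * of_int n * x))"
      by (auto simp: algebra_simps)
    then show "integral {0..pi} (\<lambda>x. h x * of_real (p (cis (2 * x)) + q (cis (2 * x))) * cis (2 * of_int n * x)) = 0"
      using P Q i by (simp add: integral_add)
  qed
next
  case (mult p q)
  note P = mult.IH(1)[OF mult.prems]
  show ?case
    using mult.IH(2)[OF conjunct1[OF P] P[THEN conjunct2, rule_format]]
    by (simp add: mult.assoc)
qed

text \<open>Polynomial approximation extends the orthogonality to all continuous real weights on the
  circle; the weights \<open>Re f\<close> and \<open>Im f\<close> then make the integral of |f|^2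
  vanish.\<close>

lemma trigonometric_system_complete:
  fixes f :: "real \<Rightarrow> complex"
  assumes cont: "continuous_on {0..pi} f" and per: "f pi = f 0"
    and orth: "\<And>n::int. integral {0..pi} (\<lambda>x. f x * cis (2 * of_int n * x)) = 0"
    and x: "x \<in> {0..pi}"
  shows "f x = 0"
proof -
  obtain g where g: "continuous_on (sphere 0 1) g" "\<And>x. x \<in> {0..pi} \<Longrightarrow> g (cis (2 * x)) = f x"
    using circle_lift[OF cont per] by blast
  have ec: "continuous_on {0..pi} (\<lambda>x. cis (2 * x))"
    unfolding cis_conv_exp by (intro continuous_intros)
  have es: "cis (2 * x) \<in> sphere 0 1" for x by simp
  have orth_u: "integral {0..pi} (\<lambda>x. f x * of_real (u (cis (2 * x)))) = 0"
    if u: "continuous_on (sphere 0 1) u" for u :: "complex \<Rightarrow> real"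
  proof -
    have uc: "continuous_on {0..pi} (\<lambda>x. u (cis (2 * x)))"
      by (rule continuous_on_compose2[OF u ec]) auto
    have fu: "(\<lambda>x. f x * of_real (u (cis (2 * x)))) integrable_on {0..pi}"
      using uc by (intro integrable_continuous_real continuous_intros cont)
    define M where "M = integral {0..pi} (\<lambda>x. norm (f x))"
    have fi: "(\<lambda>x. norm (f x)) integrable_on {0..pi}"
      by (intro integrable_continuous_real continuous_intros cont)
    have M0: "M \<ge> 0" unfolding M_def by (intro integral_nonneg fi) auto
    have small: "norm (integral {0..pi} (\<lambda>x. f x * of_real (u (cis (2 * x))))) \<le> \<epsilon>" if "\<epsilon> > 0" for \<epsilon>
    proof -
      define d where "d = \<epsilon> / (M + 1)"
      have d: "d > 0" using that M0 by (simp add: d_def)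
      obtain p where p: "real_polynomial_function p" "\<And>z. z \<in> sphere 0 1 \<Longrightarrow> \<bar>u z - p z\<bar> < d"
        using Stone_Weierstrass_real_polynomial_function[OF compact_sphere u d] by blast
      note P = real_polynomial_function_orthogonal[OF p(1) cont orth]
      have P0: "integral {0..pi} (\<lambda>x. f x * of_real (p (cis (2 * x)))) = 0"
        using P[THEN conjunct2, rule_format, of 0] by simp
      have fp: "(\<lambda>x. f x * of_real (p (cis (2 * x)))) integrable_on {0..pi}"
        using P by (intro integrable_continuous_real) auto
      have "integral {0..pi} (\<lambda>x. f x * of_real (u (cis (2 * x)))) =
        integral {0..pi} (\<lambda>x. f x * of_real (u (cis (2 * x))) - f x * of_real (p (cis (2 * x))))"
        using P0 fu fp by (simp add: integral_diff)
      also have "norm \<dots> \<le> integral {0..pi} (\<lambda>x. d * norm (f x))"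
      proof (rule integral_norm_bound_integral)
        show "(\<lambda>x. f x * of_real (u (cis (2 * x))) - f x * of_real (p (cis (2 * x)))) integrable_on {0..pi}"
          by (intro integrable_diff fu fp)
        show "(\<lambda>x. d * norm (f x)) integrable_on {0..pi}" by (intro integrable_on_mult_right fi)
        fix x
        have "norm (f x * of_real (u (cis (2 * x))) - f x * of_real (p (cis (2 * x))))
          = norm (f x) * \<bar>u (cis (2 * x)) - p (cis (2 * x))\<bar>"
          by (simp flip: norm_mult of_real_diff right_diff_distrib add: norm_mult)
        also have "\<dots> \<le> norm (f x) * d" by (intro mult_left_mono less_imp_le p(2) es norm_ge_zero)
        finally show "norm (f x * of_real (u (cis (2 * x))) - f x * of_real (p (cis (2 * x)))) \<le> d * norm (f x)"
          by (simp add: mult.commute)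
      qed
      also have "\<dots> = d * M" by (simp add: M_def)
      also have "\<dots> \<le> d * (M + 1)" using d by simp
      also have "\<dots> = \<epsilon>" using M0 by (simp add: d_def)
      finally show ?thesis .
    qed
    have "norm (integral {0..pi} (\<lambda>x. f x * of_real (u (cis (2 * x))))) \<le> 0"
    proof (rule field_le_epsilon)
      fix \<epsilon> :: real assume "\<epsilon> > 0"
      from small[OF this]
      show "norm (integral {0..pi} (\<lambda>x. f x * of_real (u (cis (2 * x))))) \<le> 0 + \<epsilon>"
        by (simp only: add_0)
    qed
    then show ?thesis by simp
  qed
  have re: "integral {0..pi} (\<lambda>x. f x * of_real (Re (f x))) = 0"
    using orth_u[OF continuous_on_Re[OF g(1)]] integral_cong[of "{0..pi}" "\<lambda>x. f x * of_real (Re (g (cis (2 * x))))"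
      "\<lambda>x. f x * of_real (Re (f x))"] g(2) by simp
  have im: "integral {0..pi} (\<lambda>x. f x * of_real (Im (f x))) = 0"
    using orth_u[OF continuous_on_Im[OF g(1)]] integral_cong[of "{0..pi}" "\<lambda>x. f x * of_real (Im (g (cis (2 * x))))"
      "\<lambda>x. f x * of_real (Im (f x))"] g(2) by simp
  have "integral {0..pi} (\<lambda>x. f x * of_real (Re (f x)) - \<i> * (f x * of_real (Im (f x)))) = 0"
    using re im
    by (subst integral_diff) (auto intro!: integrable_continuous_real continuous_intros cont)
  also have "(\<lambda>x. f x * of_real (Re (f x)) - \<i> * (f x * of_real (Im (f x)))) =
      (\<lambda>x. complex_of_real ((norm (f x))\<^sup>2))"
    by (rule ext, simp only: complex_norm_square, simp add: complex_eq_iff algebra_simps)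
  also have "integral {0..pi} \<dots> = complex_of_real (integral {0..pi} (\<lambda>x. (norm (f x))\<^sup>2))"
    by (rule integral_unique, rule has_integral_of_real, rule integrable_integral)
      (intro integrable_continuous_real continuous_intros cont)
  finally have "complex_of_real (integral {0..pi} (\<lambda>x. (norm (f x))\<^sup>2)) = 0" .
  then have "integral (cbox 0 pi) (\<lambda>x. (norm (f x))\<^sup>2) = 0" by simp
  moreover have "(\<lambda>x. (norm (f x))\<^sup>2) integrable_on cbox 0 pi"
    unfolding box_real by (intro integrable_continuous_real continuous_intros cont)
  ultimately have "((\<lambda>x. (norm (f x))\<^sup>2) has_integral 0) (cbox 0 pi)"
    by (simp only: has_integral_integrable_integral simp_thms)
  then have "(norm (f x))\<^sup>2 = 0"
  proof (rule has_integral_0_cbox_imp_0[rotated 2])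
    show "box 0 pi \<noteq> {}" using pi_gt_zero by (simp only: box_real greaterThanLessThan_empty_iff not_le)
  qed (use x cont in \<open>auto intro!: continuous_intros\<close>)
  then show ?thesis by simp
qed

section \<open>Eigenfunctions as classical solutions\<close>

text \<open>Classical form of the eigenvalue problem. Derivatives are taken within the interval
  because an eigenfunction is given only there, in contrast to \<open>is_solution\<close>.\<close>

definition bloch :: "real \<Rightarrow> real \<Rightarrow> complex \<Rightarrow> (real \<Rightarrow> complex) \<Rightarrow> (real \<Rightarrow> complex) \<Rightarrow> bool" where
  "bloch c t \<mu> y y1 \<longleftrightarrow>
     (\<forall>x\<in>{0..pi}. (y has_vector_derivative y1 x) (at x within {0..pi}) \<and>
        (y1 has_vector_derivative (potential c x - \<mu>) * y x) (at x within {0..pi})) \<and>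
     y pi = exp (\<i> * of_real (pi * t)) * y 0 \<and>
     y1 pi = exp (\<i> * of_real (pi * t)) * y1 0 \<and>
     (\<exists>x\<in>{0..pi}. y x \<noteq> 0)"

lemma continuous_on_potential: "continuous_on S (potential c)"
  unfolding potential_def by (intro continuous_intros)

lemma norm_potential_diff_le: "norm (potential c x - \<mu>) \<le> 2 * \<bar>c\<bar> + norm \<mu>"
proof -
  have "norm (potential c x) = 2 * \<bar>c\<bar> * \<bar>cos (2 * x)\<bar>" by (simp add: potential_def norm_mult)
  also have "\<dots> \<le> 2 * \<bar>c\<bar> * 1" by (intro mult_left_mono) auto
  finally show ?thesis using norm_triangle_ineq4[of "potential c x" \<mu>] by linarith
qed

lemma bloch_continuous:
  assumes "bloch c t \<mu> y y1"
  shows "continuous_on {0..pi} y" "continuous_on {0..pi} y1"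
  using assms unfolding bloch_def continuous_on_eq_continuous_within
  by (auto intro: has_vector_derivative_continuous)

text \<open>Regularity bootstrap: square integrability of \<open>y2\<close> gives integrability, so
  \<open>y1\<close> is continuous and \<open>y\<close> is differentiable; the equation then replaces
  \<open>y2\<close> almost everywhere by a continuous function, whose integral is differentiable at
  every point.\<close>

lemma is_eigenvalue_imp_bloch:
  assumes "is_eigenvalue c t \<mu>"
  obtains y y1 where "bloch c t \<mu> y y1"
proof -
  obtain y y1 y2 where w: "W22 0 pi y y1 y2"
    and bc: "y pi = exp (\<i> * of_real (pi * t)) * y 0" "y1 pi = exp (\<i> * of_real (pi * t)) * y1 0"
    and ae: "AE x in lebesgue_on {0..pi}. - y2 x + potential c x * y x = \<mu> * y x"
    and nz: "\<exists>x\<in>{0..pi}. y x \<noteq> 0"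
    using assms unfolding is_eigenvalue_def by blast
  have meas: "y2 \<in> borel_measurable (lebesgue_on {0..pi})"
    and sq: "integrable (lebesgue_on {0..pi}) (\<lambda>x. (norm (y2 x))\<^sup>2)"
    and y1: "\<And>x. x \<in> {0..pi} \<Longrightarrow> y1 x = y1 0 + integral {0..x} y2"
    and y: "\<And>x. x \<in> {0..pi} \<Longrightarrow> y x = y 0 + integral {0..x} y1"
    using w unfolding W22_def by blast+
  have "finite_measure (lebesgue_on {0..pi})"
    by (intro finite_measureI) (simp add: emeasure_restrict_space)
  then have "integrable (lebesgue_on {0..pi}) (\<lambda>x. 1 + (norm (y2 x))\<^sup>2)"
    using sq by (intro Bochner_Integration.integrable_add finite_measure.integrable_const)
  then have "integrable (lebesgue_on {0..pi}) y2"
  proof (rule Bochner_Integration.integrable_bound)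
    show "AE x in lebesgue_on {0..pi}. norm (y2 x) \<le> norm (1 + (norm (y2 x))\<^sup>2)"
    proof (rule AE_I2)
      fix x
      have "0 \<le> (norm (y2 x) - 1)\<^sup>2" by simp
      then have "2 * norm (y2 x) \<le> 1 + (norm (y2 x))\<^sup>2" by (simp add: power2_diff)
      then show "norm (y2 x) \<le> norm (1 + (norm (y2 x))\<^sup>2)"
        using norm_ge_zero[of "y2 x"] by (simp only: real_norm_def)
    qed
  qed (rule meas)
  then have "set_integrable lebesgue {0..pi} y2" by (simp add: integrable_restrict_space set_integrable_def)
  then have y2i: "y2 integrable_on {0..pi}" using set_lebesgue_integral_eq_integral(1) by blast
  have y1c: "continuous_on {0..pi} y1"
    using continuous_on_add[OF continuous_on_const indefinite_integral_continuous_1[OF y2i], of "y1 0"]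
    by (rule continuous_on_eq) (rule y1[symmetric])
  have yd: "(y has_vector_derivative y1 x) (at x within {0..pi})" if x: "x \<in> {0..pi}" for x
    using has_vector_derivative_add[OF has_vector_derivative_const[of "y 0"] integral_has_vector_derivative[OF y1c x]]
    by (simp only: add_0) (rule has_vector_derivative_transform[OF x y])
  have yc: "continuous_on {0..pi} y"
    by (rule continuous_on_vector_derivative[OF yd])
  define g where "g = (\<lambda>x. (potential c x - \<mu>) * y x)"
  have gc: "continuous_on {0..pi} g"
    unfolding g_def by (intro continuous_intros continuous_on_potential yc)
  have "AE x in lebesgue. x \<in> {0..pi} \<longrightarrow> y2 x = g x"
  proof -
    have "AE x in lebesgue. x \<in> {0..pi} \<longrightarrow> - y2 x + potential c x * y x = \<mu> * y x"
      using ae by (subst (asm) AE_restrict_space_iff) auto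
    then show ?thesis by (rule AE_mp) (auto intro!: AE_I2 simp: g_def algebra_simps)
  qed
  then obtain N where N: "N \<in> null_sets lebesgue" "{x. \<not> (x \<in> {0..pi} \<longrightarrow> y2 x = g x)} \<subseteq> N"
    by (auto simp: eventually_ae_filter)
  have neg: "negligible N" using N(1) by (simp add: negligible_iff_null_sets)
  have "integral {0..x} y2 = integral {0..x} g" if x: "x \<in> {0..pi}" for x
    by (rule integral_spike[OF neg]) (use N(2) x in auto)
  then have y1': "y1 x = y1 0 + integral {0..x} g" if "x \<in> {0..pi}" for x
    using y1[OF that] that by (simp only:)
  have "(y1 has_vector_derivative g x) (at x within {0..pi})" if x: "x \<in> {0..pi}" for x
    using has_vector_derivative_add[OF has_vector_derivative_const[of "y1 0"] integral_has_vector_derivative[OF gc x]]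
    by (simp only: add_0) (rule has_vector_derivative_transform[OF x y1'])
  then have "bloch c t \<mu> y y1" unfolding bloch_def using yd bc nz by (auto simp: g_def)
  then show thesis by (rule that)
qed

lemma bloch_imp_is_eigenvalue:
  assumes b: "bloch c t \<mu> y y1"
  shows "is_eigenvalue c t \<mu>"
proof -
  define g where "g = (\<lambda>x. (potential c x - \<mu>) * y x)"
  have gc: "continuous_on {0..pi} g"
    unfolding g_def by (intro continuous_intros continuous_on_potential bloch_continuous[OF b])
  have ftc: "f x = f 0 + integral {0..x} f'"
    if "x \<in> {0..pi}" "\<And>x. x \<in> {0..pi} \<Longrightarrow> (f has_vector_derivative f' x) (at x within {0..pi})" for f f' :: "real \<Rightarrow> complex" and x
  proof -
    have "(f' has_integral (f x - f 0)) {0..x}"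
      by (rule fundamental_theorem_of_calculus) (use that(1) in \<open>auto intro!: has_vector_derivative_within_subset[OF that(2)]\<close>)
    then show ?thesis by (simp add: integral_unique)
  qed
  have cb: "continuous_on {0..pi} h \<Longrightarrow> integrable (lebesgue_on {0..pi}) h" for h :: "real \<Rightarrow> real"
    by (simp add: continuous_imp_integrable_real)
  have "W22 0 pi y y1 g"
    unfolding W22_def
  proof (intro conjI ballI)
    show "g \<in> borel_measurable (lebesgue_on {0..pi})"
      using gc by (intro continuous_imp_measurable_on_sets_lebesgue) auto
    show "integrable (lebesgue_on {0..pi}) (\<lambda>x. (norm (g x))\<^sup>2)"
      by (intro cb continuous_intros gc)
  next
    fix x assume x: "x \<in> {0..pi}"
    show "y1 x = y1 0 + integral {0..x} g" by (rule ftc[OF x]) (use b in \<open>auto simp: bloch_def g_def\<close>)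
    show "y x = y 0 + integral {0..x} y1" by (rule ftc[OF x]) (use b in \<open>auto simp: bloch_def\<close>)
  qed
  then show ?thesis
    using b unfolding is_eigenvalue_def bloch_def
    by (intro exI[of _ y] exI[of _ y1] exI[of _ g]) (auto simp: g_def algebra_simps intro!: AE_I2)
qed

text \<open>Gronwall: the energy \<open>|y|\<^sup>2 + |y'|\<^sup>2\<close> grows at most exponentially.\<close>

lemma linear_ode_zero:
  fixes w w1 q :: "real \<Rightarrow> complex"
  assumes w: "\<And>x. x \<in> {0..b} \<Longrightarrow> (w has_vector_derivative w1 x) (at x within {0..b})"
    and w1: "\<And>x. x \<in> {0..b} \<Longrightarrow> (w1 has_vector_derivative q x * w x) (at x within {0..b})"
    and q: "\<And>x. x \<in> {0..b} \<Longrightarrow> norm (q x) \<le> K"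
    and init: "w 0 = 0" "w1 0 = 0" and x: "x \<in> {0..b}"
  shows "w x = 0" "w1 x = 0"
proof -
  define E where "E = (\<lambda>x. w x \<bullet> w x + w1 x \<bullet> w1 x)"
  define L where "L = 1 + K"
  define G where "G = (\<lambda>x. exp (- L * x) * E x)"
  define E' where "E' = (\<lambda>x. 2 * (w x \<bullet> w1 x) + 2 * (w1 x \<bullet> (q x * w x)))"
  have dE: "(E has_real_derivative E' x) (at x within {0..b})" if x: "x \<in> {0..b}" for x
  proof -
    note d = w[OF x, unfolded has_vector_derivative_def] w1[OF x, unfolded has_vector_derivative_def]
    show ?thesis unfolding E_def E'_def has_field_derivative_def
      by (rule derivative_eq_intros d refl)+ (auto simp: fun_eq_iff algebra_simps inner_commute)
  qed
  have E'_le: "E' x \<le> L * E x" if x: "x \<in> {0..b}" for x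
  proof -
    have K: "0 \<le> K" using q[OF x] norm_ge_zero order_trans by blast
    have am: "2 * (norm (w x) * norm (w1 x)) \<le> E x"
      using sum_squares_bound[of "norm (w x)" "norm (w1 x)"] by (simp add: E_def power2_norm_eq_inner mult.assoc)
    have "w x \<bullet> w1 x \<le> norm (w x) * norm (w1 x)" by (rule norm_cauchy_schwarz)
    moreover have "w1 x \<bullet> (q x * w x) \<le> norm (w1 x) * norm (q x * w x)" by (rule norm_cauchy_schwarz)
    moreover have "norm (w1 x) * norm (q x * w x) \<le> K * (norm (w x) * norm (w1 x))"
      using mult_right_mono[OF q[OF x], of "norm (w x) * norm (w1 x)"] by (simp add: norm_mult mult_ac)
    ultimately have "E' x \<le> (1 + K) * (2 * (norm (w x) * norm (w1 x)))"
      unfolding E'_def by (simp add: algebra_simps)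
    also have "\<dots> \<le> L * E x" unfolding L_def using am K by (intro mult_left_mono) auto
    finally show ?thesis .
  qed
  have dG: "(G has_real_derivative exp (- L * x) * (E' x - L * E x)) (at x within {0..b})" if x: "x \<in> {0..b}" for x
    unfolding G_def by (rule derivative_eq_intros dE[OF x] refl)+ (simp add: algebra_simps)
  have "G x \<le> G 0"
  proof (rule DERIV_nonpos_imp_decreasing_open[where f = G])
    show "0 \<le> x" using x by simp
    have "continuous_on {0..b} G" by (rule DERIV_continuous_on[OF dG])
    then show "continuous_on {0..x} G" by (rule continuous_on_subset) (use x in auto)
    fix z assume z: "0 < z" "z < x"
    then have "z \<in> {0..b}" "z \<in> interior {0..b}" using x by (auto simp: interior_atLeastAtMost_real)
    then have "(G has_real_derivative exp (- L * z) * (E' z - L * E z)) (at z)"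
      using dG by (metis at_within_interior)
    moreover have "exp (- L * z) * (E' z - L * E z) \<le> 0"
      using E'_le[OF \<open>z \<in> {0..b}\<close>] by (simp add: mult_nonneg_nonpos)
    ultimately show "\<exists>d. (G has_real_derivative d) (at z) \<and> d \<le> 0" by blast
  qed
  then have "E x \<le> 0" using init by (simp add: G_def E_def zero_le_mult_iff mult_le_0_iff)
  moreover have "0 \<le> w x \<bullet> w x" "0 \<le> w1 x \<bullet> w1 x" by simp_all
  ultimately have "w x \<bullet> w x = 0" "w1 x \<bullet> w1 x = 0" unfolding E_def by linarith+
  then show "w x = 0" "w1 x = 0" by simp_all
qed

lemma bloch_initial_data_nonzero:
  assumes b: "bloch c t \<mu> y y1"
  shows "y 0 \<noteq> 0 \<or> y1 0 \<noteq> 0"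
proof (rule ccontr)
  assume z: "\<not> ?thesis"
  have "y x = 0" if x: "x \<in> {0..pi}" for x
    by (rule linear_ode_zero(1)[of pi y y1 "\<lambda>x. potential c x - \<mu>", OF _ _ norm_potential_diff_le _ _ x]) (use b z in \<open>simp_all add: bloch_def\<close>)
  then show False using b by (auto simp: bloch_def)
qed

section \<open>Uniqueness of the parameter and conjugation symmetry\<close>

lemma exp_pi_eq_imp_eq:
  assumes "exp (\<i> * of_real (pi * t)) = exp (\<i> * of_real (pi * s))" "t \<in> {0..1}" "s \<in> {0..1}"
  shows "t = s"
proof -
  obtain n :: int where "\<i> * of_real (pi * t) = \<i> * of_real (pi * s) + of_int (2 * n) * pi * \<i>"
    using assms(1) by (auto simp only: exp_eq)
  then have "Im (\<i> * of_real (pi * t)) = Im (\<i> * of_real (pi * s) + of_int (2 * n) * pi * \<i>)"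
    by (rule arg_cong)
  then have "pi * t = pi * (s + 2 * n)" by (simp add: algebra_simps)
  then have "t = s + 2 * n" using pi_neq_zero mult_cancel_left by blast
  moreover from this have "\<bar>2 * real_of_int n\<bar> \<le> 1" using assms by auto
  then have "n = 0" by linarith
  ultimately show ?thesis by simp
qed

text \<open>The Wronskian of two eigenfunctions is constant, and it is multiplied by
  \<open>e\<^sup>i\<^sup>\<pi>\<^sup>(\<^sup>t\<^sup>+\<^sup>s\<^sup>)\<close> over a period, so it vanishes unless \<open>t + s\<close> is even.\<close>

lemma is_eigenvalue_parameter_unique:
  assumes "is_eigenvalue c t \<mu>" "is_eigenvalue c s \<mu>" "t \<in> {0..1}" "s \<in> {0..1}"
  shows "t = s"
proof (rule ccontr)
  assume ne: "t \<noteq> s"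
  obtain y y1 where y: "bloch c t \<mu> y y1" using assms(1) is_eigenvalue_imp_bloch by blast
  obtain z z1 where z: "bloch c s \<mu> z z1" using assms(2) is_eigenvalue_imp_bloch by blast
  define et es where "et = exp (\<i> * complex_of_real (pi * t))" and "es = exp (\<i> * complex_of_real (pi * s))"
  define W where "W = (\<lambda>x. y x * z1 x - y1 x * z x)"
  have yd: "(y has_vector_derivative y1 x) (at x within {0..pi})"
    "(y1 has_vector_derivative (potential c x - \<mu>) * y x) (at x within {0..pi})"
    and zd: "(z has_vector_derivative z1 x) (at x within {0..pi})"
    "(z1 has_vector_derivative (potential c x - \<mu>) * z x) (at x within {0..pi})"
    if "x \<in> {0..pi}" for x using y z that by (auto simp: bloch_def)
  have bc: "y pi = et * y 0" "y1 pi = et * y1 0" "z pi = es * z 0" "z1 pi = es * z1 0"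
    using y z by (simp_all add: bloch_def et_def es_def)
  have "(W has_vector_derivative 0) (at x within {0..pi})" if x: "x \<in> {0..pi}" for x
    unfolding W_def
    by (rule derivative_eq_intros yd[OF x] zd[OF x] refl)+ (simp add: algebra_simps)
  then obtain w0 where "\<And>x. x \<in> {0..pi} \<Longrightarrow> W x = w0"
    using has_vector_derivative_zero_constant[of "{0..pi}" W] by blast
  then have "W pi = W 0" by simp
  then have "(et * es - 1) * W 0 = 0" by (simp add: W_def bc algebra_simps)
  moreover have "et * es \<noteq> 1"
  proof
    assume "et * es = 1"
    then have "exp (\<i> * of_real (pi * (t + s))) = 1"
      by (simp add: et_def es_def exp_add[symmetric] algebra_simps)
    then obtain n :: int where "pi * (t + s) = of_int (2 * n) * pi"
      by (auto simp: exp_eq_1)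
    then have "pi * (t + s) = pi * (2 * n)" by simp
    then have "t + s = 2 * n" using pi_neq_zero mult_cancel_left by blast
    moreover have "0 < t + s" "t + s < 2" using assms(3,4) ne by auto
    ultimately have "0 < n" "n < 1" by linarith+
    then show False by simp
  qed
  ultimately have W0: "y 0 * z1 0 = y1 0 * z 0" by (simp add: W_def)
  \<comment> \<open>A vanishing Wronskian makes the two initial vectors proportional; the
    derivatives supply the coefficients when both initial values are 0.\<close>
  obtain \<alpha> \<beta> where ab: "\<alpha> * y 0 = \<beta> * z 0" "\<alpha> * y1 0 = \<beta> * z1 0" "\<alpha> \<noteq> 0 \<or> \<beta> \<noteq> 0"
  proof (cases "y 0 = 0 \<and> z 0 = 0")
    case True
    then show ?thesis using that[of "z1 0" "y1 0"] bloch_initial_data_nonzero[OF y] by (auto simp: mult.commute)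
  next
    case False
    then show ?thesis using that[of "z 0" "y 0"] W0 by (auto simp: mult.commute)
  qed
  \<comment> \<open>Having zero initial data, \<open>w\<close> and \<open>w1\<close> vanish at pi
    too. So \<open>et\<close> and \<open>es\<close> multiply one and the same vector with equal
    results, and since they differ the vector is 0.\<close>
  define w w1 where "w = (\<lambda>x. \<alpha> * y x - \<beta> * z x)" and "w1 = (\<lambda>x. \<alpha> * y1 x - \<beta> * z1 x)"
  have "w pi = 0" "w1 pi = 0"
  proof -
    have d: "(w has_vector_derivative w1 x) (at x within {0..pi})"
      "(w1 has_vector_derivative (potential c x - \<mu>) * w x) (at x within {0..pi})" if x: "x \<in> {0..pi}" for x
      unfolding w_def w1_def
      by (rule derivative_eq_intros yd[OF x] zd[OF x] refl has_vector_derivative_mult_right | simp add: algebra_simps)+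
    have i: "w 0 = 0" "w1 0 = 0" by (simp_all add: w_def w1_def ab)
    show "w pi = 0" "w1 pi = 0"
      by (rule linear_ode_zero[OF d norm_potential_diff_le i]; simp)+
  qed
  then have "\<alpha> * (et * y 0) = \<beta> * (es * z 0)" "\<alpha> * (et * y1 0) = \<beta> * (es * z1 0)"
    by (simp_all add: w_def w1_def bc)
  then have "et * (\<alpha> * y 0) = es * (\<beta> * z 0)" "et * (\<alpha> * y1 0) = es * (\<beta> * z1 0)"
    by (simp_all only: mult.left_commute[of et] mult.left_commute[of es])
  then have "et * (\<alpha> * y 0) = es * (\<alpha> * y 0)" "et * (\<alpha> * y1 0) = es * (\<alpha> * y1 0)"
    by (simp_all only: ab)
  then have "(et - es) * (\<alpha> * y 0) = 0" "(et - es) * (\<alpha> * y1 0) = 0"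
    by (simp_all only: left_diff_distrib diff_self)
  moreover have "et \<noteq> es" using exp_pi_eq_imp_eq[of t s] assms ne by (auto simp: et_def es_def)
  ultimately have "\<alpha> * y 0 = 0" "\<alpha> * y1 0 = 0" by auto
  moreover from this have "\<beta> * z 0 = 0" "\<beta> * z1 0 = 0" by (simp_all only: ab)
  ultimately show False
    using ab(3) bloch_initial_data_nonzero[OF y] bloch_initial_data_nonzero[OF z]
    by (simp only: mult_eq_0_iff) blast
qed

text \<open>The potential satisfies \<open>q(\<pi>/2 - x) = cnj (q x)\<close>, so \<open>cnj (y(\<pi>/2 - x))\<close>, continued past
  \<open>x = \<pi>/2\<close> by quasi-periodicity, is an eigenfunction for the conjugate eigenvalue.\<close>

lemma is_eigenvalue_cnj:
  assumes "is_eigenvalue c t \<mu>"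
  shows "is_eigenvalue c t (cnj \<mu>)"
proof -
  obtain y y1 where b: "bloch c t \<mu> y y1" using assms is_eigenvalue_imp_bloch by blast
  define E where "E = exp (\<i> * complex_of_real (pi * t))"
  have E: "E * cnj E = 1" by (simp add: E_def exp_cnj exp_add[symmetric])
  have bc: "y pi = E * y 0" "y1 pi = E * y1 0" using b by (simp_all add: bloch_def E_def)
  have yd: "(y has_vector_derivative y1 x) (at x within {0..pi})"
    "(y1 has_vector_derivative (potential c x - \<mu>) * y x) (at x within {0..pi})"
    if "x \<in> {0..pi}" for x using b that by (auto simp: bloch_def)
  define R where "R = (\<lambda>(A::complex) s (f :: real \<Rightarrow> complex) x. A * cnj (f (s - x)))"
  have Rd: "(R A s f has_vector_derivative - R A s f' x) (at x within {a..d})"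
    if f: "\<And>x. x \<in> {0..pi} \<Longrightarrow> (f has_vector_derivative f' x) (at x within {0..pi})"
      and x: "x \<in> {a..d}" and ad: "s - d \<ge> 0" "s - a \<le> pi" for A s f f' x a d
  proof -
    have "((\<lambda>x. s - x) has_vector_derivative - 1) (at x within {a..d})"
      by (auto intro!: derivative_eq_intros)
    moreover have "(f has_vector_derivative f' (s - x)) (at (s - x) within (\<lambda>x. s - x) ` {a..d})"
      by (rule has_vector_derivative_within_subset[OF f]) (use x ad in auto)
    ultimately have "((f \<circ> (\<lambda>x. s - x)) has_vector_derivative (- 1) *\<^sub>R f' (s - x)) (at x within {a..d})"
      by (rule vector_diff_chain_within)
    then have "((\<lambda>x. A * cnj ((f \<circ> (\<lambda>x. s - x)) x)) has_vector_derivative A * cnj ((- 1) *\<^sub>R f' (s - x))) (at x within {a..d})"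
      by (intro has_vector_derivative_mult_right has_vector_derivative_cnj)
    then show ?thesis by (simp add: R_def o_def)
  qed
  \<comment> \<open>Beyond pi/2 the argument pi/2 - x leaves the interval;
    \<open>y (x + pi) = E * y x\<close> and |E| = 1 turn \<open>cnj (y (pi/2 - x))\<close> into
    \<open>E * cnj (y (3*pi/2 - x))\<close>. The minus signs in \<open>z1\<close> come from the
    reflection.\<close>
  define z z1 where
    "z = (\<lambda>x. if x \<in> {0..pi/2} then R 1 (pi/2) y x else R E (3*pi/2) y x)" and
    "z1 = (\<lambda>x. if x \<in> {0..pi/2} then R (- 1) (pi/2) y1 x else R (- E) (3*pi/2) y1 x)"
  have pot: "potential c (pi/2 - x) = cnj (potential c x)" "potential c (3*pi/2 - x) = cnj (potential c x)" for x
  proof -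
    have "cos (pi - 2 * x) = - cos (2 * x)" by (simp add: cos_diff)
    moreover have "cos (3 * pi - 2 * x) = - cos (2 * x)"
      using cos_periodic[of "pi - 2 * x"] calculation by (simp add: algebra_simps)
    ultimately show "potential c (pi/2 - x) = cnj (potential c x)" "potential c (3*pi/2 - x) = cnj (potential c x)"
      by (simp_all add: potential_def right_diff_distrib)
  qed
  have un: "{0..pi} = {0..pi/2} \<union> {pi/2..pi}" by auto
  have glue: "((\<lambda>x. if x \<in> {0..pi/2} then f x else g x) has_vector_derivative
      (if x \<in> {0..pi/2} then f' x else g' x)) (at x within {0..pi})"
    if "x \<in> {0..pi}" "\<And>x. x \<in> {0..pi/2} \<Longrightarrow> (f has_vector_derivative f' x) (at x within {0..pi/2})"
      "\<And>x. x \<in> {pi/2..pi} \<Longrightarrow> (g has_vector_derivative g' x) (at x within {pi/2..pi})"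
      "f (pi/2) = g (pi/2)" "f' (pi/2) = g' (pi/2)" for f g f' g' :: "real \<Rightarrow> complex" and x
  proof (rule has_vector_derivative_If_within_closures[OF _ un])
    have cl: "closure {0..pi/2} = {0..pi/2}" "closure {pi/2..pi} = {pi/2..pi}" by simp_all
    have i: "{0..pi/2} \<inter> {pi/2..pi} = {pi/2}" by auto
    have u: "{0..pi/2} \<union> {pi/2} = {0..pi/2}" "{pi/2..pi} \<union> {pi/2} = {pi/2..pi}" by auto
    show "x \<in> {0..pi/2} \<union> {pi/2..pi}" using that(1) un by blast
    show "x \<in> {0..pi/2} \<union> closure {0..pi/2} \<inter> closure {pi/2..pi} \<Longrightarrow>
      (f has_vector_derivative f' x) (at x within {0..pi/2} \<union> closure {0..pi/2} \<inter> closure {pi/2..pi})"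
      unfolding cl i u by (rule that(2))
    show "x \<in> {pi/2..pi} \<union> closure {0..pi/2} \<inter> closure {pi/2..pi} \<Longrightarrow>
      (g has_vector_derivative g' x) (at x within {pi/2..pi} \<union> closure {0..pi/2} \<inter> closure {pi/2..pi})"
      unfolding cl i u by (rule that(3))
    assume "x \<in> closure {0..pi/2}" "x \<in> closure {pi/2..pi}"
    then have "x \<le> pi/2" "pi/2 \<le> x" by (simp_all only: cl atLeastAtMost_iff)
    then have eq: "x = pi/2" by (rule order_antisym)
    show "f x = g x" "f' x = g' x" unfolding eq by (rule that(4), rule that(5))
  qed
  have y0: "cnj (y 0) = E * cnj (y pi)" "cnj (y1 0) = E * cnj (y1 pi)"
    using E by (simp_all add: bc mult.assoc[symmetric])
  have "bloch c t (cnj \<mu>) z z1"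
    unfolding bloch_def
  proof (intro conjI ballI)
    fix x :: real assume x: "x \<in> {0..pi}"
    have eq1: "z1 x = (if x \<in> {0..pi/2} then - R 1 (pi/2) y1 x else - R E (3*pi/2) y1 x)"
      by (simp add: z1_def R_def)
    show "(z has_vector_derivative z1 x) (at x within {0..pi})"
      unfolding eq1 z_def
    proof (rule glue[OF x])
      show "(R 1 (pi/2) y has_vector_derivative - R 1 (pi/2) y1 x) (at x within {0..pi/2})"
        if "x \<in> {0..pi/2}" for x
        by (rule Rd[OF yd(1) that]) simp_all
      show "(R E (3*pi/2) y has_vector_derivative - R E (3*pi/2) y1 x) (at x within {pi/2..pi})"
        if "x \<in> {pi/2..pi}" for x
        by (rule Rd[OF yd(1) that]) simp_all
      show "R 1 (pi/2) y (pi/2) = R E (3*pi/2) y (pi/2)" by (simp add: R_def y0)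
      show "- R 1 (pi/2) y1 (pi/2) = - R E (3*pi/2) y1 (pi/2)" by (simp add: R_def y0)
    qed
    have eq2: "(potential c x - cnj \<mu>) * z x = (if x \<in> {0..pi/2}
        then - R (- 1) (pi/2) (\<lambda>x. (potential c x - \<mu>) * y x) x
        else - R (- E) (3*pi/2) (\<lambda>x. (potential c x - \<mu>) * y x) x)"
      by (simp add: z_def R_def pot)
    show "(z1 has_vector_derivative (potential c x - cnj \<mu>) * z x) (at x within {0..pi})"
      unfolding eq2 z1_def
    proof (rule glue[OF x])
      let ?f = "\<lambda>x. (potential c x - \<mu>) * y x"
      show "(R (- 1) (pi/2) y1 has_vector_derivative - R (- 1) (pi/2) ?f x) (at x within {0..pi/2})"
        if "x \<in> {0..pi/2}" for x
        by (rule Rd[OF yd(2) that]) simp_all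
      show "(R (- E) (3*pi/2) y1 has_vector_derivative - R (- E) (3*pi/2) ?f x) (at x within {pi/2..pi})"
        if "x \<in> {pi/2..pi}" for x
        by (rule Rd[OF yd(2) that]) simp_all
      show "R (- 1) (pi/2) y1 (pi/2) = R (- E) (3*pi/2) y1 (pi/2)" by (simp add: R_def y0)
      have "potential c pi = potential c 0" by (simp add: potential_def)
      then show "- R (- 1) (pi/2) ?f (pi/2) = - R (- E) (3*pi/2) ?f (pi/2)" by (simp add: R_def y0)
    qed
  next
    show "z pi = exp (\<i> * of_real (pi * t)) * z 0" "z1 pi = exp (\<i> * of_real (pi * t)) * z1 0"
      unfolding E_def[symmetric] by (simp_all add: z_def z1_def R_def)
  next
    obtain x where x: "x \<in> {0..pi}" "y x \<noteq> 0" using b by (auto simp: bloch_def)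
    show "\<exists>x\<in>{0..pi}. z x \<noteq> 0"
    proof (cases "x \<le> pi/2")
      case True
      then show ?thesis using x by (intro bexI[of _ "pi/2 - x"]) (auto simp: z_def R_def)
    next
      case False
      show ?thesis
      proof (cases "x = pi")
        \<comment> \<open>The witness 3pi/2 - x would be pi/2, which falls into the first branch of
          \<open>z\<close>; the boundary condition moves the nonzero value to 0.\<close>
        case True
        then have "y 0 \<noteq> 0" using x bc by auto
        then show ?thesis by (intro bexI[of _ "pi/2"]) (auto simp: z_def R_def)
      next
        case F: False
        then show ?thesis using x False
          by (intro bexI[of _ "3*pi/2 - x"]) (auto simp: z_def R_def E_def)
      qed
    qed
  qed
  then show ?thesis by (rule bloch_imp_is_eigenvalue)
qed

section \<open>Fourier coefficients of eigenfunctions\<close>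

definition floquet_rec :: "real \<Rightarrow> real \<Rightarrow> complex \<Rightarrow> (int \<Rightarrow> complex) \<Rightarrow> bool" where
  "floquet_rec c t \<mu> b \<longleftrightarrow>
     (\<forall>n. (of_real ((2 * of_int n + t)\<^sup>2) - \<mu>) * b n = of_real c * (b (n + 1) - b (n - 1)))"

text \<open>This is the rate that the recurrence gives for merely bounded coefficients. It supplies
  limits at both ends and an index of maximal modulus.\<close>

definition quadratic_decay :: "(int \<Rightarrow> complex) \<Rightarrow> bool" where
  "quadratic_decay b \<longleftrightarrow> (\<exists>M. \<forall>n. (1 + (real_of_int n)\<^sup>2) * norm (b n) \<le> M)"

text \<open>The coefficients are rotated by \<open>(-\<i>)\<^sup>n\<close>, which makes the recurrence real.\<close>

lemma is_eigenvalue_imp_floquet: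
  assumes "is_eigenvalue c t \<mu>" "t \<in> {0..1}"
  obtains b where "floquet_rec c t \<mu> b" "quadratic_decay b" "\<exists>n. b n \<noteq> 0"
proof -
  obtain y y1 where bl: "bloch c t \<mu> y y1" using assms is_eigenvalue_imp_bloch by blast
  note yc = bloch_continuous(1)[OF bl]
  have yd: "(y has_vector_derivative y1 x) (at x within {0..pi})"
    "(y1 has_vector_derivative (potential c x - \<mu>) * y x) (at x within {0..pi})"
    if "x \<in> {0..pi}" for x using bl that by (auto simp: bloch_def)
  define \<omega> where "\<omega> = (\<lambda>n::int. 2 * real_of_int n + t)"
  \<comment> \<open>Conjugated exponentials of frequency 2n + t; the extra phase n pi/2 absorbs the
    factor \<open>\<i>\<close> of the potential, see \<open>e_diff\<close>.\<close>
  define e where "e = (\<lambda>n x. exp (- (\<i> * of_real (\<omega> n * x + of_int n * (pi / 2)))))"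
  have ed: "(e n has_vector_derivative - (\<i> * of_real (\<omega> n)) * e n x) (at x within S)" for n x S
  proof -
    have "((\<lambda>x. of_real (\<omega> n * x + of_int n * (pi / 2))) has_vector_derivative complex_of_real (\<omega> n)) (at x within S)"
      by (rule has_vector_derivative_of_real) (auto intro!: derivative_eq_intros)
    then have "((\<lambda>x. - (\<i> * of_real (\<omega> n * x + of_int n * (pi / 2)))) has_vector_derivative - (\<i> * of_real (\<omega> n))) (at x within S)"
      by (intro has_vector_derivative_minus has_vector_derivative_mult_right)
    from field_vector_diff_chain_within[OF this DERIV_subset[OF DERIV_exp subset_UNIV]]
    show ?thesis by (simp add: e_def o_def)
  qed
  have ec: "continuous_on S (e n)" for n S unfolding e_def by (intro continuous_intros)
  have ne: "norm (e n x) = 1" for n x unfolding e_def by (simp only: norm_exp_eq_Re) simp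
  have e_diff: "of_real c * (e (n - 1) x - e (n + 1) x) = potential c x * e n x" for n x
  proof -
    have e: "e (n - 1) x = e n x * exp (\<i> * of_real (2 * x)) * exp (\<i> * of_real (pi / 2))"
      "e (n + 1) x = e n x * exp (- (\<i> * of_real (2 * x))) * exp (- (\<i> * of_real (pi / 2)))"
      unfolding e_def \<omega>_def exp_add[symmetric]
      by (intro arg_cong[where f = exp], simp add: algebra_simps add_divide_distrib diff_divide_distrib)+
    have half: "exp (\<i> * of_real (pi / 2)) = \<i>"
      by (simp only: cis_conv_exp[symmetric] cis_pi_half)
    have half': "exp (- (\<i> * of_real (pi / 2))) = - \<i>" by (simp only: exp_minus half) simp
    have cos2: "exp (\<i> * of_real (2 * x)) + exp (- (\<i> * of_real (2 * x))) = 2 * of_real (cos (2 * x))"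
      by (simp only: exp_minus cis_conv_exp[symmetric] cis_inverse) (simp add: complex_eq_iff)
    have "of_real c * (e (n - 1) x - e (n + 1) x) =
        of_real c * \<i> * e n x * (exp (\<i> * of_real (2 * x)) + exp (- (\<i> * of_real (2 * x))))"
      unfolding e half half' by (simp add: algebra_simps)
    also have "\<dots> = potential c x * e n x"
      unfolding cos2 potential_def by (simp only: mult_ac)
    finally show ?thesis .
  qed
  define b where "b = (\<lambda>n. integral {0..pi} (\<lambda>x. y x * e n x))"
  have yei: "(\<lambda>x. y x * e n x) integrable_on {0..pi}" for n
    by (intro integrable_continuous_real continuous_intros yc ec)
  have rec: "floquet_rec c t \<mu> b"
    unfolding floquet_rec_def
  proof
    fix n
    \<comment> \<open>The boundary form of two integrations by parts: the \<open>y1\<close> terms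
      cancel in its derivative, and it takes equal values at 0 and pi because the multiplier of
      \<open>y\<close> is inverse to that of \<open>e n\<close>.\<close>
    define U where "U = (\<lambda>x. y1 x * e n x + \<i> * of_real (\<omega> n) * (y x * e n x))"
    have "(U has_vector_derivative (potential c x - \<mu> + of_real ((\<omega> n)\<^sup>2)) * (y x * e n x)) (at x within {0..pi})"
      if x: "x \<in> {0..pi}" for x
      unfolding U_def
      by (rule derivative_eq_intros has_vector_derivative_mult_right yd[OF x] ed refl)+
        (simp add: algebra_simps power2_eq_square)
    then have "((\<lambda>x. (potential c x - \<mu> + of_real ((\<omega> n)\<^sup>2)) * (y x * e n x)) has_integral (U pi - U 0)) {0..pi}"
      by (intro fundamental_theorem_of_calculus) auto
    moreover have "U pi = U 0"
    proof -
      have "e n pi = exp (- (\<i> * of_real (pi * t))) * e n 0"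
      proof -
        have "e n pi = exp (- (\<i> * of_real (pi * t))) * e n 0 * exp (- (2 * of_int n * of_real pi * \<i>))"
          unfolding e_def \<omega>_def exp_add[symmetric] by (intro arg_cong[where f = exp]) (simp add: algebra_simps)
        also have "exp (- (2 * of_int n * of_real pi * \<i>)) = 1"
          using exp_integer_2pi[of "- of_int n"] by simp
        finally show ?thesis by simp
      qed
      moreover have "exp (\<i> * of_real (pi * t)) * exp (- (\<i> * of_real (pi * t))) = 1"
        by (simp add: exp_add[symmetric])
      ultimately have "y1 pi * e n pi = y1 0 * e n 0" "y pi * e n pi = y 0 * e n 0"
        using bl unfolding bloch_def by (simp_all add: mult_ac)
      then show ?thesis by (simp add: U_def)
    qed
    ultimately have "((\<lambda>x. (of_real ((\<omega> n)\<^sup>2) - \<mu>) * (y x * e n x)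
        + of_real c * (y x * e (n - 1) x - y x * e (n + 1) x)) has_integral 0) {0..pi}"
    proof (simp, elim has_integral_eq[rotated])
      fix x
      have "of_real c * (y x * e (n - 1) x - y x * e (n + 1) x) = y x * (potential c x * e n x)"
        unfolding e_diff[symmetric] by (simp add: algebra_simps)
      then show "(potential c x - \<mu> + (of_real (\<omega> n))\<^sup>2) * (y x * e n x) =
        ((of_real (\<omega> n))\<^sup>2 - \<mu>) * (y x * e n x) + of_real c * (y x * e (n - 1) x - y x * e (n + 1) x)"
        by (simp add: algebra_simps)
    qed
    moreover have "((\<lambda>x. (of_real ((\<omega> n)\<^sup>2) - \<mu>) * (y x * e n x)
        + of_real c * (y x * e (n - 1) x - y x * e (n + 1) x)) has_integral
        ((of_real ((\<omega> n)\<^sup>2) - \<mu>) * b n + of_real c * (b (n - 1) - b (n + 1)))) {0..pi}"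
      unfolding b_def
      by (intro has_integral_add has_integral_mult_right has_integral_diff integrable_integral yei)
    ultimately have "(of_real ((\<omega> n)\<^sup>2) - \<mu>) * b n + of_real c * (b (n - 1) - b (n + 1)) = 0"
      using has_integral_unique by blast
    then show "(of_real ((2 * of_int n + t)\<^sup>2) - \<mu>) * b n = of_real c * (b (n + 1) - b (n - 1))"
      unfolding \<omega>_def add_eq_0_iff2 by (simp add: algebra_simps)
  qed
  have dec: "quadratic_decay b"
    unfolding quadratic_decay_def
  proof (intro exI allI)
    fix n :: int
    define B where "B = integral {0..pi} (\<lambda>x. norm (y x))"
    have bB: "norm (b n) \<le> B" for n
      unfolding b_def B_def
      by (intro integral_norm_bound_integral yei integrable_continuous_real continuous_intros yc)
        (simp add: norm_mult ne)
    have "norm (of_real ((\<omega> n)\<^sup>2) - \<mu>) * norm (b n) = \<bar>c\<bar> * norm (b (n + 1) - b (n - 1))"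
      using rec unfolding floquet_rec_def \<omega>_def by (metis norm_mult norm_of_real)
    also have "\<dots> \<le> \<bar>c\<bar> * (2 * B)"
      using norm_triangle_ineq4[of "b (n+1)" "b (n-1)"] bB[of "n+1"] bB[of "n-1"]
      by (intro mult_left_mono) auto
    finally have 1: "norm (of_real ((\<omega> n)\<^sup>2) - \<mu>) * norm (b n) \<le> \<bar>c\<bar> * (2 * B)" .
    have "norm (complex_of_real ((\<omega> n)\<^sup>2)) \<le> norm (of_real ((\<omega> n)\<^sup>2) - \<mu>) + norm \<mu>"
      using norm_triangle_ineq[of "of_real ((\<omega> n)\<^sup>2) - \<mu>" \<mu>] by simp
    then have 2: "(\<omega> n)\<^sup>2 \<le> norm (of_real ((\<omega> n)\<^sup>2) - \<mu>) + norm \<mu>" by (simp only: norm_of_real)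
    have "\<bar>real_of_int n\<bar> \<le> \<bar>\<omega> n\<bar>"
    proof (cases "n = 0")
      case False
      then have "1 \<le> \<bar>real_of_int n\<bar>" by simp
      then show ?thesis using assms(2) by (auto simp: \<omega>_def abs_if)
    qed simp
    then have "(real_of_int n)\<^sup>2 \<le> (\<omega> n)\<^sup>2" by (simp add: abs_le_square_iff)
    then have "(1 + (real_of_int n)\<^sup>2) * norm (b n) \<le> (1 + (norm (of_real ((\<omega> n)\<^sup>2) - \<mu>) + norm \<mu>)) * norm (b n)"
      using 2 by (intro mult_right_mono) auto
    also have "\<dots> \<le> B + \<bar>c\<bar> * (2 * B) + norm \<mu> * B"
      using 1 bB[of n] mult_left_mono[OF bB[of n], of "norm \<mu>"] by (simp add: algebra_simps)
    finally show "(1 + (real_of_int n)\<^sup>2) * norm (b n) \<le> B + \<bar>c\<bar> * (2 * B) + norm \<mu> * B" .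
  qed
  have nz: "\<exists>n. b n \<noteq> 0"
  proof (rule ccontr)
    assume "\<not> ?thesis"
    then have b0: "b n = 0" for n by simp
    \<comment> \<open>Removing the factor exp(itx) makes \<open>y\<close> periodic with period pi,
      and the Fourier coefficients of \<open>f\<close> are unimodular multiples of the
      \<open>b (- n)\<close>.\<close>
    define f where "f = (\<lambda>x. y x * exp (- (\<i> * of_real (t * x))))"
    have "f x = 0" if x: "x \<in> {0..pi}" for x
    proof (rule trigonometric_system_complete[OF _ _ _ x])
      show "continuous_on {0..pi} f" unfolding f_def by (intro continuous_intros yc)
      have "y pi = exp (\<i> * of_real (pi * t)) * y 0" using bl by (simp add: bloch_def)
      then have "f pi = y 0 * (exp (\<i> * of_real (pi * t)) * exp (- (\<i> * of_real (t * pi))))"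
        by (simp add: f_def mult_ac)
      also have "exp (\<i> * of_real (pi * t)) * exp (- (\<i> * of_real (t * pi))) = 1"
        by (simp add: exp_add[symmetric] mult.commute)
      finally show "f pi = f 0" by (simp add: f_def)
      fix n :: int
      define A where "A = exp (- (\<i> * of_real (of_int n * (pi / 2))))"
      have "f x * cis (2 * of_int n * x) = A * (y x * e (- n) x)" for x
      proof -
        have "exp (- (\<i> * of_real (t * x))) * cis (2 * of_int n * x) = A * e (- n) x"
          unfolding cis_conv_exp A_def e_def \<omega>_def exp_add[symmetric]
          by (intro arg_cong[where f = exp]) (simp add: algebra_simps)
        then show ?thesis unfolding f_def by (metis mult.assoc mult.left_commute)
      qed
      then have "integral {0..pi} (\<lambda>x. f x * cis (2 * of_int n * x)) = A * b (- n)"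
        by (simp add: b_def)
      then show "integral {0..pi} (\<lambda>x. f x * cis (2 * of_int n * x)) = 0" by (simp add: b0)
    qed
    then have "y x = 0" if "x \<in> {0..pi}" for x using that by (simp add: f_def)
    then show False using bl by (auto simp: bloch_def)
  qed
  show thesis using that rec dec nz by blast
qed

section \<open>Maximal coefficients and localization near the centers\<close>

lemma quadratic_decay_tendsto_zero:
  assumes "quadratic_decay b"
  shows "(\<lambda>K::nat. b (int K + a)) \<longlonglongrightarrow> 0" "(\<lambda>K::nat. b (a - int K)) \<longlonglongrightarrow> 0"
proof -
  obtain M where M: "\<And>n. (1 + (real_of_int n)\<^sup>2) * norm (b n) \<le> M"
    using assms by (auto simp: quadratic_decay_def)
  have le: "norm (b n) \<le> M / (1 + (real_of_int n)\<^sup>2)" for n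
    using M[of n] by (simp add: field_simps add_pos_nonneg)
  have "(\<lambda>K::nat. M / (1 + (real K + a)\<^sup>2)) \<longlonglongrightarrow> 0" by real_asymp
  then show "(\<lambda>K::nat. b (int K + a)) \<longlonglongrightarrow> 0"
    by (rule Lim_null_comparison[rotated]) (use le in \<open>auto intro!: always_eventually\<close>, metis le of_int_add of_int_of_nat_eq)
  have "(\<lambda>K::nat. M / (1 + (a - real K)\<^sup>2)) \<longlonglongrightarrow> 0" by real_asymp
  then show "(\<lambda>K::nat. b (a - int K)) \<longlonglongrightarrow> 0"
    by (rule Lim_null_comparison[rotated]) (use le in \<open>auto intro!: always_eventually\<close>, metis le of_int_diff of_int_of_nat_eq)
qed

text \<open>Decay leaves only finitely many indices whose coefficient is at least as large as
  \<open>b m\<close>, so a maximum over all integers is attained.\<close>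

lemma quadratic_decay_argmax:
  assumes "quadratic_decay b" and nz: "b m \<noteq> 0"
  obtains N where "\<And>n. norm (b n) \<le> norm (b N)" "b N \<noteq> 0"
proof -
  obtain M where M: "\<And>n. (1 + (real_of_int n)\<^sup>2) * norm (b n) \<le> M"
    using assms by (auto simp: quadratic_decay_def)
  define S where "S = {n. norm (b m) \<le> norm (b n)}"
  define L where "L = \<lceil>M / norm (b m)\<rceil>"
  have "S \<subseteq> {- L..L}"
  proof
    fix n assume "n \<in> S"
    then have "(1 + (real_of_int n)\<^sup>2) * norm (b m) \<le> (1 + (real_of_int n)\<^sup>2) * norm (b n)"
      by (intro mult_left_mono) (auto simp: S_def)
    then have 1: "1 + (real_of_int n)\<^sup>2 \<le> M / norm (b m)"
      using M[of n] nz by (simp add: field_simps)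
    have "2 * \<bar>real_of_int n\<bar> \<le> 1 + (real_of_int n)\<^sup>2"
      using zero_le_power2[of "\<bar>real_of_int n\<bar> - 1"] by (simp add: power2_diff)
    then have "\<bar>real_of_int n\<bar> \<le> M / norm (b m)" using 1 by linarith
    then have "\<bar>real_of_int n\<bar> \<le> real_of_int L" unfolding L_def by linarith
    then show "n \<in> {- L..L}" by auto
  qed
  then have fin: "finite S" using finite_subset by blast
  have mS: "m \<in> S" by (simp add: S_def)
  obtain N where N: "N \<in> S" "norm (b N) = Max ((\<lambda>n. norm (b n)) ` S)"
    using Max_in[of "(\<lambda>n. norm (b n)) ` S"] fin mS by fastforce
  have N2: "norm (b n) \<le> norm (b N)" if "n \<in> S" for n
    using that fin by (simp add: N(2))
  have "norm (b n) \<le> norm (b N)" for n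
    using N(1) N2[of n] by (cases "n \<in> S") (auto simp: S_def)
  moreover have "b N \<noteq> 0" using N(1) nz by (auto simp: S_def)
  ultimately show thesis by (rule that)
qed

text \<open>At an index \<open>N\<close> where \<open>\<bar>b\<^sub>N\<bar>\<close> is maximal the recurrence gives the first bound; inserting
  it at \<open>N \<plusminus> 1\<close> bounds the neighbours of \<open>b\<^sub>N\<close>, which gives the second one.\<close>

lemma eigenvalue_localization:
  assumes ev: "is_eigenvalue c t \<mu>" "t \<in> {0..1}" and c: "c > 0"
  obtains N :: int where "norm (\<mu> - of_real ((2 * of_int N + t)\<^sup>2)) \<le> 2 * c"
    "norm (\<mu> - of_real ((2 * of_int N + t)\<^sup>2)) * (4 * (\<bar>2 * of_int N + t\<bar> - 1) - 2 * c) \<le> 4 * c\<^sup>2"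
proof -
  obtain b where rec: "floquet_rec c t \<mu> b" and dec: "quadratic_decay b" and nz: "\<exists>n. b n \<noteq> 0"
    using is_eigenvalue_imp_floquet[OF ev] by blast
  obtain N where N: "\<And>n. norm (b n) \<le> norm (b N)" "b N \<noteq> 0"
    using nz quadratic_decay_argmax[OF dec] by blast
  define \<omega> where "\<omega> = (\<lambda>n::int. 2 * real_of_int n + t)"
  define d where "d = (\<lambda>n. norm (\<mu> - of_real ((\<omega> n)\<^sup>2)))"
  define q where "q = norm (b N)"
  have q: "q > 0" using N by (simp add: q_def)
  have eq: "d n * norm (b n) = c * norm (b (n + 1) - b (n - 1))" for n
  proof -
    have "norm ((of_real ((\<omega> n)\<^sup>2) - \<mu>) * b n) = norm (of_real c * (b (n + 1) - b (n - 1)))"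
      using rec unfolding floquet_rec_def \<omega>_def by metis
    then show ?thesis using c unfolding d_def by (simp add: norm_mult norm_minus_commute)
  qed
  have tri: "norm (b (n + 1) - b (n - 1)) \<le> norm (b (n + 1)) + norm (b (n - 1))" for n
    by (rule norm_triangle_ineq4)
  have le: "d n * norm (b n) \<le> c * (2 * q)" for n
    unfolding eq using tri[of n] N(1)[of "n+1"] N(1)[of "n-1"] c by (intro mult_left_mono) (auto simp: q_def)
  have "d N * q \<le> 2 * c * q" using le[of N] by (simp add: q_def mult_ac)
  then have dN: "d N \<le> 2 * c" using q by simp
  \<comment> \<open>A lower bound for \<open>d\<close> at both neighbours of \<open>N\<close>:
    adjacent centers differ by at least 4(|omega N| - 1), and \<open>\<mu>\<close> is within 2c of
    the center of \<open>N\<close>.\<close>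
  define D where "D = 4 * (\<bar>\<omega> N\<bar> - 1) - 2 * c"
  have "d N * D \<le> 4 * c\<^sup>2"
  proof (cases "D > 0")
    case False
    then have "d N * D \<le> 0" by (intro mult_nonneg_nonpos) (auto simp: d_def)
    then show ?thesis using zero_le_power2[of c] by linarith
  next
    case True
    have nb: "D * norm (b m) \<le> 2 * c * q" if m: "m = N + 1 \<or> m = N - 1" for m
    proof -
      have "4 * (\<bar>\<omega> N\<bar> - 1) \<le> \<bar>(\<omega> m)\<^sup>2 - (\<omega> N)\<^sup>2\<bar>"
      proof -
        have "(\<omega> m)\<^sup>2 - (\<omega> N)\<^sup>2 = 4 * \<omega> N + 4" if "\<omega> m = \<omega> N + 2"
          unfolding that by (simp add: power2_eq_square algebra_simps)
        moreover have "(\<omega> m)\<^sup>2 - (\<omega> N)\<^sup>2 = 4 - 4 * \<omega> N" if "\<omega> m = \<omega> N - 2"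
          unfolding that by (simp add: power2_eq_square algebra_simps)
        moreover have "\<omega> m = \<omega> N + 2 \<or> \<omega> m = \<omega> N - 2" using m by (auto simp: \<omega>_def)
        ultimately have "(\<omega> m)\<^sup>2 - (\<omega> N)\<^sup>2 = 4 * \<omega> N + 4 \<or> (\<omega> m)\<^sup>2 - (\<omega> N)\<^sup>2 = 4 - 4 * \<omega> N"
          by blast
        then show ?thesis
        proof
          assume e: "(\<omega> m)\<^sup>2 - (\<omega> N)\<^sup>2 = 4 * \<omega> N + 4"
          show ?thesis unfolding e using abs_triangle_ineq2[of "4 * \<omega> N" "- 4"] by (simp add: abs_mult)
        next
          assume e: "(\<omega> m)\<^sup>2 - (\<omega> N)\<^sup>2 = 4 - 4 * \<omega> N"
          show ?thesis unfolding e using abs_triangle_ineq2_sym[of "4 * \<omega> N" 4] by (simp add: abs_mult)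
        qed
      qed
      also have "\<dots> = norm (complex_of_real ((\<omega> m)\<^sup>2) - of_real ((\<omega> N)\<^sup>2))"
        by (simp only: norm_of_real flip: of_real_diff)
      also have "\<dots> \<le> d m + d N"
        unfolding d_def using norm_triangle_ineq4[of "\<mu> - of_real ((\<omega> N)\<^sup>2)" "\<mu> - of_real ((\<omega> m)\<^sup>2)"] by simp
      finally have "D \<le> d m" using dN by (simp add: D_def)
      then have "D * norm (b m) \<le> d m * norm (b m)" by (intro mult_right_mono) auto
      then show ?thesis using le[of m] by simp
    qed
    have "d N * q \<le> c * (norm (b (N + 1)) + norm (b (N - 1)))"
      using eq[of N] tri[of N] c by (simp add: q_def)
    then have "D * (d N * q) \<le> D * (c * (norm (b (N + 1)) + norm (b (N - 1))))"
      using True by (intro mult_left_mono) auto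
    also have "\<dots> = c * (D * norm (b (N + 1)) + D * norm (b (N - 1)))" by (simp add: algebra_simps)
    also have "\<dots> \<le> c * (2 * c * q + 2 * c * q)" using nb[of "N+1"] nb[of "N-1"] c by (intro mult_left_mono) auto
    finally have "(d N * D) * q \<le> (4 * c\<^sup>2) * q" by (simp add: algebra_simps power2_eq_square)
    then show ?thesis using q by simp
  qed
  then show thesis using that[of N] dN by (simp add: d_def D_def \<omega>_def)
qed

lemma sum_symmetric_interval_telescope:
  fixes g :: "int \<Rightarrow> 'a::ab_group_add"
  shows "(\<Sum>n\<in>{- int K..int K}. g n - g (n - 1)) = g (int K) - g (- int K - 1)"
proof (induction K)
  case (Suc K)
  have "{- int (Suc K)..int (Suc K)} = insert (- int K - 1) (insert (int K + 1) {- int K..int K})" by auto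
  then show ?case using Suc by (simp add: algebra_simps)
qed simp

text \<open>For nonreal \<open>\<mu>\<close> the even and the odd coefficients have the same square sum.  If every center
  \<open>(2n + t)\<^sup>2\<close> of one parity were further than \<open>2c\<close> from \<open>\<mu>\<close>, the recurrence would make the square
  sum of that parity strictly smaller than the other one.\<close>

lemma nonreal_eigenvalue_near_both_parities:
  assumes ev: "is_eigenvalue c t \<mu>" "t \<in> {0..1}" and c: "c > 0" and im: "\<mu> \<notin> \<real>"
  obtains N :: int where "even N = P" "norm (\<mu> - of_real ((2 * of_int N + t)\<^sup>2)) \<le> 2 * c"
proof (rule ccontr)
  assume nt: "\<not> thesis"
  note obt = that
  define \<omega> where "\<omega> = (\<lambda>n::int. 2 * real_of_int n + t)"
  define d where "d = (\<lambda>n. norm (\<mu> - of_real ((\<omega> n)\<^sup>2)))"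
  have far: "d n > 2 * c" if "even n = P" for n
    unfolding d_def \<omega>_def using nt obt[OF that] by (meson not_le)
  obtain b where rec: "floquet_rec c t \<mu> b" and dec: "quadratic_decay b" and nz: "\<exists>n. b n \<noteq> 0"
    using is_eigenvalue_imp_floquet[OF ev] by blast
  have rec': "(of_real ((\<omega> n)\<^sup>2) - \<mu>) * b n = of_real c * (b (n + 1) - b (n - 1))" for n
    using rec unfolding floquet_rec_def \<omega>_def by blast
  define I where "I = (\<lambda>K::nat. {- int K..int K})"
  \<comment> \<open>Multiplying the recurrence by \<open>cnj (b n)\<close> and subtracting the
    conjugate equation leaves terms that telescope only with alternating signs, because the coupling
    is antisymmetric. \<open>C\<close> is the resulting flux.\<close>
  define \<sigma> where "\<sigma> = (\<lambda>n::int. if even n = P then 1 else - 1 :: complex)"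
  define C where "C = (\<lambda>n. \<sigma> n * (cnj (b n) * b (n + 1) - b n * cnj (b (n + 1))))"
  have t0: "(\<lambda>K. b (int K + a)) \<longlonglongrightarrow> 0" "(\<lambda>K. b (a - int K)) \<longlonglongrightarrow> 0" for a
    using quadratic_decay_tendsto_zero[OF dec] by auto
  have step: "(cnj \<mu> - \<mu>) * (\<sigma> n * (b n * cnj (b n))) = of_real c * (C n - C (n - 1))" for n
  proof -
    have r2: "(of_real ((\<omega> n)\<^sup>2) - cnj \<mu>) * cnj (b n) = of_real c * (cnj (b (n + 1)) - cnj (b (n - 1)))"
      using arg_cong[OF rec'[of n], of cnj] by simp
    have s: "\<sigma> (n - 1) = - \<sigma> n" by (simp add: \<sigma>_def)
    have "(cnj \<mu> - \<mu>) * (\<sigma> n * (b n * cnj (b n))) =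
      \<sigma> n * (cnj (b n) * ((of_real ((\<omega> n)\<^sup>2) - \<mu>) * b n) - b n * ((of_real ((\<omega> n)\<^sup>2) - cnj \<mu>) * cnj (b n)))"
      by (simp add: algebra_simps)
    also have "\<dots> = \<sigma> n * (cnj (b n) * (of_real c * (b (n + 1) - b (n - 1)))
        - b n * (of_real c * (cnj (b (n + 1)) - cnj (b (n - 1)))))"
      unfolding rec' r2 ..
    also have "\<dots> = of_real c * (C n - C (n - 1))"
      unfolding C_def s by (simp add: algebra_simps)
    finally show ?thesis .
  qed
  define v where "v = (\<lambda>n. if even n = P then (norm (b n))\<^sup>2 else 0)"
  define u where "u = (\<lambda>n. if even n = P then 0 else (norm (b n))\<^sup>2)"
  have uv0: "u n \<ge> 0" "v n \<ge> 0" for n by (simp_all add: u_def v_def)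
  have "(\<lambda>K. of_real c * (C (int K) - C (- int K - 1))) \<longlonglongrightarrow> of_real c * (0 - 0)"
  proof (rule tendsto_mult[OF tendsto_const tendsto_diff])
    have prod0: "(\<lambda>K. 2 * (norm (X K) * norm (Y K))) \<longlonglongrightarrow> 0"
      if "X \<longlonglongrightarrow> 0" "Y \<longlonglongrightarrow> 0" for X Y :: "nat \<Rightarrow> complex"
      using tendsto_mult[OF tendsto_const[of 2] tendsto_mult[OF tendsto_norm[OF that(1)] tendsto_norm[OF that(2)]]]
      by simp
    have C_le: "norm (C n) \<le> 2 * (norm (b n) * norm (b (n + 1)))" for n
    proof -
      have "norm (C n) = norm (cnj (b n) * b (n + 1) - b n * cnj (b (n + 1)))"
        by (simp add: C_def \<sigma>_def norm_mult)
      also have "\<dots> \<le> norm (cnj (b n) * b (n + 1)) + norm (b n * cnj (b (n + 1)))" by (rule norm_triangle_ineq4)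
      finally show ?thesis by (simp add: norm_mult)
    qed
    have "(\<lambda>K. 2 * (norm (b (int K)) * norm (b (int K + 1)))) \<longlonglongrightarrow> 0"
      using prod0[OF t0(1)[of 0] t0(1)[of 1]] by simp
    then show "(\<lambda>K. C (int K)) \<longlonglongrightarrow> 0"
      by (rule Lim_null_comparison[rotated]) (intro always_eventually allI C_le)
    have "(\<lambda>K. 2 * (norm (b (- 1 - int K)) * norm (b (0 - int K)))) \<longlonglongrightarrow> 0"
      by (rule prod0[OF t0(2) t0(2)])
    moreover have "norm (C (- int K - 1)) \<le> 2 * (norm (b (- 1 - int K)) * norm (b (0 - int K)))" for K
    proof -
      have idx: "- int K - 1 = - 1 - int K" by simp
      show ?thesis unfolding idx using C_le[of "- 1 - int K"] by simp
    qed
    ultimately show "(\<lambda>K. C (- int K - 1)) \<longlonglongrightarrow> 0"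
      by (intro Lim_null_comparison[of "\<lambda>K. C (- int K - 1)"] always_eventually allI)
  qed
  moreover have "of_real c * (C (int K) - C (- int K - 1)) = (cnj \<mu> - \<mu>) * of_real ((\<Sum>n\<in>I K. v n) - (\<Sum>n\<in>I K. u n))" for K
  proof -
    have "of_real c * (C (int K) - C (- int K - 1)) = (\<Sum>n\<in>I K. of_real c * (C n - C (n - 1)))"
      unfolding I_def by (simp add: sum_symmetric_interval_telescope flip: sum_distrib_left)
    also have "\<dots> = (\<Sum>n\<in>I K. (cnj \<mu> - \<mu>) * of_real (v n - u n))"
      unfolding step[symmetric] by (intro sum.cong refl) (simp add: \<sigma>_def u_def v_def complex_norm_square del: of_real_power)
    finally show ?thesis by (simp add: sum_subtractf flip: sum_distrib_left of_real_sum)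
  qed
  ultimately have "(\<lambda>K. (cnj \<mu> - \<mu>) * of_real ((\<Sum>n\<in>I K. v n) - (\<Sum>n\<in>I K. u n))) \<longlonglongrightarrow> 0" by simp
  then have "(\<lambda>K. (cnj \<mu> - \<mu>) * of_real ((\<Sum>n\<in>I K. v n) - (\<Sum>n\<in>I K. u n)) / (cnj \<mu> - \<mu>)) \<longlonglongrightarrow> 0 / (cnj \<mu> - \<mu>)"
    using im by (intro tendsto_divide tendsto_const) (auto simp: complex_eq_iff complex_is_Real_iff)
  moreover have "cnj \<mu> - \<mu> \<noteq> 0" using im by (auto simp: complex_eq_iff complex_is_Real_iff)
  ultimately have "(\<lambda>K. complex_of_real ((\<Sum>n\<in>I K. v n) - (\<Sum>n\<in>I K. u n))) \<longlonglongrightarrow> of_real 0" by simp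
  then have diff: "(\<lambda>K. (\<Sum>n\<in>I K. v n) - (\<Sum>n\<in>I K. u n)) \<longlonglongrightarrow> 0" by (simp only: tendsto_of_real_iff)
  have loc: "(d n)\<^sup>2 * v n \<le> 2 * c\<^sup>2 * (u (n - 1) + u (n + 1))" for n
  proof (cases "even n = P")
    case True
    have "d n * norm (b n) = c * norm (b (n + 1) - b (n - 1))"
    proof -
      have "norm ((of_real ((\<omega> n)\<^sup>2) - \<mu>) * b n) = norm (of_real c * (b (n + 1) - b (n - 1)))"
        by (simp only: rec')
      then show ?thesis using c unfolding d_def by (simp add: norm_mult norm_minus_commute)
    qed
    also have "\<dots> \<le> c * (norm (b (n + 1)) + norm (b (n - 1)))"
      using c by (intro mult_left_mono norm_triangle_ineq4) auto
    finally have "(d n * norm (b n))\<^sup>2 \<le> (c * (norm (b (n + 1)) + norm (b (n - 1))))\<^sup>2"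
      by (intro power_mono) (auto simp: d_def)
    also have "\<dots> = c\<^sup>2 * (norm (b (n + 1)) + norm (b (n - 1)))\<^sup>2" by (rule power_mult_distrib)
    also have "\<dots> \<le> c\<^sup>2 * (2 * (u (n - 1) + u (n + 1)))"
    proof (intro mult_left_mono)
      have "u (n - 1) = (norm (b (n - 1)))\<^sup>2" "u (n + 1) = (norm (b (n + 1)))\<^sup>2"
        using True by (auto simp: u_def)
      then show "(norm (b (n + 1)) + norm (b (n - 1)))\<^sup>2 \<le> 2 * (u (n - 1) + u (n + 1))"
        using sum_squares_bound[of "norm (b (n + 1))" "norm (b (n - 1))"] by (simp add: power2_sum)
    qed simp
    finally show ?thesis using True by (simp add: v_def power_mult_distrib algebra_simps)
  next
    case False
    then show ?thesis using uv0[of "n - 1"] uv0[of "n + 1"] by (simp add: v_def)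
  qed
  \<comment> \<open>Shifting a window {-K..K} by one costs one end term. So the error consists of
    the difference of the two square sums, which tends to 0, and of decaying end terms.\<close>
  define \<epsilon> where "\<epsilon> = (\<lambda>K. 4 * c\<^sup>2 * ((\<Sum>n\<in>I K. u n) - (\<Sum>n\<in>I K. v n)) + 2 * c\<^sup>2 * (u (int K + 1) + u (- int K - 1)))"
  have bound: "(\<Sum>n\<in>I K. ((d n)\<^sup>2 - 4 * c\<^sup>2) * v n) \<le> \<epsilon> K" for K
  proof -
    have s1: "(\<Sum>n\<in>I K. u (n - 1)) \<le> (\<Sum>n\<in>I K. u n) + u (- int K - 1)"
      using sum_symmetric_interval_telescope[of u K] uv0(1)[of "int K"] by (simp add: I_def sum_subtractf)
    have s2: "(\<Sum>n\<in>I K. u (n + 1)) \<le> (\<Sum>n\<in>I K. u n) + u (int K + 1)"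
      using sum_symmetric_interval_telescope[of "\<lambda>n. u (n + 1)" K] uv0(1)[of "- int K"] by (simp add: I_def sum_subtractf)
    have "(\<Sum>n\<in>I K. (d n)\<^sup>2 * v n) \<le> (\<Sum>n\<in>I K. 2 * c\<^sup>2 * (u (n - 1) + u (n + 1)))"
      by (intro sum_mono loc)
    also have "\<dots> = 2 * c\<^sup>2 * ((\<Sum>n\<in>I K. u (n - 1)) + (\<Sum>n\<in>I K. u (n + 1)))"
      by (simp add: sum.distrib flip: sum_distrib_left)
    also have "\<dots> \<le> 2 * c\<^sup>2 * (((\<Sum>n\<in>I K. u n) + u (- int K - 1)) + ((\<Sum>n\<in>I K. u n) + u (int K + 1)))"
      using s1 s2 by (intro mult_left_mono add_mono) auto
    finally show ?thesis
      by (simp add: \<epsilon>_def left_diff_distrib sum_subtractf flip: sum_distrib_left) (simp add: algebra_simps)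
  qed
  have u_lim: "(\<lambda>K. u (int K + 1)) \<longlonglongrightarrow> 0" "(\<lambda>K. u (- int K - 1)) \<longlonglongrightarrow> 0"
  proof -
    have u_le: "norm (u n) \<le> (norm (b n))\<^sup>2" for n by (simp add: u_def)
    have sq: "(\<lambda>K. (norm (b (int K + 1)))\<^sup>2) \<longlonglongrightarrow> 0" "(\<lambda>K. (norm (b (- 1 - int K)))\<^sup>2) \<longlonglongrightarrow> 0"
      using tendsto_power[OF tendsto_norm[OF t0(1)[of 1]], of 2] tendsto_power[OF tendsto_norm[OF t0(2)[of "- 1"]], of 2]
      by simp_all
    have idx: "- int K - 1 = - 1 - int K" for K by simp
    show "(\<lambda>K. u (int K + 1)) \<longlonglongrightarrow> 0"
      by (rule Lim_null_comparison[OF _ sq(1)]) (intro always_eventually allI u_le)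
    show "(\<lambda>K. u (- int K - 1)) \<longlonglongrightarrow> 0"
      unfolding idx by (rule Lim_null_comparison[OF _ sq(2)]) (intro always_eventually allI u_le)
  qed
  have "(\<lambda>K. 4 * c\<^sup>2 * (- ((\<Sum>n\<in>I K. v n) - (\<Sum>n\<in>I K. u n))) + 2 * c\<^sup>2 * (u (int K + 1) + u (- int K - 1)))
      \<longlonglongrightarrow> 4 * c\<^sup>2 * (- 0) + 2 * c\<^sup>2 * (0 + 0)"
    by (rule tendsto_add[OF tendsto_mult[OF tendsto_const tendsto_minus[OF diff]] tendsto_mult[OF tendsto_const tendsto_add[OF u_lim]]])
  then have \<epsilon>_lim: "\<epsilon> \<longlonglongrightarrow> 0" by (simp add: \<epsilon>_def)
  have I_mem: "\<forall>\<^sub>F K in sequentially. n \<in> I K" for n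
    using eventually_ge_at_top[of "nat \<bar>n\<bar>"] by eventually_elim (auto simp: I_def)
  have fin: "finite (I K)" for K by (simp add: I_def)
  have dv: "((d n)\<^sup>2 - 4 * c\<^sup>2) * v n \<ge> 0" for n
  proof (cases "even n = P")
    case True
    have "(2 * c)\<^sup>2 \<le> (d n)\<^sup>2" using far[OF True] c by (intro power_mono) auto
    then show ?thesis using uv0[of n] by (intro mult_nonneg_nonneg) (auto simp: power_mult_distrib)
  qed (simp add: v_def)
  \<comment> \<open>A fixed nonnegative summand lies below \<open>\<epsilon> K\<close> for all large
    K, hence is 0; strictness in \<open>far\<close> makes its factor positive. The other parity then
    dies through \<open>diff\<close>.\<close>
  have v0: "v n = 0" for n
  proof (cases "even n = P")
    case True
    have "\<forall>\<^sub>F K in sequentially. ((d n)\<^sup>2 - 4 * c\<^sup>2) * v n \<le> \<epsilon> K"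
      using I_mem[of n]
    proof eventually_elim
      case (elim K)
      then show ?case using bound[of K] member_le_sum[of n "I K" "\<lambda>n. ((d n)\<^sup>2 - 4 * c\<^sup>2) * v n"] dv fin by fastforce
    qed
    then have "((d n)\<^sup>2 - 4 * c\<^sup>2) * v n \<le> 0" using \<epsilon>_lim tendsto_lowerbound trivial_limit_sequentially by blast
    moreover have "(2 * c)\<^sup>2 < (d n)\<^sup>2" using far[OF True] c by (intro power_strict_mono) auto
    then have "(d n)\<^sup>2 - 4 * c\<^sup>2 > 0" by (simp add: power_mult_distrib)
    ultimately show ?thesis using uv0[of n] by (simp add: mult_le_0_iff)
  qed (simp add: v_def)
  have u0: "u n = 0" for n
  proof -
    have "\<forall>\<^sub>F K in sequentially. (\<Sum>n\<in>I K. v n) - (\<Sum>n\<in>I K. u n) \<le> - u n"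
      using I_mem[of n]
    proof eventually_elim
      case (elim K)
      then show ?case using member_le_sum[of n "I K" u] uv0 fin by (simp add: v0)
    qed
    then have "0 \<le> - u n" using diff tendsto_upperbound trivial_limit_sequentially by blast
    then show ?thesis using uv0[of n] by simp
  qed
  have "b n = 0" for n using u0[of n] v0[of n] by (auto simp: u_def v_def split: if_splits)
  then show False using nz by blast
qed

text \<open>The recurrence makes the Casoratian of two solutions alternate in sign, so decay forces it to
  vanish.\<close>

lemma floquet_casoratian_zero:
  assumes c: "c \<noteq> 0" and "floquet_rec c t \<mu> b" "floquet_rec c t \<mu> b'" "quadratic_decay b" "quadratic_decay b'"
  shows "b n * b' (n + 1) = b (n + 1) * b' n"
proof -
  define W where "W = (\<lambda>n. b n * b' (n + 1) - b (n + 1) * b' n)"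
  have step: "W n = - W (n - 1)" for n
  proof -
    define D where "D = complex_of_real ((2 * of_int n + t)\<^sup>2) - \<mu>"
    have r: "D * b n = of_real c * (b (n + 1) - b (n - 1))" "D * b' n = of_real c * (b' (n + 1) - b' (n - 1))"
      using assms(2,3) by (auto simp: floquet_rec_def D_def)
    have "of_real c * (W n + W (n - 1)) = b n * (of_real c * (b' (n + 1) - b' (n - 1)))
        - b' n * (of_real c * (b (n + 1) - b (n - 1)))"
      by (simp add: W_def algebra_simps)
    also have "\<dots> = 0" unfolding r[symmetric] by simp
    finally show ?thesis using c by (simp add: add_eq_0_iff2)
  qed
  have "norm (W (n + int K)) = norm (W n)" for K
  proof (induction K)
    case (Suc K)
    then show ?case using step[of "n + int (Suc K)"] by simp
  qed simp
  moreover have "(\<lambda>K. norm (W (n + int K))) \<longlonglongrightarrow> 0"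
    using tendsto_norm[OF tendsto_diff[OF
        tendsto_mult[OF quadratic_decay_tendsto_zero(1)[OF assms(4), of n] quadratic_decay_tendsto_zero(1)[OF assms(5), of "n+1"]]
        tendsto_mult[OF quadratic_decay_tendsto_zero(1)[OF assms(4), of "n+1"] quadratic_decay_tendsto_zero(1)[OF assms(5), of n]]]]
    unfolding W_def by (simp add: add_ac)
  ultimately have "norm (W n) = 0" by (simp add: LIMSEQ_const_iff)
  then show ?thesis by (simp add: W_def)
qed

text \<open>For \<open>t = 1\<close> the reflection \<open>n \<mapsto> -1 - n\<close> and complex conjugation preserve the solution space of the
  real recurrence; the two resulting Casoratian identities at \<open>n = -1\<close> force \<open>b\<^sub>-\<^sub>1 = b\<^sub>0 = 0\<close>.\<close>

lemma antiperiodic_eigenvalue_nonreal: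
  assumes ev: "is_eigenvalue c 1 \<mu>" and c: "c > 0"
  shows "\<mu> \<notin> \<real>"
proof
  assume "\<mu> \<in> \<real>"
  then have cnj: "cnj \<mu> = \<mu>" by (simp add: Reals_cnj_iff)
  obtain b where rec: "floquet_rec c 1 \<mu> b" and dec: "quadratic_decay b" and nz: "\<exists>n. b n \<noteq> 0"
    using is_eigenvalue_imp_floquet[OF ev] by auto
  define b1 where "b1 = (\<lambda>n. cnj (b n))"
  \<comment> \<open>The alternating sign compensates that the reflection exchanges the neighbours
    \<open>b (n + 1)\<close> and \<open>b (n - 1)\<close>.\<close>
  define b2 where "b2 = (\<lambda>n. (if even n then 1 else - 1) * b (- 1 - n))"
  obtain M where M: "\<And>n. (1 + (real_of_int n)\<^sup>2) * norm (b n) \<le> M"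
    using dec by (auto simp: quadratic_decay_def)
  have r1: "floquet_rec c 1 \<mu> b1"
    unfolding floquet_rec_def b1_def
  proof
    fix n
    have "cnj ((of_real ((2 * of_int n + 1)\<^sup>2) - \<mu>) * b n) = cnj (of_real c * (b (n + 1) - b (n - 1)))"
      using rec unfolding floquet_rec_def by metis
    then show "(of_real ((2 * of_int n + 1)\<^sup>2) - \<mu>) * cnj (b n) = of_real c * (cnj (b (n + 1)) - cnj (b (n - 1)))"
      by (simp only: complex_cnj_mult complex_cnj_diff complex_cnj_complex_of_real cnj)
  qed
  have d1: "quadratic_decay b1" using dec by (simp add: quadratic_decay_def b1_def)
  have r2: "floquet_rec c 1 \<mu> b2"
    unfolding floquet_rec_def
  proof
    fix n :: int
    have "(of_real ((2 * of_int (- 1 - n) + 1)\<^sup>2) - \<mu>) * b (- 1 - n) = of_real c * (b (- 1 - n + 1) - b (- 1 - n - 1))"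
      using rec unfolding floquet_rec_def by blast
    moreover have "(2 * of_int (- 1 - n) + 1)\<^sup>2 = (2 * real_of_int n + 1)\<^sup>2"
      by (simp add: power2_eq_square algebra_simps)
    moreover have "- 1 - n + 1 = - n" "- 1 - n - 1 = - 2 - n" by simp_all
    ultimately have r: "(of_real ((2 * of_int n + 1)\<^sup>2) - \<mu>) * b (- 1 - n) = of_real c * (b (- n) - b (- 2 - n))"
      by (simp only:)
    have "b2 (n + 1) = (if even n then - 1 else 1) * b (- 2 - n)" "b2 (n - 1) = (if even n then - 1 else 1) * b (- n)"
      by (simp_all add: b2_def)
    then show "(of_real ((2 * of_int n + 1)\<^sup>2) - \<mu>) * b2 n = of_real c * (b2 (n + 1) - b2 (n - 1))"
      using r by (cases "even n") (simp_all add: b2_def algebra_simps)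
  qed
  have d2: "quadratic_decay b2"
    unfolding quadratic_decay_def
  proof (intro exI allI)
    fix n :: int
    \<comment> \<open>This is 4(1 + (n + 1)^2) - (1 + n^2), the cost of reflecting the decay
      weight.\<close>
    have "0 \<le> 3 * (real_of_int n)\<^sup>2 + 8 * real_of_int n + 7"
      using zero_le_power2[of "3 * real_of_int n + 4"] by (simp add: power2_eq_square algebra_simps)
    then have "1 + (real_of_int n)\<^sup>2 \<le> 4 * (1 + (real_of_int (- 1 - n))\<^sup>2)"
      by (simp add: power2_eq_square algebra_simps)
    then have "(1 + (real_of_int n)\<^sup>2) * norm (b (- 1 - n)) \<le> 4 * (1 + (real_of_int (- 1 - n))\<^sup>2) * norm (b (- 1 - n))"
      by (intro mult_right_mono) auto
    also have "\<dots> \<le> 4 * M" using mult_left_mono[OF M[of "- 1 - n"], of 4] by (simp only: mult.assoc)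
    finally show "(1 + (real_of_int n)\<^sup>2) * norm (b2 n) \<le> 4 * M" by (simp add: b2_def norm_mult)
  qed
  have c0: "c \<noteq> 0" using c by simp
  have "b (- 1) * b1 0 = b 0 * b1 (- 1)" "b (- 1) * b2 0 = b 0 * b2 (- 1)"
    using floquet_casoratian_zero[OF c0 rec r1 dec d1, of "- 1"] floquet_casoratian_zero[OF c0 rec r2 dec d2, of "- 1"]
    by simp_all
  then have e1: "b (- 1) * cnj (b 0) = b 0 * cnj (b (- 1))" and e2: "b (- 1) * b (- 1) = - (b 0 * b 0)"
    by (simp_all add: b1_def b2_def)
  \<comment> \<open>By \<open>e1\<close> the product \<open>b (- 1) * cnj (b 0)\<close> is real, so
    its squared modulus is its square, which is -|b 0|^4 by \<open>e2\<close>. Both sides must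
    vanish.\<close>
  have "complex_of_real ((norm (b (- 1)))\<^sup>2 * (norm (b 0))\<^sup>2 + (norm (b 0))\<^sup>2 * (norm (b 0))\<^sup>2) = 0"
  proof -
    have "(b (- 1) * cnj (b (- 1))) * (b 0 * cnj (b 0)) = (b (- 1) * cnj (b 0)) * (b 0 * cnj (b (- 1)))"
      by (simp only: mult_ac)
    also have "\<dots> = (b (- 1) * b (- 1)) * (cnj (b 0) * cnj (b 0))" unfolding e1[symmetric] by (simp only: mult_ac)
    also have "\<dots> = - ((b 0 * cnj (b 0)) * (b 0 * cnj (b 0)))" unfolding e2 by (simp add: mult_ac)
    finally show ?thesis by (simp only: of_real_add of_real_mult complex_norm_square) simp
  qed
  then have "(norm (b (- 1)))\<^sup>2 * (norm (b 0))\<^sup>2 + (norm (b 0))\<^sup>2 * (norm (b 0))\<^sup>2 = 0"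
    by (simp only: of_real_eq_0_iff)
  then have "b 0 = 0" by (simp add: add_nonneg_eq_0_iff)
  then have b0: "b 0 = 0" "b (- 1) = 0" using e2 by auto
  have recc: "of_real c * (b (n + 1) - b (n - 1)) = (of_real ((2 * of_int n + 1)\<^sup>2) - \<mu>) * b n" for n
    using rec unfolding floquet_rec_def by simp
  have up: "b (int K) = 0 \<and> b (int K - 1) = 0" for K
  proof (induction K)
    case (Suc K)
    then show ?case using recc[of "int K"] c0 by (simp add: add.commute)
  qed (use b0 in simp)
  have down: "b (- int K) = 0 \<and> b (- int K - 1) = 0" for K
  proof (induction K)
    case (Suc K)
    then have "b (- int K - 1 - 1) = 0" using recc[of "- int K - 1"] c0 by simp
    moreover have idx: "- int (Suc K) = - int K - 1" by simp
    ultimately show ?case unfolding idx using Suc by simp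
  qed (use b0 in simp)
  have "b n = 0" for n using up[of "nat n"] down[of "nat (- n)"] by (cases "n \<ge> 0") auto
  then show False using nz by blast
qed

section \<open>The Hill discriminant\<close>

text \<open>The order is singled out by a local factorization h(w) (w - z)^n with h holomorphic.
  Conjugating h on both sides carries such a factorization at z to one at \<open>cnj z\<close>, so
  the selecting predicates agree for every n and the selected values coincide.\<close>

lemma zorder_cnj_symmetric:
  assumes f: "\<And>w. f (cnj w) = cnj (f w)"
  shows "zorder f (cnj z) = zorder f z"
proof -
  define P where "P = (\<lambda>z n. \<exists>h r. r > 0 \<and> h holomorphic_on cball z r \<and> h z \<noteq> 0 \<and>
    (\<forall>w\<in>cball z r - {z}. f w = h w * (w - z) powi n \<and> h w \<noteq> 0))"
  have *: "P (cnj z) n" if Pz: "P z n" for z n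
  proof -
    obtain h r where h: "r > 0" "h holomorphic_on cball z r" "h z \<noteq> 0"
      and hf: "\<And>w. w \<in> cball z r - {z} \<Longrightarrow> f w = h w * (w - z) powi n \<and> h w \<noteq> 0"
      using Pz unfolding P_def by blast
    have mem: "cnj w \<in> cball z r \<longleftrightarrow> w \<in> cball (cnj z) r" for w
      unfolding mem_cball dist_norm using complex_mod_cnj[of "z - cnj w"] by simp
    have im: "cnj ` cball (cnj z) r = cball z r"
    proof
      show "cnj ` cball (cnj z) r \<subseteq> cball z r" using mem by blast
      show "cball z r \<subseteq> cnj ` cball (cnj z) r"
        using mem by (metis complex_cnj_cnj image_eqI subsetI)
    qed
    have "(cnj \<circ> h \<circ> cnj) holomorphic_on cball (cnj z) r"
      unfolding holomorphic_on_def
    proof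
      fix w assume "w \<in> cball (cnj z) r"
      then obtain D where "(h has_field_derivative D) (at (cnj w) within cnj ` cball (cnj z) r)"
        using h(2) mem unfolding im holomorphic_on_def field_differentiable_def by blast
      then have d: "(h has_derivative (*) D) (at (cnj w) within cnj ` cball (cnj z) r)"
        by (simp add: has_field_derivative_def)
      have c: "(cnj has_derivative cnj) (at w within S)" for w S
        by (rule bounded_linear_imp_has_derivative[OF bounded_linear_cnj])
      have "(cnj \<circ> h \<circ> cnj has_derivative cnj \<circ> (*) D \<circ> cnj) (at w within cball (cnj z) r)"
        by (rule diff_chain_within[OF c], simp, rule diff_chain_within[OF d c])
      moreover have "cnj \<circ> (*) D \<circ> cnj = (*) (cnj D)" by auto
      ultimately show "(cnj \<circ> h \<circ> cnj) field_differentiable (at w within cball (cnj z) r)"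
        unfolding field_differentiable_def has_field_derivative_def by auto
    qed
    moreover have "f w = (cnj \<circ> h \<circ> cnj) w * (w - cnj z) powi n \<and> (cnj \<circ> h \<circ> cnj) w \<noteq> 0"
      if w: "w \<in> cball (cnj z) r - {cnj z}" for w
    proof -
      have "cnj w \<in> cball z r - {z}" using w mem by auto
      from hf[OF this] have "cnj (f (cnj w)) = cnj (h (cnj w) * (cnj w - z) powi n)" "h (cnj w) \<noteq> 0" by auto
      then show ?thesis using f[of "cnj w"] by simp
    qed
    ultimately show ?thesis unfolding P_def using h(1,3)
      by (intro exI[of _ "cnj \<circ> h \<circ> cnj"] exI[of _ r]) auto
  qed
  have "P (cnj z) n = P z n" for n using *[of z n] *[of "cnj z" n] by auto
  then show ?thesis by (simp add: zorder_def P_def)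
qed

text \<open>Comparing coefficients in \<open>y'' = v y\<close> for the power series \<open>y\<close> and \<open>v\<close>.\<close>

fun ode_coeff :: "(nat \<Rightarrow> complex) \<Rightarrow> complex \<Rightarrow> complex \<Rightarrow> nat \<Rightarrow> complex" where
  "ode_coeff v A B 0 = A"
| "ode_coeff v A B (Suc 0) = B"
| "ode_coeff v A B (Suc (Suc m)) =
     (\<Sum>i\<in>{0..m}. v i * ode_coeff v A B (m - i)) / (of_nat (m + 1) * of_nat (m + 2))"

text \<open>With weights R^m, R = |z| + 1, the recursion multiplies earlier maxima by at most R^2 S
  / ((m+1)(m+2)). Past a threshold this is at most 1, so the weighted coefficients stay bounded and
  a geometric series dominates at z.\<close>

lemma ode_coeff_conv_radius:
  assumes v: "conv_radius v = \<infinity>"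
  shows "conv_radius (ode_coeff v A B) = \<infinity>"
proof (rule conv_radius_inftyI'')
  fix z :: complex
  let ?a = "ode_coeff v A B"
  define R where "R = norm z + 1"
  have R: "R > 0" by (simp add: R_def add_nonneg_pos)
  define q where "q = (\<lambda>m. norm (?a m) * R ^ m)"
  have q0: "q m \<ge> 0" for m using R by (simp add: q_def)
  define S where "S = (\<Sum>i. norm (v i * of_real R ^ i))"
  have sm: "summable (\<lambda>i. norm (v i * of_real R ^ i))"
    by (rule abs_summable_in_conv_radius) (simp add: v)
  have S_le: "(\<Sum>i\<in>{0..m}. norm (v i) * R ^ i) \<le> S" for m
    using sum_le_suminf[OF sm, of "{0..m}"] R by (simp add: S_def norm_mult norm_power)
  have S0: "S \<ge> 0" using S_le[of 0] R by (intro order_trans[OF _ S_le[of 0]]) simp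
  define m0 where "m0 = nat \<lceil>R\<^sup>2 * S\<rceil>"
  have m0: "R\<^sup>2 * S \<le> real m" if "m \<ge> m0" for m
    using that unfolding m0_def by linarith
  define T where "T = Max (q ` {..m0 + 1})"
  have "q n \<le> T" for n
  proof (induction n rule: less_induct)
    case (less n)
    show ?case
    proof (cases "n \<le> m0 + 1")
      case True
      then show ?thesis unfolding T_def by (intro Max_ge) auto
    next
      case False
      then obtain m where m: "n = Suc (Suc m)" "m \<ge> m0" by (intro that[of "n - 2"]) auto
      have T0: "T \<ge> 0" using less[of 0] False q0[of 0] by linarith
      define P where "P = real (m + 1) * real (m + 2)"
      have P: "P > 0" unfolding P_def by (intro mult_pos_pos) auto
      have "real m * 1 \<le> real (m + 1) * real (m + 2)" by (intro mult_mono) auto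
      then have mP: "real m \<le> P" by (simp add: P_def)
      have "norm (?a n) * P = norm (\<Sum>i\<in>{0..m}. v i * ?a (m - i))"
        unfolding m(1) ode_coeff.simps norm_divide norm_mult norm_of_nat P_def
        by (rule nonzero_eq_divide_eq[THEN iffD1, OF _ refl]) simp
      also have "\<dots> \<le> (\<Sum>i\<in>{0..m}. norm (v i) * norm (?a (m - i)))"
        by (rule order_trans[OF norm_sum]) (simp add: norm_mult)
      finally have "norm (?a n) * P * R ^ m \<le> (\<Sum>i\<in>{0..m}. norm (v i) * norm (?a (m - i))) * R ^ m"
        using R by (intro mult_right_mono) auto
      also have "\<dots> = (\<Sum>i\<in>{0..m}. (norm (v i) * R ^ i) * q (m - i))"
        unfolding sum_distrib_right
      proof (intro sum.cong refl)
        fix i assume "i \<in> {0..m}"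
        then have "R ^ m = R ^ i * R ^ (m - i)" by (simp flip: power_add)
        then show "norm (v i) * norm (?a (m - i)) * R ^ m = norm (v i) * R ^ i * q (m - i)"
          by (simp add: q_def)
      qed
      also have "\<dots> \<le> (\<Sum>i\<in>{0..m}. (norm (v i) * R ^ i) * T)"
        using m R by (intro sum_mono mult_left_mono less.IH) auto
      also have "\<dots> \<le> S * T"
        using S_le[of m] T0 by (simp add: mult_right_mono flip: sum_distrib_right)
      finally have 1: "norm (?a n) * P * R ^ m \<le> S * T" .
      have "q n * P = R\<^sup>2 * (norm (?a n) * P * R ^ m)"
        by (simp add: q_def m(1) power2_eq_square mult_ac)
      also have "\<dots> \<le> R\<^sup>2 * (S * T)" using 1 by (intro mult_left_mono) auto
      also have "\<dots> = (R\<^sup>2 * S) * T" by simp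
      also have "\<dots> \<le> P * T" using m0[OF m(2)] mP T0 by (intro mult_right_mono) auto
      finally show ?thesis using P by (simp add: mult.commute)
    qed
  qed
  note qT = this
  have lt: "norm (norm z / R) < 1" using R by (simp add: R_def)
  show "summable (\<lambda>n. ?a n * z ^ n)"
  proof (rule summable_comparison_test)
    show "summable (\<lambda>n. T * (norm z / R) ^ n)" by (intro summable_mult summable_geometric lt)
    show "\<exists>N. \<forall>n\<ge>N. norm (?a n * z ^ n) \<le> T * (norm z / R) ^ n"
    proof (intro exI allI impI)
      fix n
      have "norm (?a n * z ^ n) = q n * (norm z / R) ^ n"
        using R by (simp add: q_def norm_mult norm_power power_divide)
      also have "\<dots> \<le> T * (norm z / R) ^ n" using R by (intro mult_right_mono qT) auto
      finally show "norm (?a n * z ^ n) \<le> T * (norm z / R) ^ n" .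
    qed
  qed
qed

text \<open>Existence is what gives the definite description in \<open>hill_discriminant\<close> a
  value. The potential is entire, ic(e^(2ix) + e^(-2ix)), so formal power series yield solutions on
  the whole line.\<close>

lemma solution_exists:
  obtains y y1 where "is_solution c \<mu> y y1" "y 0 = A" "y1 0 = B"
proof -
  define V :: "complex fps" where
    "V = fps_const (\<i> * of_real c) * (fps_exp (2 * \<i>) + fps_exp (- 2 * \<i>)) - fps_const \<mu>"
  have r1: "fps_conv_radius (fps_exp (2 * \<i>) + fps_exp (- 2 * \<i>) :: complex fps) = \<infinity>"
    using fps_conv_radius_add[of "fps_exp (2 * \<i>)" "fps_exp (- 2 * \<i>)"] by simp
  have r2: "fps_conv_radius (fps_const (\<i> * of_real c) * (fps_exp (2 * \<i>) + fps_exp (- 2 * \<i>))) = \<infinity>"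
    using fps_conv_radius_mult[of "fps_const (\<i> * of_real c)" "fps_exp (2 * \<i>) + fps_exp (- 2 * \<i>)"] r1 by simp
  have rV: "fps_conv_radius V = \<infinity>"
    using fps_conv_radius_diff[of "fps_const (\<i> * of_real c) * (fps_exp (2 * \<i>) + fps_exp (- 2 * \<i>))" "fps_const \<mu>"] r2
    by (simp add: V_def)
  have eV: "eval_fps V (of_real x) = potential c x - \<mu>" for x
  proof -
    have "exp (2 * \<i> * of_real x) + exp (- 2 * \<i> * of_real x) = 2 * of_real (cos (2 * x))"
      using exp_minus[of "2 * \<i> * of_real x"]
      by (simp add: cos_of_real[symmetric] cos_exp_eq mult_ac)
    then show ?thesis
      unfolding V_def using r1 r2
      by (simp add: eval_fps_diff eval_fps_mult eval_fps_add potential_def mult_ac)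
  qed
  define Y where "Y = Abs_fps (ode_coeff (fps_nth V) A B)"
  have rY: "fps_conv_radius Y = \<infinity>"
    unfolding fps_conv_radius_def Y_def
    using ode_coeff_conv_radius[of "fps_nth V" A B] rV by (simp add: fps_conv_radius_def)
  have rY1: "fps_conv_radius (fps_deriv Y) = \<infinity>"
    using fps_conv_radius_deriv[of Y] rY by simp
  have Y2: "fps_deriv (fps_deriv Y) = V * Y"
  proof (rule fps_ext)
    fix m
    have "fps_nth (fps_deriv (fps_deriv Y)) m = of_nat (m + 1) * (of_nat (m + 2) * ode_coeff (fps_nth V) A B (Suc (Suc m)))"
      by (simp add: Y_def)
    also have "\<dots> = (of_nat (m + 1) * of_nat (m + 2)) * ode_coeff (fps_nth V) A B (Suc (Suc m))"
      by (simp only: mult.assoc)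
    also have "\<dots> = (\<Sum>i\<in>{0..m}. fps_nth V i * ode_coeff (fps_nth V) A B (m - i))"
    proof -
      have nz: "complex_of_nat (m + 1) * of_nat (m + 2) \<noteq> 0"
        by (simp only: mult_eq_0_iff of_nat_eq_0_iff) simp
      show ?thesis
        unfolding ode_coeff.simps times_divide_eq_right by (rule nonzero_mult_div_cancel_left[OF nz])
    qed
    also have "\<dots> = fps_nth (V * Y) m" by (simp add: fps_mult_nth Y_def)
    finally show "fps_nth (fps_deriv (fps_deriv Y)) m = fps_nth (V * Y) m" .
  qed
  have d: "((\<lambda>x. eval_fps f (of_real x)) has_vector_derivative eval_fps (fps_deriv f) (of_real x)) (at x)"
    if "fps_conv_radius f = \<infinity>" for f :: "complex fps" and x
    using has_vector_derivative_real_field[OF has_field_derivative_eval_fps[of "of_real x" f UNIV]] that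
    by simp
  have "is_solution c \<mu> (\<lambda>x. eval_fps Y (of_real x)) (\<lambda>x. eval_fps (fps_deriv Y) (of_real x))"
    unfolding is_solution_def
  proof (intro allI conjI)
    fix x :: real
    show "((\<lambda>x. eval_fps Y (of_real x)) has_vector_derivative eval_fps (fps_deriv Y) (of_real x)) (at x)"
      by (rule d[OF rY])
    have "eval_fps (fps_deriv (fps_deriv Y)) (of_real x) = (potential c x - \<mu>) * eval_fps Y (of_real x)"
      unfolding Y2 eV[symmetric] by (rule eval_fps_mult) (simp_all add: rV rY)
    then show "((\<lambda>x. eval_fps (fps_deriv Y) (of_real x)) has_vector_derivative
        (potential c x - \<mu>) * eval_fps Y (of_real x)) (at x)"
      using d[OF rY1, of x] by simp
  qed
  moreover have "eval_fps Y (of_real 0) = A" "eval_fps (fps_deriv Y) (of_real 0) = B"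
    by (simp_all add: eval_fps_at_0 Y_def)
  ultimately show thesis using that by blast
qed

section \<open>Monodromy and the conjugation symmetry of the discriminant\<close>

lemma is_solution_combination:
  assumes "is_solution c \<mu> y y1" "is_solution c \<mu> z z1"
  shows "is_solution c \<mu> (\<lambda>x. \<alpha> * y x + \<beta> * z x) (\<lambda>x. \<alpha> * y1 x + \<beta> * z1 x)"
  unfolding is_solution_def
proof (intro allI conjI)
  fix x
  have d: "(y has_vector_derivative y1 x) (at x)" "(y1 has_vector_derivative (potential c x - \<mu>) * y x) (at x)"
    "(z has_vector_derivative z1 x) (at x)" "(z1 has_vector_derivative (potential c x - \<mu>) * z x) (at x)"
    using assms by (auto simp: is_solution_def)
  show "((\<lambda>x. \<alpha> * y x + \<beta> * z x) has_vector_derivative \<alpha> * y1 x + \<beta> * z1 x) (at x)"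
    by (intro has_vector_derivative_add has_vector_derivative_mult_right d)
  have "((\<lambda>x. \<alpha> * y1 x + \<beta> * z1 x) has_vector_derivative
      \<alpha> * ((potential c x - \<mu>) * y x) + \<beta> * ((potential c x - \<mu>) * z x)) (at x)"
    by (intro has_vector_derivative_add has_vector_derivative_mult_right d)
  then show "((\<lambda>x. \<alpha> * y1 x + \<beta> * z1 x) has_vector_derivative (potential c x - \<mu>) * (\<alpha> * y x + \<beta> * z x)) (at x)"
    by (simp add: algebra_simps)
qed

lemma is_solution_shift:
  assumes "is_solution c \<mu> y y1"
  shows "is_solution c \<mu> (\<lambda>x. y (x + pi)) (\<lambda>x. y1 (x + pi))"
proof -
  have "potential c (x + pi) = potential c x" for x
    using cos_periodic[of "2 * x"] by (simp add: potential_def algebra_simps)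
  moreover have "((\<lambda>x. f (x + pi)) has_vector_derivative D) (at x)"
    if "(f has_vector_derivative D) (at (x + pi))" for f :: "real \<Rightarrow> complex" and D x
  proof -
    have "((\<lambda>x. x + pi) has_vector_derivative 1) (at x)" by (auto intro!: derivative_eq_intros)
    from vector_diff_chain_at[OF this that] show ?thesis by (simp add: o_def)
  qed
  ultimately show ?thesis using assms unfolding is_solution_def by metis
qed

text \<open>Among the reflections conjugating the potential, this one sends 0, pi, 2pi to 5pi/2,
  3pi/2, pi/2, all nonnegative, where the forward uniqueness argument and the trace identity are
  available.\<close>

lemma is_solution_reflect_cnj:
  assumes "is_solution c \<mu> y y1"
  shows "is_solution c (cnj \<mu>) (\<lambda>x. cnj (y (5 * pi / 2 - x))) (\<lambda>x. - cnj (y1 (5 * pi / 2 - x)))"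
proof -
  have pot: "potential c (5 * pi / 2 - x) = cnj (potential c x)" for x
  proof -
    have "cos (2 * (5 * pi / 2 - x)) = cos (pi - 2 * x + 2 * pi + 2 * pi)" by (simp add: algebra_simps)
    also have "\<dots> = cos (pi - 2 * x)" by (simp only: cos_periodic)
    also have "\<dots> = - cos (2 * x)" by (simp add: cos_diff)
    finally show ?thesis unfolding potential_def by (simp only:) simp
  qed
  have d: "((\<lambda>x. cnj (f (5 * pi / 2 - x))) has_vector_derivative - cnj D) (at x)"
    if "(f has_vector_derivative D) (at (5 * pi / 2 - x))" for f :: "real \<Rightarrow> complex" and D x
  proof -
    have "((\<lambda>x. 5 * pi / 2 - x) has_vector_derivative - 1) (at x)" by (auto intro!: derivative_eq_intros)
    from has_vector_derivative_cnj[OF vector_diff_chain_at[OF this that]] show ?thesis by (simp add: o_def)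
  qed
  show ?thesis
    unfolding is_solution_def
  proof (intro allI conjI)
    fix x
    have y: "(y has_vector_derivative y1 (5 * pi / 2 - x)) (at (5 * pi / 2 - x))"
      "(y1 has_vector_derivative (potential c (5 * pi / 2 - x) - \<mu>) * y (5 * pi / 2 - x)) (at (5 * pi / 2 - x))"
      using assms unfolding is_solution_def by blast+
    show "((\<lambda>x. cnj (y (5 * pi / 2 - x))) has_vector_derivative - cnj (y1 (5 * pi / 2 - x))) (at x)"
      by (rule d[OF y(1)])
    show "((\<lambda>x. - cnj (y1 (5 * pi / 2 - x))) has_vector_derivative
        (potential c x - cnj \<mu>) * cnj (y (5 * pi / 2 - x))) (at x)"
      using has_vector_derivative_minus[OF d[OF y(2)]] by (simp add: pot)
  qed
qed

lemma is_solution_unique: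
  assumes "is_solution c \<mu> y y1" "y 0 = 0" "y1 0 = 0" "x \<ge> 0"
  shows "y x = 0 \<and> y1 x = 0"
  using linear_ode_zero[of x y y1 "\<lambda>x. potential c x - \<mu>", OF _ _ norm_potential_diff_le assms(2,3), of x] assms(1,4)
  by (auto simp: is_solution_def intro: has_vector_derivative_at_within)

lemma is_solution_wronskian:
  assumes "is_solution c \<mu> y y1" "is_solution c \<mu> z z1"
  shows "y x * z1 x - y1 x * z x = y 0 * z1 0 - y1 0 * z 0"
proof -
  define W where "W = (\<lambda>x. y x * z1 x - y1 x * z x)"
  have "(W has_vector_derivative 0) (at x within UNIV)" for x
  proof -
    have d: "(y has_vector_derivative y1 x) (at x)" "(y1 has_vector_derivative (potential c x - \<mu>) * y x) (at x)"
      "(z has_vector_derivative z1 x) (at x)" "(z1 has_vector_derivative (potential c x - \<mu>) * z x) (at x)"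
      using assms by (auto simp: is_solution_def)
    show ?thesis unfolding W_def
      by (rule derivative_eq_intros d refl)+ (simp add: algebra_simps)
  qed
  then obtain w0 where "\<And>x. x \<in> UNIV \<Longrightarrow> W x = w0"
    using has_vector_derivative_zero_constant[of UNIV W] by blast
  then have "W x = W 0" by simp
  then show ?thesis by (simp add: W_def)
qed

text \<open>Cayley--Hamilton for the monodromy matrix, whose determinant is \<open>1\<close>.\<close>

lemma is_solution_hill_discriminant:
  assumes y: "is_solution c \<mu> y y1" and "x \<ge> 0"
  shows "y (x + 2 * pi) + y x = hill_discriminant c \<mu> * y (x + pi)"
proof -
  obtain \<theta> \<theta>1 where th: "is_solution c \<mu> \<theta> \<theta>1" "\<theta> 0 = 1" "\<theta>1 0 = 0" using solution_exists by blast
  obtain \<phi> \<phi>1 where ph: "is_solution c \<mu> \<phi> \<phi>1" "\<phi> 0 = 0" "\<phi>1 0 = 1" using solution_exists by blast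
  have repr: "z x = z 0 * \<theta> x + z1 0 * \<phi> x \<and> z1 x = z 0 * \<theta>1 x + z1 0 * \<phi>1 x"
    if z: "is_solution c \<mu> z z1" and "x \<ge> 0" for z z1 x
    using is_solution_unique[OF is_solution_combination[OF z is_solution_combination[OF th(1) ph(1), of "z 0" "z1 0"], of 1 "- 1"] _ _ that(2)]
    by (simp add: th ph algebra_simps)
  define D where "D = \<theta> pi + \<phi>1 pi"
  have hd: "hill_discriminant c \<mu> = D"
    unfolding hill_discriminant_def
  proof (rule the_equality)
    show "\<exists>\<theta> \<theta>1 \<phi> \<phi>1. is_solution c \<mu> \<theta> \<theta>1 \<and> \<theta> 0 = 1 \<and> \<theta>1 0 = 0 \<and>
        is_solution c \<mu> \<phi> \<phi>1 \<and> \<phi> 0 = 0 \<and> \<phi>1 0 = 1 \<and> D = \<theta> pi + \<phi>1 pi"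
      using th ph D_def by blast
    fix D' assume "\<exists>\<theta> \<theta>1 \<phi> \<phi>1. is_solution c \<mu> \<theta> \<theta>1 \<and> \<theta> 0 = 1 \<and> \<theta>1 0 = 0 \<and>
        is_solution c \<mu> \<phi> \<phi>1 \<and> \<phi> 0 = 0 \<and> \<phi>1 0 = 1 \<and> D' = \<theta> pi + \<phi>1 pi"
    then obtain \<theta>' \<theta>1' \<phi>' \<phi>1' where "is_solution c \<mu> \<theta>' \<theta>1'" "\<theta>' 0 = 1" "\<theta>1' 0 = 0"
        "is_solution c \<mu> \<phi>' \<phi>1'" "\<phi>' 0 = 0" "\<phi>1' 0 = 1" "D' = \<theta>' pi + \<phi>1' pi" by blast
    then show "D' = D" using repr[of \<theta>' \<theta>1' pi] repr[of \<phi>' \<phi>1' pi] by (simp add: D_def)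
  qed
  have W: "\<theta> pi * \<phi>1 pi - \<theta>1 pi * \<phi> pi = 1"
    using is_solution_wronskian[OF th(1) ph(1), of pi] by (simp add: th ph)
  \<comment> \<open>The defect of the claimed identity, written with trivial factors 1 to match
    \<open>is_solution_combination\<close>. Its initial data vanish because the Wronskian is
    1.\<close>
  define s s1 where "s = (\<lambda>x. 1 * (1 * y (x + pi + pi) + 1 * y x) + (- D) * y (x + pi))"
    and "s1 = (\<lambda>x. 1 * (1 * y1 (x + pi + pi) + 1 * y1 x) + (- D) * y1 (x + pi))"
  have sol: "is_solution c \<mu> s s1"
    unfolding s_def s1_def
    by (intro is_solution_combination y is_solution_shift[OF y] is_solution_shift[OF is_solution_shift[OF y]])
  have y_pi: "y pi = y 0 * \<theta> pi + y1 0 * \<phi> pi" "y1 pi = y 0 * \<theta>1 pi + y1 0 * \<phi>1 pi"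
    using repr[OF y, of pi] by auto
  have y_2pi: "y (pi + pi) = y pi * \<theta> pi + y1 pi * \<phi> pi" "y1 (pi + pi) = y pi * \<theta>1 pi + y1 pi * \<phi>1 pi"
    using repr[OF is_solution_shift[OF y], of pi] by auto
  have s0: "s 0 = y (pi + pi) + y 0 - D * y pi" "s1 0 = y1 (pi + pi) + y1 0 - D * y1 pi"
    by (simp_all add: s_def s1_def)
  have "s 0 = y 0 * (1 - (\<theta> pi * \<phi>1 pi - \<theta>1 pi * \<phi> pi))"
    unfolding s0 y_2pi y_pi D_def by (simp add: algebra_simps)
  moreover have "s1 0 = y1 0 * (1 - (\<theta> pi * \<phi>1 pi - \<theta>1 pi * \<phi> pi))"
    unfolding s0 y_2pi y_pi D_def by (simp add: algebra_simps)
  ultimately have "s x = 0" using is_solution_unique[OF sol _ _ assms(2)] W by simp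
  then show ?thesis by (simp add: s_def hd algebra_simps)
qed

text \<open>The three-term identity determines the discriminant wherever the middle value is
  nonzero. Here it is read off at pi/2, 3pi/2, 5pi/2 for \<open>y\<close> and at the reflected
  points for \<open>z\<close>; the Wronskian guarantees a solution not vanishing at 3pi/2.\<close>

lemma hill_discriminant_cnj: "hill_discriminant c (cnj \<mu>) = cnj (hill_discriminant c \<mu>)"
proof -
  obtain \<theta> \<theta>1 where th: "is_solution c \<mu> \<theta> \<theta>1" "\<theta> 0 = 1" "\<theta>1 0 = 0" using solution_exists by blast
  obtain \<phi> \<phi>1 where ph: "is_solution c \<mu> \<phi> \<phi>1" "\<phi> 0 = 0" "\<phi>1 0 = 1" using solution_exists by blast
  have "\<theta> (3 * pi / 2) \<noteq> 0 \<or> \<phi> (3 * pi / 2) \<noteq> 0"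
    using is_solution_wronskian[OF th(1) ph(1), of "3 * pi / 2"] by (auto simp: th ph)
  then obtain y y1 where y: "is_solution c \<mu> y y1" "y (3 * pi / 2) \<noteq> 0" using th ph by blast
  define z where "z = (\<lambda>x. cnj (y (5 * pi / 2 - x)))"
  have z: "z 0 = cnj (y (5 * pi / 2))" "z pi = cnj (y (3 * pi / 2))" "z (2 * pi) = cnj (y (pi / 2))"
  proof -
    have "5 * pi / 2 - pi = 3 * pi / 2" "5 * pi / 2 - 2 * pi = pi / 2" by simp_all
    then show "z 0 = cnj (y (5 * pi / 2))" "z pi = cnj (y (3 * pi / 2))" "z (2 * pi) = cnj (y (pi / 2))"
      by (simp_all only: z_def) simp
  qed
  have "z (0 + 2 * pi) + z 0 = hill_discriminant c (cnj \<mu>) * z (0 + pi)"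
    unfolding z_def by (rule is_solution_hill_discriminant[OF is_solution_reflect_cnj[OF y(1)]]) simp
  moreover have "y (pi / 2 + 2 * pi) + y (pi / 2) = hill_discriminant c \<mu> * y (pi / 2 + pi)"
    by (rule is_solution_hill_discriminant[OF y(1)]) simp
  moreover have "pi / 2 + 2 * pi = 5 * pi / 2" "pi / 2 + pi = 3 * pi / 2" by simp_all
  ultimately have "hill_discriminant c (cnj \<mu>) * cnj (y (3 * pi / 2))
      = cnj (hill_discriminant c \<mu> * y (3 * pi / 2))"
    by (simp only: z add_0_left) (metis add.commute complex_cnj_add)
  then show ?thesis using y(2) by simp
qed

lemma alg_mult_cnj: "alg_mult c t (cnj \<mu>) = alg_mult c t \<mu>"
  unfolding alg_mult_def
  by (subst zorder_cnj_symmetric) (simp_all add: hill_discriminant_cnj)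

section \<open>Localization and the collision of bands\<close>

lemma center_le:
  assumes "t \<in> {0..1/2}" "\<bar>N\<bar> \<le> int j"
  shows "(2 * real_of_int N + t)\<^sup>2 \<le> (2 * real j + 1/2)\<^sup>2"
proof -
  have "\<bar>real_of_int N\<bar> \<le> real j" using assms(2) by linarith
  then have "\<bar>2 * real_of_int N + t\<bar> \<le> \<bar>2 * real j + 1/2\<bar>" using assms(1) by auto
  then show ?thesis by (simp only: abs_le_square_iff)
qed

text \<open>Negative \<open>N\<close> is extremal: its modulus is 2|N| - t, at least 2(j + 1) -
  1/2.\<close>

lemma center_ge:
  assumes "t \<in> {0..1/2}" "\<bar>N\<bar> \<ge> int j + 1"
  shows "(2 * real_of_int N + t)\<^sup>2 \<ge> (2 * real j + 3/2)\<^sup>2"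
proof -
  have "\<bar>real_of_int N\<bar> \<ge> real j + 1" using assms(2) by linarith
  then have "\<bar>2 * real j + 3/2\<bar> \<le> \<bar>2 * real_of_int N + t\<bar>" using assms(1) by auto
  then show ?thesis by (simp only: abs_le_square_iff)
qed

lemma abs_Re_diff_of_real_le: "\<bar>Re \<mu> - x\<bar> \<le> norm (\<mu> - of_real x)"
  using abs_Re_le_cmod[of "\<mu> - of_real x"] by simp

text \<open>The abscissa is the midpoint of (2j + 1/2)^2 and (2j + 3/2)^2, the extreme positions of
  the centers on either side. Half the gap is 2j + 1, which exceeds the radius 2c exactly when j > c
  - 1/2.\<close>

lemma eigenvalue_off_separating_line:
  assumes ev: "is_eigenvalue c t \<mu>" "t \<in> {0..1/2}" and c: "c > 0" and j: "real j > c - 1/2"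
  shows "Re \<mu> \<noteq> (2 * real j + 1)\<^sup>2 + 1/4"
proof -
  obtain N :: int where "norm (\<mu> - of_real ((2 * of_int N + t)\<^sup>2)) \<le> 2 * c"
    using eigenvalue_localization[of c t \<mu>] ev c by auto
  then have near: "\<bar>Re \<mu> - (2 * of_int N + t)\<^sup>2\<bar> \<le> 2 * c"
    using abs_Re_diff_of_real_le order_trans by blast
  show ?thesis
  proof (cases "\<bar>N\<bar> \<le> int j")
    case True
    have "(2 * real j + 1/2)\<^sup>2 + 2 * c < (2 * real j + 1)\<^sup>2 + 1/4"
      using j by (simp add: power2_eq_square algebra_simps)
    then show ?thesis using center_le[OF ev(2) True] near by linarith
  next
    case False
    have "(2 * real j + 3/2)\<^sup>2 - 2 * c > (2 * real j + 1)\<^sup>2 + 1/4"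
      using j by (simp add: power2_eq_square algebra_simps)
    moreover have "\<bar>N\<bar> \<ge> int j + 1" using False by linarith
    ultimately show ?thesis using center_ge[OF ev(2)] near by fastforce
  qed
qed

text \<open>The strip is bounded by the separating lines of j - 1 and j; the threshold for
  \<open>j\<close> is the one for the lower line.\<close>

lemma strip_center:
  assumes t: "t \<in> {0..1/2}" and near: "\<bar>x - (2 * real_of_int N + t)\<^sup>2\<bar> \<le> 2 * c"
    and j: "j \<ge> 1" "real j > c + 1/2"
    and x: "(2 * real j - 1)\<^sup>2 + 1/4 < x" "x < (2 * real j + 1)\<^sup>2 + 1/4"
  shows "\<bar>N\<bar> = int j"
proof (rule ccontr)
  assume ne: "\<bar>N\<bar> \<noteq> int j"
  show False
  proof (cases "\<bar>N\<bar> \<le> int j")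
    case True
    then have "\<bar>N\<bar> \<le> int (j - 1)" using ne j(1) by linarith
    from center_le[OF t this] have "(2 * of_int N + t)\<^sup>2 \<le> (2 * real j - 3/2)\<^sup>2"
      using j(1) by (simp add: of_nat_diff algebra_simps)
    moreover have "(2 * real j - 3/2)\<^sup>2 + 2 * c < (2 * real j - 1)\<^sup>2 + 1/4"
      using j(2) by (simp add: power2_eq_square algebra_simps)
    ultimately show False using near x by linarith
  next
    case False
    then have "\<bar>N\<bar> \<ge> int j + 1" by linarith
    from center_ge[OF t this] have "(2 * real j + 3/2)\<^sup>2 \<le> (2 * of_int N + t)\<^sup>2" .
    moreover have "(2 * real j + 3/2)\<^sup>2 - 2 * c > (2 * real j + 1)\<^sup>2 + 1/4"
      using j(2) by (simp add: power2_eq_square algebra_simps)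
    ultimately show False using near x by linarith
  qed
qed

text \<open>In the strip only the centers with index \<open>\<plusminus>j\<close> are within \<open>2c\<close>, and these have equal parity.\<close>

lemma strip_eigenvalue_real:
  assumes ev: "is_eigenvalue c t \<mu>" "t \<in> {0..1/2}" and c: "c > 0"
    and j: "j \<ge> 1" "real j > c + 1/2"
    and x: "(2 * real j - 1)\<^sup>2 + 1/4 < Re \<mu>" "Re \<mu> < (2 * real j + 1)\<^sup>2 + 1/4"
  shows "\<mu> \<in> \<real>"
proof (rule ccontr)
  assume "\<mu> \<notin> \<real>"
  \<comment> \<open>The parity requested is the one opposite to that of \<open>j\<close>.\<close>
  then obtain N :: int where N: "even N = odd j" "norm (\<mu> - of_real ((2 * of_int N + t)\<^sup>2)) \<le> 2 * c"
    using nonreal_eigenvalue_near_both_parities[of c t \<mu> "odd j"] ev c by auto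
  then have "\<bar>Re \<mu> - (2 * of_int N + t)\<^sup>2\<bar> \<le> 2 * c"
    using abs_Re_diff_of_real_le order_trans by blast
  from strip_center[OF ev(2) this j x] have "\<bar>N\<bar> = int j" .
  then have "N = int j \<or> N = - int j" by linarith
  then have "even N = even j" by auto
  then show False using N(1) by simp
qed

text \<open>With |N| = j the factor 4(2j - 1) - 2c in the second localization bound exceeds 6c,
  which leaves the radius 4c^2 / (6c).\<close>

lemma periodic_eigenvalue_localization:
  assumes ev: "is_eigenvalue c 0 \<mu>" and c: "c > 0"
    and j: "j \<ge> 1" "real j > c + 1/2"
    and x: "(2 * real j - 1)\<^sup>2 + 1/4 < Re \<mu>" "Re \<mu> < (2 * real j + 1)\<^sup>2 + 1/4"
  shows "\<bar>Re \<mu> - (2 * real j)\<^sup>2\<bar> \<le> 2 * c / 3"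
proof -
  obtain N :: int where N: "norm (\<mu> - of_real ((2 * of_int N + 0)\<^sup>2)) \<le> 2 * c"
    "norm (\<mu> - of_real ((2 * of_int N + 0)\<^sup>2)) * (4 * (\<bar>2 * of_int N + 0\<bar> - 1) - 2 * c) \<le> 4 * c\<^sup>2"
    using eigenvalue_localization[of c 0 \<mu>] ev c by auto
  define r where "r = norm (\<mu> - of_real ((2 * of_int N + 0)\<^sup>2))"
  have near: "\<bar>Re \<mu> - (2 * of_int N + 0)\<^sup>2\<bar> \<le> r"
    unfolding r_def by (rule abs_Re_diff_of_real_le)
  then have "\<bar>Re \<mu> - (2 * of_int N + 0)\<^sup>2\<bar> \<le> 2 * c" using N(1) r_def by linarith
  from strip_center[OF _ this j x] have aN: "\<bar>N\<bar> = int j" by simp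
  then have aN': "\<bar>real_of_int N\<bar> = real j" by linarith
  have sq: "(2 * real_of_int N + 0)\<^sup>2 = (2 * real j)\<^sup>2"
    using aN' by (simp add: power_mult_distrib flip: aN')
  have "6 * c \<le> 4 * (\<bar>2 * real_of_int N + 0\<bar> - 1) - 2 * c"
    using aN' j(2) by (simp add: abs_mult)
  then have "r * (6 * c) \<le> r * (4 * (\<bar>2 * real_of_int N + 0\<bar> - 1) - 2 * c)"
    by (intro mult_left_mono) (auto simp: r_def)
  also have "\<dots> \<le> 4 * c\<^sup>2" using N(2) by (simp add: r_def)
  finally have "(6 * r) * c \<le> (4 * c) * c" by (simp add: power2_eq_square mult_ac)
  then have "6 * r \<le> 4 * c" using c by simp
  then show ?thesis using near unfolding sq by simp
qed

text \<open>Complements the periodic bound: for t >= 1/2 the real parts keep out of the very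
  interval that contains the periodic eigenvalues near (2j)^2. Centers far below are handled by the
  crude radius 2c, the others by 4c/3.\<close>

lemma upper_half_eigenvalue_localization:
  assumes ev: "is_eigenvalue c t \<mu>" "t \<in> {1/2..1}" and c: "c \<ge> 2" and j: "real j > c + 1/2"
  shows "\<bar>Re \<mu> - (2 * real j)\<^sup>2\<bar> > 2 * c / 3"
proof -
  obtain N :: int where N: "norm (\<mu> - of_real ((2 * of_int N + t)\<^sup>2)) \<le> 2 * c"
    "norm (\<mu> - of_real ((2 * of_int N + t)\<^sup>2)) * (4 * (\<bar>2 * of_int N + t\<bar> - 1) - 2 * c) \<le> 4 * c\<^sup>2"
    using eigenvalue_localization[of c t \<mu>] ev c by auto
  define r where "r = norm (\<mu> - of_real ((2 * of_int N + t)\<^sup>2))"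
  define u where "u = \<bar>2 * real_of_int N + t\<bar>"
  have u0: "u \<ge> 0" by (simp add: u_def)
  have usq: "(2 * real_of_int N + t)\<^sup>2 = u\<^sup>2" by (simp add: u_def)
  have near: "\<bar>Re \<mu> - u\<^sup>2\<bar> \<le> r"
    unfolding r_def usq[symmetric] by (rule abs_Re_diff_of_real_le)
  \<comment> \<open>For such t the number 2N + t is never closer than 1/2 to an even
    integer.\<close>
  have alt: "u \<le> 2 * real j - 1/2 \<or> u \<ge> 2 * real j + 1/2"
  proof (cases "N \<ge> 0")
    case True
    then have "N + 1 \<le> int j \<or> N \<ge> int j" by linarith
    then have "real_of_int N + 1 \<le> real j \<or> real_of_int N \<ge> real j" by linarith
    then show ?thesis using ev(2) True by (auto simp: u_def)
  next
    case False
    then have "- N \<le> int j \<or> - N \<ge> int j + 1" by linarith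
    then have *: "- real_of_int N \<le> real j \<or> - real_of_int N \<ge> real j + 1" by linarith
    have "real_of_int N \<le> - 1" using False by linarith
    then have "u = - (2 * real_of_int N + t)" using ev(2) by (auto simp: u_def)
    then show ?thesis using ev(2) * by auto
  qed
  show ?thesis
  proof (cases "u \<ge> 2 * real j - 3/2")
    case True
    \<comment> \<open>The factor exceeds 6c - 6, and this is at least 3c because c >= 2.\<close>
    then have "3 * c \<le> 4 * (u - 1) - 2 * c" using j c by argo
    then have "r * (3 * c) \<le> r * (4 * (u - 1) - 2 * c)" by (intro mult_left_mono) (auto simp: r_def)
    also have "\<dots> \<le> 4 * c\<^sup>2" using N(2) by (simp add: r_def u_def)
    finally have "(3 * r) * c \<le> (4 * c) * c" by (simp add: power2_eq_square mult_ac)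
    then have r: "3 * r \<le> 4 * c" using c by simp
    from alt show ?thesis
    proof
      assume "u \<le> 2 * real j - 1/2"
      then have "u\<^sup>2 \<le> (2 * real j - 1/2)\<^sup>2" using u0 by (intro power_mono)
      moreover have "(2 * real j - 1/2)\<^sup>2 + 4 * c / 3 < (2 * real j)\<^sup>2 - 2 * c / 3"
        using j by (simp add: power2_eq_square algebra_simps)
      ultimately show ?thesis using near r by linarith
    next
      assume "u \<ge> 2 * real j + 1/2"
      then have "u\<^sup>2 \<ge> (2 * real j + 1/2)\<^sup>2" by (intro power_mono) auto
      moreover have "(2 * real j + 1/2)\<^sup>2 - 4 * c / 3 > (2 * real j)\<^sup>2 + 2 * c / 3"
        using j by (simp add: power2_eq_square algebra_simps)
      ultimately show ?thesis using near r by linarith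
    qed
  next
    case False
    then have "u\<^sup>2 \<le> (2 * real j - 3/2)\<^sup>2" using u0 by (intro power_mono) auto
    moreover have "(2 * real j - 3/2)\<^sup>2 + 2 * c < (2 * real j)\<^sup>2 - 2 * c / 3"
      using j c by (simp add: power2_eq_square algebra_simps)
    moreover have "r \<le> 2 * c" using N(1) by (simp add: r_def)
    ultimately show ?thesis using near by linarith
  qed
qed

lemma continuous_no_crossing:
  fixes f :: "real \<Rightarrow> real"
  assumes "continuous_on {a..b} f" "\<And>x. x \<in> {a..b} \<Longrightarrow> f x \<noteq> v" "x \<in> {a..b}" "y \<in> {a..b}"
  shows "f x < v \<longleftrightarrow> f y < v"
proof -
  have "\<not> (f x < v \<and> \<not> f y < v)" if xy: "x \<in> {a..b}" "y \<in> {a..b}" for x y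
  proof
    assume *: "f x < v \<and> \<not> f y < v"
    have "connected (f ` {a..b})" using assms(1) by (intro connected_continuous_image) auto
    moreover have "f x \<in> f ` {a..b}" "f y \<in> f ` {a..b}" using xy by blast+
    moreover have "f x \<le> v" "v \<le> f y" using * by auto
    ultimately have "v \<in> f ` {a..b}" unfolding connected_iff_interval by blast
    then obtain z where "z \<in> {a..b}" "f z = v" by blast
    then show False using assms(2)[of z] by blast
  qed
  then show ?thesis using assms(3,4) by blast
qed

lemma continuous_inj_less_left:
  fixes f :: "real \<Rightarrow> real"
  assumes "continuous_on {a..b} f" "inj_on f {a..b}" "f b < f a" "x \<in> {a<..b}"
  shows "f x < f a"
proof (cases "x = b")
  case False
  then show ?thesis using continuous_inj_imp_mono[of a x b f] assms by auto
qed (use assms in simp)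

section \<open>The paths of eigenvalues for a fixed numbering and a fixed k\<close>

context
  fixes c :: real and lam :: "nat \<Rightarrow> real \<Rightarrow> complex" and k :: nat
  assumes c2: "c \<ge> 2" and num: "eigenvalue_numbering c lam" and kn3: "k > n3 c"
begin

text \<open>The thresholds behind \<open>n3\<close>: the indices j = k - 1 and j = k satisfy j > c +
  1/2, while j = k - 2 satisfies j > c - 1/2 and \<open>n1 c <= j\<close>.\<close>

lemma k_bounds: "real k > c + 3/2" "n1 c + 2 \<le> k" "k \<ge> 4"
proof -
  define m where "m = \<lfloor>(2 * c + 1) / 2\<rfloor>"
  have "c + 1/2 < of_int m + 1"
    using floor_correct[of "(2 * c + 1) / 2"] by (simp add: m_def add_divide_distrib)
  moreover have "real_of_int m \<le> real (nat m)" by simp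
  moreover have "real (n3 c) = real (nat m) + 1" by (simp add: n3_def m_def)
  ultimately have "c + 1/2 < real (n3 c)" by (simp only:)
  moreover have "real k \<ge> real (n3 c) + 1" using kn3 by linarith
  ultimately show r: "real k > c + 3/2" by linarith
  then show "k \<ge> 4" using c2 by linarith
  have "\<lfloor>(c + 1) / 2\<rfloor> \<le> \<lfloor>(2 * c + 1) / 2\<rfloor>" using c2 by (intro floor_mono) simp
  then have "n1 c \<le> nat \<lfloor>(2 * c + 1) / 2\<rfloor>" unfolding n1_def by linarith
  then show "n1 c + 2 \<le> k" using kn3 unfolding n3_def by linarith
qed

lemma c_pos: "c > 0" using c2 by simp

lemma lam_continuous: "n \<ge> 1 \<Longrightarrow> continuous_on {0..1} (lam n)"
  using num by (simp add: eigenvalue_numbering_def)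

lemma lam_even: "n \<ge> 1 \<Longrightarrow> t \<in> {0<..<1} \<Longrightarrow> lam n (- t) = lam n t"
  using num by (simp add: eigenvalue_numbering_def)

lemma lam_eigenvalue: "n \<ge> 1 \<Longrightarrow> t \<in> {0..1} \<Longrightarrow> is_eigenvalue c t (lam n t)"
  using num by (simp add: eigenvalue_numbering_def)

lemma lam_count:
  assumes "t \<in> {0..1}" "is_eigenvalue c t \<mu>"
  shows "finite {n. n \<ge> 1 \<and> lam n t = \<mu>}" "card {n. n \<ge> 1 \<and> lam n t = \<mu>} = alg_mult c t \<mu>"
  using num assms unfolding eigenvalue_numbering_def by blast+

lemma lam_rectangle: "n \<in> {1..2 * n1 c + 1} \<Longrightarrow> Re (lam n 0) \<le> (2 * real (n1 c))\<^sup>2 + 2 * c"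
  using num unfolding eigenvalue_numbering_def by blast

lemma lam_disk:
  assumes "m > n1 c" "n = 2 * m \<or> n = 2 * m + 1"
  shows "\<bar>Re (lam n 0) - (2 * real m)\<^sup>2\<bar> \<le> 2 * c"
proof -
  have "lam n 0 \<in> cball (of_real ((2 * real m)\<^sup>2)) (2 * c)"
    using num assms unfolding eigenvalue_numbering_def by blast
  then have "norm (lam n 0 - of_real ((2 * real m)\<^sup>2)) \<le> 2 * c"
    unfolding mem_cball dist_norm by (simp only: norm_minus_commute)
  then show ?thesis using abs_Re_diff_of_real_le order_trans by blast
qed

lemma lam_periodic_less: "m > n1 c \<Longrightarrow> Re (lam (2 * m) 0) < Re (lam (2 * m + 1) 0)"
  using num unfolding eigenvalue_numbering_def by blast

lemma lam_parameter_unique: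
  assumes "lam n t = lam m s" "n \<ge> 1" "m \<ge> 1" "t \<in> {0..1}" "s \<in> {0..1}"
  shows "t = s"
  using is_eigenvalue_parameter_unique[of c t "lam n t" s] lam_eigenvalue assms by metis

lemma Re_lam_continuous: "n \<ge> 1 \<Longrightarrow> S \<subseteq> {0..1} \<Longrightarrow> continuous_on S (\<lambda>t. Re (lam n t))"
  by (intro continuous_on_Re continuous_on_subset[OF lam_continuous])

text \<open>The numbering convention anchors the count here: the rectangle and the disks up to index
  j end by (2j)^2 + 2c, left of the separating line, and later disks start right of it.\<close>

lemma lam_zero_position:
  assumes n: "n \<ge> 1" and j: "j + 2 \<ge> k"
  shows "n \<le> 2 * j + 1 \<Longrightarrow> Re (lam n 0) < (2 * real j + 1)\<^sup>2 + 1/4"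
    and "n \<ge> 2 * j + 2 \<Longrightarrow> Re (lam n 0) > (2 * real j + 1)\<^sup>2 + 1/4"
proof -
  have jn: "n1 c \<le> j" using j k_bounds(2) by linarith
  have jc: "real j > c - 1/2" using j k_bounds(1) by linarith
  have sq: "(2 * real m)\<^sup>2 \<le> (2 * real m')\<^sup>2" if "m \<le> m'" for m m'
    using that by (intro power_mono) auto
  have lo: "(2 * real j)\<^sup>2 + 2 * c < (2 * real j + 1)\<^sup>2 + 1/4"
    using jc by (simp add: power2_eq_square algebra_simps)
  show "Re (lam n 0) < (2 * real j + 1)\<^sup>2 + 1/4" if nj: "n \<le> 2 * j + 1"
  proof (cases "n \<le> 2 * n1 c + 1")
    case True
    then have "Re (lam n 0) \<le> (2 * real (n1 c))\<^sup>2 + 2 * c" using lam_rectangle[of n] n by simp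
    then show ?thesis using sq[OF jn] lo by linarith
  next
    case False
    define m where "m = n div 2"
    have m: "m > n1 c" "n = 2 * m \<or> n = 2 * m + 1" "m \<le> j" using False nj unfolding m_def by auto
    show ?thesis using lam_disk[OF m(1,2)] sq[OF m(3)] lo by linarith
  qed
  show "Re (lam n 0) > (2 * real j + 1)\<^sup>2 + 1/4" if nj: "n \<ge> 2 * j + 2"
  proof -
    define m where "m = n div 2"
    have m: "m > n1 c" "n = 2 * m \<or> n = 2 * m + 1" "j + 1 \<le> m" using jn nj unfolding m_def by auto
    have "(2 * real (j + 1))\<^sup>2 - 2 * c > (2 * real j + 1)\<^sup>2 + 1/4"
      using jc by (simp add: power2_eq_square algebra_simps)
    then show ?thesis using lam_disk[OF m(1,2)] sq[OF m(3)] by linarith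
  qed
qed

text \<open>No eigenvalue meets the separating line while t <= 1/2, so continuity preserves the side
  taken at t = 0.\<close>

lemma lam_lower_half_position:
  assumes n: "n \<ge> 1" and j: "j + 2 \<ge> k" and t: "t \<in> {0..1/2}"
  shows "n \<le> 2 * j + 1 \<Longrightarrow> Re (lam n t) < (2 * real j + 1)\<^sup>2 + 1/4"
    and "n \<ge> 2 * j + 2 \<Longrightarrow> Re (lam n t) > (2 * real j + 1)\<^sup>2 + 1/4"
proof -
  have jc: "real j > c - 1/2" using j k_bounds(1) by linarith
  have off: "Re (lam n s) \<noteq> (2 * real j + 1)\<^sup>2 + 1/4" if "s \<in> {0..1/2}" for s
    using eigenvalue_off_separating_line[OF lam_eigenvalue[OF n] that c_pos jc] that by auto
  have "continuous_on {0..1/2} (\<lambda>t. Re (lam n t))" by (rule Re_lam_continuous[OF n]) auto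
  from continuous_no_crossing[OF this off t, of 0]
  have iff: "Re (lam n t) < (2 * real j + 1)\<^sup>2 + 1/4 \<longleftrightarrow> Re (lam n 0) < (2 * real j + 1)\<^sup>2 + 1/4" by auto
  show "n \<le> 2 * j + 1 \<Longrightarrow> Re (lam n t) < (2 * real j + 1)\<^sup>2 + 1/4"
    using iff lam_zero_position(1)[OF n j] by blast
  show "n \<ge> 2 * j + 2 \<Longrightarrow> Re (lam n t) > (2 * real j + 1)\<^sup>2 + 1/4"
    using iff lam_zero_position(2)[OF n j] off[OF t] by linarith
qed

text \<open>The lower boundary is the line of j - 1, hence \<open>j + 1 >= k\<close> where the
  one-line statement allows \<open>j + 2 >= k\<close>.\<close>

lemma lam_strip:
  assumes "n \<ge> 1" and j: "j + 1 \<ge> k" and t: "t \<in> {0..1/2}"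
  shows "(2 * real j - 1)\<^sup>2 + 1/4 < Re (lam n t) \<and> Re (lam n t) < (2 * real j + 1)\<^sup>2 + 1/4
    \<longleftrightarrow> n = 2 * j \<or> n = 2 * j + 1"
proof -
  have j1: "j \<ge> 1" using j k_bounds(3) by linarith
  have e: "2 * real (j - 1) + 1 = 2 * real j - 1" using j1 by (simp add: of_nat_diff)
  have "j - 1 + 2 \<ge> k" "j + 2 \<ge> k" using j j1 by linarith+
  note a = lam_lower_half_position[OF assms(1) this(1) t, unfolded e]
  note b = lam_lower_half_position[OF assms(1) \<open>j + 2 \<ge> k\<close> t]
  consider (lo) "n \<le> 2 * (j - 1) + 1" | (mid) "n = 2 * j \<or> n = 2 * j + 1" | (hi) "n \<ge> 2 * j + 2"
    using j1 by linarith
  then show ?thesis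
  proof cases
    case lo
    then have "\<not> (n = 2 * j \<or> n = 2 * j + 1)" using j1 by linarith
    then show ?thesis using a(1)[OF lo] by auto
  next
    case mid
    then have "n \<ge> 2 * (j - 1) + 2" "n \<le> 2 * j + 1" using j1 by linarith+
    then show ?thesis using mid a(2) b(1) by blast
  next
    case hi
    then have "\<not> (n = 2 * j \<or> n = 2 * j + 1)" by linarith
    then show ?thesis using b(2)[OF hi] by auto
  qed
qed

lemma lam_lower_half_real:
  assumes n: "n = 2 * j \<or> n = 2 * j + 1" and j: "j + 1 \<ge> k" and t: "t \<in> {0..1/2}"
  shows "lam n t \<in> \<real>"
proof -
  have j1: "j \<ge> 1" "real j > c + 1/2" using j k_bounds(1,3) by linarith+
  have n1: "n \<ge> 1" using n j1 by linarith
  show ?thesis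
    using strip_eigenvalue_real[OF lam_eigenvalue[OF n1] t c_pos j1] lam_strip[OF n1 j t] n t by auto
qed

lemma lam_periodic_localization:
  assumes n: "n = 2 * j \<or> n = 2 * j + 1" and j: "j + 1 \<ge> k"
  shows "\<bar>Re (lam n 0) - (2 * real j)\<^sup>2\<bar> \<le> 2 * c / 3"
proof -
  have j1: "j \<ge> 1" "real j > c + 1/2" using j k_bounds(1,3) by linarith+
  have n1: "n \<ge> 1" using n j1 by linarith
  show ?thesis
    using periodic_eigenvalue_localization[OF lam_eigenvalue[OF n1] c_pos j1] lam_strip[OF n1 j, of 0] n by auto
qed

lemma lam_upper_half_localization:
  assumes "n \<ge> 1" "j + 1 \<ge> k" "t \<in> {1/2..1}"
  shows "\<bar>Re (lam n t) - (2 * real j)\<^sup>2\<bar> > 2 * c / 3"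
proof -
  have "real j > c + 1/2" using assms(2) k_bounds(1) by linarith
  then show ?thesis
    using upper_half_eigenvalue_localization[OF lam_eigenvalue[OF assms(1)] assms(3) c2] assms(3) by auto
qed

lemma Re_lam_inj_on:
  assumes n: "n \<ge> 1" and S: "S \<subseteq> {0..1}" and r: "\<And>t. t \<in> S \<Longrightarrow> lam n t \<in> \<real>"
  shows "inj_on (\<lambda>t. Re (lam n t)) S"
proof (rule inj_onI)
  fix s t assume "s \<in> S" "t \<in> S" "Re (lam n s) = Re (lam n t)"
  then have "lam n s = lam n t" using r[of s] r[of t] by (simp add: complex_eq_iff complex_is_Real_iff)
  then show "s = t" using lam_parameter_unique[of n s n t] n S \<open>s \<in> S\<close> \<open>t \<in> S\<close> by blast
qed

text \<open>At \<open>t = 1/2\<close> the two eigenvalues have left the interval around \<open>(2j)\<^sup>2\<close> that contains both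
  periodic ones, and they cannot pass through the other periodic eigenvalue on their way out.\<close>

lemma lam_lower_half_outward:
  assumes j: "j + 1 \<ge> k"
  shows "Re (lam (2 * j) (1/2)) < (2 * real j)\<^sup>2" "Re (lam (2 * j + 1) (1/2)) > (2 * real j)\<^sup>2"
    and "t \<in> {0<..1/2} \<Longrightarrow> Re (lam (2 * j) t) < Re (lam (2 * j) 0)"
    and "t \<in> {0<..1/2} \<Longrightarrow> Re (lam (2 * j + 1) t) > Re (lam (2 * j + 1) 0)"
proof -
  define p q where "p = 2 * j" and "q = 2 * j + 1"
  have j1: "j > n1 c" "j \<ge> 1" using j k_bounds(2,3) by linarith+
  have pq: "p \<ge> 1" "q \<ge> 1" using j1 by (auto simp: p_def q_def)
  define f g where "f = (\<lambda>t. Re (lam p t))" and "g = (\<lambda>t. Re (lam q t))"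
  have fg0: "f 0 < g 0" using lam_periodic_less[OF j1(1)] by (simp add: f_def g_def p_def q_def)
  have loc0: "\<bar>f 0 - (2 * real j)\<^sup>2\<bar> \<le> 2 * c / 3" "\<bar>g 0 - (2 * real j)\<^sup>2\<bar> \<le> 2 * c / 3"
    unfolding f_def g_def p_def q_def by (rule lam_periodic_localization[OF _ j]; simp)+
  have loch: "\<bar>f (1/2) - (2 * real j)\<^sup>2\<bar> > 2 * c / 3" "\<bar>g (1/2) - (2 * real j)\<^sup>2\<bar> > 2 * c / 3"
    unfolding f_def g_def using lam_upper_half_localization[OF _ j, of _ "1/2"] pq by auto
  have rp: "lam p t \<in> \<real>" "lam q t \<in> \<real>" if "t \<in> {0..1/2}" for t
    using lam_lower_half_real[OF _ j that] by (auto simp: p_def q_def)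
  have sub: "{0..1/2} \<subseteq> {0..1::real}" by auto
  have cf: "continuous_on {0..1/2} f" "continuous_on {0..1/2} g"
    unfolding f_def g_def by (rule Re_lam_continuous[OF _ sub]; use pq in simp)+
  have inj: "inj_on f {0..1/2}" "inj_on g {0..1/2}"
    unfolding f_def g_def using Re_lam_inj_on[OF _ sub] pq rp by auto
  \<comment> \<open>Equality would make one number an eigenvalue for two parameters unless t = 0,
    and there \<open>fg0\<close> excludes it.\<close>
  have fne: "f t \<noteq> g 0" "g t \<noteq> f 0" if "t \<in> {0..1/2}" for t
  proof -
    have "f t \<noteq> g 0"
    proof
      assume "f t = g 0"
      then have "lam p t = lam q 0" using rp[OF that] rp[of 0]
        by (simp add: complex_eq_iff complex_is_Real_iff f_def g_def)
      then have "t = 0" using lam_parameter_unique[of p t q 0] pq that by auto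
      then show False using \<open>f t = g 0\<close> fg0 by simp
    qed
    moreover have "g t \<noteq> f 0"
    proof
      assume "g t = f 0"
      then have "lam q t = lam p 0" using rp[OF that] rp[of 0]
        by (simp add: complex_eq_iff complex_is_Real_iff f_def g_def)
      then have "t = 0" using lam_parameter_unique[of q t p 0] pq that by auto
      then show False using \<open>g t = f 0\<close> fg0 by simp
    qed
    ultimately show "f t \<noteq> g 0" "g t \<noteq> f 0" by auto
  qed
  have "f (1/2) < g 0" using continuous_no_crossing[OF cf(1) fne(1), of 0 "1/2"] fg0 by auto
  then have f2: "f (1/2) < (2 * real j)\<^sup>2 - 2 * c / 3" using loc0(2) loch(1) by linarith
  have "\<not> g (1/2) < f 0" using continuous_no_crossing[OF cf(2) fne(2), of 0 "1/2"] fg0 by auto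
  then have g2: "g (1/2) > (2 * real j)\<^sup>2 + 2 * c / 3" using loc0(1) loch(2) by linarith
  show "Re (lam (2 * j) (1/2)) < (2 * real j)\<^sup>2" "Re (lam (2 * j + 1) (1/2)) > (2 * real j)\<^sup>2"
    using f2 g2 c_pos by (simp_all add: f_def g_def p_def q_def)
  have "f (1/2) < f 0" using f2 loc0(1) by linarith
  then show "t \<in> {0<..1/2} \<Longrightarrow> Re (lam (2 * j) t) < Re (lam (2 * j) 0)"
    using continuous_inj_less_left[OF cf(1) inj(1), of t] by (simp add: f_def p_def)
  have "- g (1/2) < - g 0" using g2 loc0(2) by linarith
  moreover have "continuous_on {0..1/2} (\<lambda>t. - g t)" "inj_on (\<lambda>t. - g t) {0..1/2}"
    using cf(2) inj(2) by (auto intro: continuous_on_minus simp: inj_on_def)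
  ultimately show "t \<in> {0<..1/2} \<Longrightarrow> Re (lam (2 * j + 1) t) > Re (lam (2 * j + 1) 0)"
    using continuous_inj_less_left[of 0 "1/2" "\<lambda>t. - g t" t] by (simp add: g_def q_def)
qed

text \<open>For t >= 1/2 the barrier is the line through (2j)^2, which
  \<open>lam_upper_half_localization\<close> keeps free. At t = 1/2 the two paths starting near
  (2j)^2 have already parted to its two sides, so the new barrier splits the old pair.\<close>

lemma lam_upper_half_position:
  assumes n: "n \<ge> 1" and j: "j + 1 \<ge> k" and t: "t \<in> {1/2..1}"
  shows "n \<le> 2 * j \<Longrightarrow> Re (lam n t) < (2 * real j)\<^sup>2"
    and "n \<ge> 2 * j + 1 \<Longrightarrow> Re (lam n t) > (2 * real j)\<^sup>2"
proof -
  have off: "Re (lam n s) \<noteq> (2 * real j)\<^sup>2" if "s \<in> {1/2..1}" for s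
    using lam_upper_half_localization[OF n j that] c_pos by auto
  have "continuous_on {1/2..1} (\<lambda>t. Re (lam n t))" by (rule Re_lam_continuous[OF n]) auto
  from continuous_no_crossing[OF this off t, of "1/2"]
  have iff: "Re (lam n t) < (2 * real j)\<^sup>2 \<longleftrightarrow> Re (lam n (1/2)) < (2 * real j)\<^sup>2" by auto
  have j1: "j \<ge> 1" using j k_bounds(3) by linarith
  have h: "1/2 \<in> {0..1/2::real}" by simp
  have e: "2 * real (j - 1) + 1 = 2 * real j - 1" using j1 by (simp add: of_nat_diff)
  have j2: "j - 1 + 2 \<ge> k" "j + 2 \<ge> k" using j j1 by linarith+
  note a = lam_lower_half_position(1)[OF n j2(1) h, unfolded e]
  note b = lam_lower_half_position(2)[OF n j2(2) h]
  have m1: "(2 * real j - 1)\<^sup>2 + 1/4 < (2 * real j)\<^sup>2" "(2 * real j)\<^sup>2 < (2 * real j + 1)\<^sup>2 + 1/4"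
    using j1 by (simp_all add: power2_eq_square algebra_simps)
  show "Re (lam n t) < (2 * real j)\<^sup>2" if "n \<le> 2 * j"
  proof (cases "n = 2 * j")
    case True
    then show ?thesis using iff lam_lower_half_outward(1)[OF j] by simp
  next
    case False
    then have "n \<le> 2 * (j - 1) + 1" using that j1 by linarith
    then show ?thesis using iff a m1 by linarith
  qed
  show "Re (lam n t) > (2 * real j)\<^sup>2" if "n \<ge> 2 * j + 1"
  proof -
    have "Re (lam n (1/2)) > (2 * real j)\<^sup>2"
    proof (cases "n = 2 * j + 1")
      case True
      then show ?thesis using lam_lower_half_outward(2)[OF j] by simp
    next
      case False
      then have "n \<ge> 2 * j + 2" using that by linarith
      then show ?thesis using b m1 by linarith
    qed
    then show ?thesis using iff off[OF t] by linarith
  qed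
qed

lemma lam_upper_half_strip:
  assumes n: "n \<ge> 1" and t: "t \<in> {1/2..1}"
  shows "(2 * real (k - 1))\<^sup>2 < Re (lam n t) \<and> Re (lam n t) < (2 * real k)\<^sup>2 \<longleftrightarrow> n = 2 * k - 1 \<or> n = 2 * k"
proof -
  have k: "k - 1 + 1 \<ge> k" "k + 1 \<ge> k" by linarith+
  note a = lam_upper_half_position[OF n k(1) t] and b = lam_upper_half_position[OF n k(2) t]
  have "n \<le> 2 * (k - 1) \<or> n = 2 * k - 1 \<or> n = 2 * k \<or> n \<ge> 2 * k + 1" using k_bounds(3) by linarith
  then show ?thesis
  proof (elim disjE)
    assume "n \<le> 2 * (k - 1)"
    then show ?thesis using a(1) k_bounds(3) by auto
  next
    assume "n \<ge> 2 * k + 1"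
    then show ?thesis using b(2) by auto
  next
    assume "n = 2 * k - 1"
    moreover from this have "n \<ge> 2 * (k - 1) + 1" "n \<le> 2 * k" using k_bounds(3) by linarith+
    ultimately show ?thesis using a(2) b(1) by blast
  next
    assume "n = 2 * k"
    moreover from this have "n \<ge> 2 * (k - 1) + 1" "n \<le> 2 * k" using k_bounds(3) by linarith+
    ultimately show ?thesis using a(2) b(1) by blast
  qed
qed

text \<open>The conjugate eigenvalue has the same positive multiplicity, so it is listed under some
  index. It has the same real part, hence lies in the same strip, and only two indices live
  there.\<close>

lemma lam_pair_cnj:
  assumes t: "t \<in> {1/2..1}" and p: "p = 2 * k - 1 \<or> p = 2 * k" and nr: "lam p t \<notin> \<real>"
  shows "lam (if p = 2 * k then 2 * k - 1 else 2 * k) t = cnj (lam p t)"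
proof -
  have p1: "p \<ge> 1" using p k_bounds(3) by linarith
  have t1: "t \<in> {0..1}" using t by auto
  note ev = lam_eigenvalue[OF p1 t1]
  have "p \<in> {n. n \<ge> 1 \<and> lam n t = lam p t}" using p1 by simp
  then have "card {n. n \<ge> 1 \<and> lam n t = lam p t} > 0" using lam_count(1)[OF t1 ev] card_gt_0_iff by blast
  then have "card {n. n \<ge> 1 \<and> lam n t = cnj (lam p t)} > 0"
    using lam_count(2)[OF t1 ev] lam_count(2)[OF t1 is_eigenvalue_cnj[OF ev]] alg_mult_cnj by simp
  then obtain n where n: "n \<ge> 1" "lam n t = cnj (lam p t)" by (auto simp: card_gt_0_iff)
  then have "n = 2 * k - 1 \<or> n = 2 * k"
    using lam_upper_half_strip[OF n(1) t] lam_upper_half_strip[OF p1 t] p by simp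
  moreover have "n \<noteq> p" using n(2) nr by (auto simp: Reals_cnj_iff)
  ultimately show ?thesis using n(2) p by auto
qed

lemma lam_pair_real:
  assumes t: "t \<in> {1/2..1}"
  shows "lam (2 * k) t \<in> \<real> \<longleftrightarrow> lam (2 * k - 1) t \<in> \<real>"
proof -
  have ne: "2 * k - 1 \<noteq> 2 * k" using k_bounds(3) by linarith
  have "lam (2 * k) t \<notin> \<real>" if "lam (2 * k - 1) t \<notin> \<real>"
    using lam_pair_cnj[OF t _ that] that ne by (simp add: complex_is_Real_iff)
  moreover have "lam (2 * k - 1) t \<notin> \<real>" if "lam (2 * k) t \<notin> \<real>"
    using lam_pair_cnj[OF t _ that] that by (simp add: complex_is_Real_iff)
  ultimately show ?thesis by blast
qed

text \<open>The collision parameter is the first exit of the pair from the real line.  Until then the two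
  real paths sweep out the whole interval between the periodic eigenvalues, so a later real eigenvalue
  would belong to two different parameters.\<close>

lemma collision_parameter:
  obtains T where "T \<in> {1/2..<1}" "lam (2 * k - 1) T = lam (2 * k) T"
    "\<And>t. t \<in> {0..T} \<Longrightarrow> lam (2 * k - 1) t \<in> \<real> \<and> lam (2 * k) t \<in> \<real>"
    "\<And>t. t \<in> {T<..1} \<Longrightarrow> lam (2 * k - 1) t \<notin> \<real> \<and> lam (2 * k) t \<notin> \<real>"
    "Re (lam (2 * k - 1) 0) < Re (lam (2 * k - 1) T)" "Re (lam (2 * k) T) < Re (lam (2 * k) 0)"
proof -
  define p q where "p = 2 * k - 1" and "q = 2 * k"
  have pq: "p \<ge> 1" "q \<ge> 1" "p = 2 * (k - 1) + 1" using k_bounds(3) by (auto simp: p_def q_def)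
  have k1: "k - 1 + 1 \<ge> k" "k + 1 \<ge> k" by linarith+
  define Z where "Z = {t \<in> {0..1}. lam p t \<notin> \<real>}"
  define T where "T = Inf Z"
  have low: "lam p t \<in> \<real>" "lam q t \<in> \<real>" if "t \<in> {0..1/2}" for t
    using lam_lower_half_real[OF _ k1(1) that, of p] lam_lower_half_real[OF _ k1(2) that, of q] pq(3)
    by (auto simp: q_def)
  have Zge: "t \<ge> 1/2" if "t \<in> Z" for t
  proof (rule ccontr)
    assume "\<not> t \<ge> 1/2"
    then have "t \<in> {0..1/2}" using that by (auto simp: Z_def)
    then show False using low(1)[of t] that by (simp add: Z_def)
  qed
  have "lam p 1 \<notin> \<real>" using antiperiodic_eigenvalue_nonreal[OF lam_eigenvalue c_pos] pq by simp
  then have Z1: "1 \<in> Z" by (simp add: Z_def)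
  have bdd: "bdd_below Z" using Zge by (rule bdd_belowI)
  have T: "1/2 \<le> T" "T \<le> 1"
    unfolding T_def using cInf_greatest[of Z "1/2"] Z1 Zge cInf_lower[OF Z1 bdd] by auto
  have real_lt: "lam p t \<in> \<real>" if "0 \<le> t" "t < T" for t
  proof (rule ccontr)
    assume "lam p t \<notin> \<real>"
    then have "t \<in> Z" using that T by (simp add: Z_def)
    then show False using cInf_lower[OF _ bdd] that(2) unfolding T_def by fastforce
  qed
  have cont: "continuous_on {0..1} (lam p)" "continuous_on {0..1} (lam q)" using lam_continuous pq by auto
  \<comment> \<open>Reality passes to the limit from the left; T >= 1/2 ensures that there are
    points to the left.\<close>
  have real_T: "lam p T \<in> \<real>"
  proof -
    have "closed {t \<in> {0..1}. Im (lam p t) = 0}"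
      using cont(1) by (intro continuous_closed_preimage_constant continuous_on_Im) auto
    moreover have "T \<in> closure {0..<T}" using T by simp
    moreover have "{0..<T} \<subseteq> {t \<in> {0..1}. Im (lam p t) = 0}"
      using real_lt T by (auto simp: complex_is_Real_iff)
    ultimately have "T \<in> {t \<in> {0..1}. Im (lam p t) = 0}" using closure_minimal by blast
    then show ?thesis by (simp add: complex_is_Real_iff)
  qed
  have real_le: "lam p t \<in> \<real> \<and> lam q t \<in> \<real>" if "t \<in> {0..T}" for t
  proof -
    have "lam p t \<in> \<real>" using real_lt[of t] real_T that by (cases "t = T") auto
    moreover have "lam q t \<in> \<real>"
      using low(2)[of t] lam_pair_real[of t] calculation that T by (cases "t \<le> 1/2") (auto simp: p_def q_def)
    ultimately show ?thesis by simp
  qed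
  have T1: "T < 1" using real_T \<open>lam p 1 \<notin> \<real>\<close> T by (cases "T = 1") auto
  \<comment> \<open>On \<open>Z\<close> the two values are conjugate; this closed condition persists
    at the infimum \<open>T\<close>, where the values are real.\<close>
  have coll: "lam p T = lam q T"
  proof -
    have "closed {t \<in> {1/2..1}. lam q t - cnj (lam p t) = 0}"
      by (intro continuous_closed_preimage_constant continuous_on_diff continuous_on_cnj
          continuous_on_subset[OF cont(1)] continuous_on_subset[OF cont(2)]) auto
    moreover have "Z \<subseteq> {t \<in> {1/2..1}. lam q t - cnj (lam p t) = 0}"
    proof
      fix t assume t: "t \<in> Z"
      then have "t \<in> {1/2..1}" "lam p t \<notin> \<real>" using Zge[OF t] by (auto simp: Z_def)
      moreover have "p \<noteq> 2 * k" using pq by (simp add: p_def)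
      ultimately have "lam q t = cnj (lam p t)"
        using lam_pair_cnj[of t p] by (simp add: p_def q_def)
      then show "t \<in> {t \<in> {1/2..1}. lam q t - cnj (lam p t) = 0}" using \<open>t \<in> {1/2..1}\<close> by simp
    qed
    moreover have "T \<in> closure Z" unfolding T_def using Z1 bdd by (intro closure_contains_Inf) auto
    ultimately have "T \<in> {t \<in> {1/2..1}. lam q t - cnj (lam p t) = 0}" using closure_minimal by blast
    then show ?thesis using real_T by (simp add: Reals_cnj_iff)
  qed
  have Tm: "T \<in> {1/2..1}" using T by simp
  \<comment> \<open>The pair stays between the even squares and more than 2c/3 away from both,
    whereas the two periodic endpoints lie within 2c/3 of these squares.\<close>
  have inside: "Re (lam p 0) < x \<and> x < Re (lam q 0)"
    if n: "n = p \<or> n = q" and t: "t \<in> {1/2..1}" and x: "x = Re (lam n t)" for n t x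
  proof -
    have n1: "n \<ge> 1" "n = 2 * k - 1 \<or> n = 2 * k" using n pq by (auto simp: p_def q_def)
    have "(2 * real (k - 1))\<^sup>2 < x" "x < (2 * real k)\<^sup>2"
      using lam_upper_half_strip[OF n1(1) t] n1(2) x by auto
    moreover have "\<bar>x - (2 * real (k - 1))\<^sup>2\<bar> > 2 * c / 3" "\<bar>x - (2 * real k)\<^sup>2\<bar> > 2 * c / 3"
      using lam_upper_half_localization[OF n1(1) k1(1) t] lam_upper_half_localization[OF n1(1) k1(2) t] x by auto
    moreover have "\<bar>Re (lam p 0) - (2 * real (k - 1))\<^sup>2\<bar> \<le> 2 * c / 3" "\<bar>Re (lam q 0) - (2 * real k)\<^sup>2\<bar> \<le> 2 * c / 3"
      using lam_periodic_localization[OF _ k1(1), of p] lam_periodic_localization[OF _ k1(2), of q] pq(3)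
      by (auto simp: q_def)
    ultimately show ?thesis by linarith
  qed
  have after: "lam p t \<notin> \<real>" if t: "t \<in> {T<..1}" for t
  proof
    assume r: "lam p t \<in> \<real>"
    define x where "x = Re (lam p t)"
    have t1: "t \<in> {1/2..1}" using t T by auto
    have x: "Re (lam p 0) < x" "x < Re (lam q 0)" using inside[of p t x] t1 x_def by auto
    have sub: "{0..T} \<subseteq> {0..1}" using T by auto
    have cf: "continuous_on {0..T} (\<lambda>t. Re (lam p t))" "continuous_on {0..T} (\<lambda>t. Re (lam q t))"
      using Re_lam_continuous[OF _ sub] pq by auto
    \<comment> \<open>Up to \<open>T\<close> the first path covers everything from its start to the
      collision value, the second everything from there to its own start.\<close>
    have "\<exists>s\<in>{0..T}. \<exists>n\<in>{p, q}. Re (lam n s) = x"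
    proof (cases "x \<le> Re (lam p T)")
      case True
      then show ?thesis using IVT'[of "\<lambda>t. Re (lam p t)" 0 x T] cf(1) x T by auto
    next
      case False
      then have "Re (lam q T) \<le> x" by (simp add: coll)
      then show ?thesis using IVT2'[of "\<lambda>t. Re (lam q t)" T x 0] cf(2) x T by auto
    qed
    then obtain s n where s: "s \<in> {0..T}" "n = p \<or> n = q" "Re (lam n s) = x" by blast
    then have "lam n s = lam p t" using real_le[OF s(1)] r
      by (auto simp: x_def complex_eq_iff complex_is_Real_iff)
    then have "s = t" using lam_parameter_unique[of n s p t] s pq t T by auto
    then show False using s(1) t by auto
  qed
  have afterq: "lam q t \<notin> \<real>" if t: "t \<in> {T<..1}" for t
    using after[OF t] lam_pair_real[of t] t T by (auto simp: p_def q_def)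
  show thesis
  proof (rule that[of T])
    show "T \<in> {1/2..<1}" using T T1 by simp
    show "lam (2 * k - 1) T = lam (2 * k) T" using coll by (simp add: p_def q_def)
    show "lam (2 * k - 1) t \<in> \<real> \<and> lam (2 * k) t \<in> \<real>" if "t \<in> {0..T}" for t
      using real_le[OF that] by (simp add: p_def q_def)
    show "lam (2 * k - 1) t \<notin> \<real> \<and> lam (2 * k) t \<notin> \<real>" if "t \<in> {T<..1}" for t
      using after[OF that] afterq[OF that] by (simp add: p_def q_def)
    show "Re (lam (2 * k - 1) 0) < Re (lam (2 * k - 1) T)" "Re (lam (2 * k) T) < Re (lam (2 * k) 0)"
      using inside[of p T] inside[of q T] Tm by (simp_all add: p_def q_def)
  qed
qed

section \<open>Images of the paths and multiplicity at the collision\<close>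

lemma band_eq_image:
  assumes "n \<ge> 1"
  shows "band lam n = lam n ` {0..1}"
proof
  show "band lam n \<subseteq> lam n ` {0..1}"
  proof
    fix z assume "z \<in> band lam n"
    then obtain t where t: "t \<in> {-1<..1}" "z = lam n t" by (auto simp: band_def)
    show "z \<in> lam n ` {0..1}"
    proof (cases "t \<ge> 0")
      case False
      then have "z = lam n (- t)" using lam_even[OF assms, of "- t"] t by simp
      then show ?thesis using t False by auto
    qed (use t in auto)
  qed
qed (auto simp: band_def)

text \<open>A real path is injective, since a value belongs to one parameter only; being continuous
  it is monotone, in the direction that its endpoints dictate.\<close>

lemma real_path_image:
  assumes n: "n \<ge> 1" and T: "T \<in> {0..1}" and r: "\<And>t. t \<in> {0..T} \<Longrightarrow> lam n t \<in> \<real>"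
  shows "Re (lam n 0) < Re (lam n T) \<Longrightarrow> lam n ` {0..T} = real_interval (lam n 0) (lam n T)"
    and "Re (lam n T) < Re (lam n 0) \<Longrightarrow> lam n ` {0..T} = real_interval (lam n T) (lam n 0)"
    and "Re (lam n 0) < Re (lam n T) \<Longrightarrow> t \<in> {0..<T} \<Longrightarrow> Re (lam n t) < Re (lam n T)"
    and "Re (lam n T) < Re (lam n 0) \<Longrightarrow> t \<in> {0..<T} \<Longrightarrow> Re (lam n T) < Re (lam n t)"
proof -
  have sub: "{0..T} \<subseteq> {0..1}" using T by auto
  have cont: "continuous_on {0..T} (\<lambda>t. Re (lam n t))" by (rule Re_lam_continuous[OF n sub])
  have inj: "inj_on (\<lambda>t. Re (lam n t)) {0..T}" by (rule Re_lam_inj_on[OF n sub r])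
  note mono = continuous_inj_imp_mono[OF _ _ cont inj]
  have im: "lam n ` {0..T} = complex_of_real ` (\<lambda>t. Re (lam n t)) ` {0..T}"
    using r by (force simp: image_image complex_eq_iff complex_is_Real_iff intro!: image_cong)
  show "lam n ` {0..T} = real_interval (lam n 0) (lam n T)" if lt: "Re (lam n 0) < Re (lam n T)"
  proof -
    have "(\<lambda>t. Re (lam n t)) ` {0..T} = {Re (lam n 0)..Re (lam n T)}"
    proof
      show "(\<lambda>t. Re (lam n t)) ` {0..T} \<subseteq> {Re (lam n 0)..Re (lam n T)}"
      proof
        fix y assume "y \<in> (\<lambda>t. Re (lam n t)) ` {0..T}"
        then obtain s where s: "s \<in> {0..T}" "y = Re (lam n s)" by auto
        then show "y \<in> {Re (lam n 0)..Re (lam n T)}"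
          using mono[of s] lt by (cases "s = 0"; cases "s = T") auto
      qed
      show "{Re (lam n 0)..Re (lam n T)} \<subseteq> (\<lambda>t. Re (lam n t)) ` {0..T}"
        using IVT'[of "\<lambda>t. Re (lam n t)" 0 _ T] cont T by (force simp: image_iff)
    qed
    then show ?thesis unfolding im real_interval_def by simp
  qed
  show "lam n ` {0..T} = real_interval (lam n T) (lam n 0)" if lt: "Re (lam n T) < Re (lam n 0)"
  proof -
    have "(\<lambda>t. Re (lam n t)) ` {0..T} = {Re (lam n T)..Re (lam n 0)}"
    proof
      show "(\<lambda>t. Re (lam n t)) ` {0..T} \<subseteq> {Re (lam n T)..Re (lam n 0)}"
      proof
        fix y assume "y \<in> (\<lambda>t. Re (lam n t)) ` {0..T}"
        then obtain s where s: "s \<in> {0..T}" "y = Re (lam n s)" by auto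
        then show "y \<in> {Re (lam n T)..Re (lam n 0)}"
          using mono[of s] lt by (cases "s = 0"; cases "s = T") auto
      qed
      show "{Re (lam n T)..Re (lam n 0)} \<subseteq> (\<lambda>t. Re (lam n t)) ` {0..T}"
        using IVT2'[of "\<lambda>t. Re (lam n t)" T _ 0] cont T by (force simp: image_iff)
    qed
    then show ?thesis unfolding im real_interval_def by simp
  qed
  show "Re (lam n t) < Re (lam n T)" if "Re (lam n 0) < Re (lam n T)" "t \<in> {0..<T}"
    using mono[of t] that by (cases "t = 0") auto
  show "Re (lam n T) < Re (lam n t)" if "Re (lam n T) < Re (lam n 0)" "t \<in> {0..<T}"
    using mono[of t] that by (cases "t = 0") auto
qed

text \<open>Multiplicity counts the indices with a given value; an index sharing the collision value
  lies in the strip, so there are just the two.\<close>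

lemma alg_mult_collision:
  assumes "T \<in> {1/2..1}" "lam (2 * k - 1) T = lam (2 * k) T"
  shows "alg_mult c T (lam (2 * k - 1) T) = 2"
proof -
  have n1: "2 * k - 1 \<ge> 1" "2 * k \<ge> 1" "2 * k - 1 \<noteq> 2 * k" using k_bounds(3) by linarith+
  have T: "T \<in> {0..1}" using assms(1) by auto
  have "{n. n \<ge> 1 \<and> lam n T = lam (2 * k - 1) T} = {2 * k - 1, 2 * k}"
  proof (intro equalityI subsetI)
    fix n assume "n \<in> {n. n \<ge> 1 \<and> lam n T = lam (2 * k - 1) T}"
    then have n: "n \<ge> 1" "lam n T = lam (2 * k - 1) T" by auto
    show "n \<in> {2 * k - 1, 2 * k}"
      using lam_upper_half_strip[OF n(1) assms(1)] lam_upper_half_strip[OF n1(1) assms(1)] n(2) by simp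
  next
    fix n assume "n \<in> {2 * k - 1, 2 * k}"
    then show "n \<in> {n. n \<ge> 1 \<and> lam n T = lam (2 * k - 1) T}" using n1 assms(2) by auto
  qed
  then show ?thesis using lam_count(2)[OF T lam_eigenvalue[OF n1(1) T]] n1 by simp
qed

lemma alg_mult_ge_2_imp_coincidence:
  assumes "t \<in> {0..1}" "n \<ge> 1" "alg_mult c t (lam n t) \<ge> 2"
  obtains m where "m \<ge> 1" "m \<noteq> n" "lam m t = lam n t"
proof -
  let ?S = "{m. m \<ge> 1 \<and> lam m t = lam n t}"
  have "card ?S \<ge> 2" using lam_count(2)[OF assms(1) lam_eigenvalue[OF assms(2,1)]] assms(3) by simp
  then have "\<not> ?S \<subseteq> {n}" using card_mono[of "{n}" ?S] by fastforce
  then show thesis using that by blast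
qed

end

theorem theorem6:
  fixes c :: real and lam :: "nat \<Rightarrow> real \<Rightarrow> complex" and k :: nat
  assumes "c \<ge> 2"
    and "eigenvalue_numbering c lam"
    and "k > n3 c"
  shows "(\<exists>!t. t \<in> {0<..<1} \<and> multiple_real_at c lam k t) \<and>
    (\<forall>t\<^sub>k\<in>{0<..<1}. multiple_real_at c lam k t\<^sub>k \<longrightarrow>
       alg_mult c t\<^sub>k (lam (2 * k - 1) t\<^sub>k) = 2 \<and>
       lam (2 * k - 1) t\<^sub>k = lam (2 * k) t\<^sub>k \<and>
       band lam (2 * k - 1) \<inter> \<real> = lam (2 * k - 1) ` {0..t\<^sub>k} \<and>
       lam (2 * k - 1) ` {0..t\<^sub>k} = real_interval (lam (2 * k - 1) 0) (lam (2 * k - 1) t\<^sub>k) \<and>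
       band lam (2 * k) \<inter> \<real> = lam (2 * k) ` {0..t\<^sub>k} \<and>
       lam (2 * k) ` {0..t\<^sub>k} = real_interval (lam (2 * k) t\<^sub>k) (lam (2 * k) 0) \<and>
       band lam (2 * k - 1) - \<real> = lam (2 * k - 1) ` {t\<^sub>k<..1} \<and>
       band lam (2 * k) - \<real> = lam (2 * k) ` {t\<^sub>k<..1})"
proof -
  note hyps = assms
  define p q where "p = 2 * k - 1" and "q = 2 * k"
  have pq: "p \<ge> 1" "q \<ge> 1" "p \<noteq> q" "p = 2 * (k - 1) + 1" using k_bounds(3)[OF hyps] by (auto simp: p_def q_def)
  obtain T where T: "T \<in> {1/2..<1}" "lam p T = lam q T"
    and real: "\<And>t. t \<in> {0..T} \<Longrightarrow> lam p t \<in> \<real> \<and> lam q t \<in> \<real>"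
    and nonreal: "\<And>t. t \<in> {T<..1} \<Longrightarrow> lam p t \<notin> \<real> \<and> lam q t \<notin> \<real>"
    and less: "Re (lam p 0) < Re (lam p T)" "Re (lam q T) < Re (lam q 0)"
    using collision_parameter[OF hyps] unfolding p_def q_def by blast
  have T01: "T \<in> {0..1}" "T \<in> {0<..<1}" "T \<in> {1/2..1}" using T by auto
  note path_p = real_path_image[OF hyps pq(1) T01(1)] and path_q = real_path_image[OF hyps pq(2) T01(1)]
  have mult2: "alg_mult c T (lam p T) = 2"
    using alg_mult_collision[OF hyps T01(3)] T(2) by (simp add: p_def q_def)
  have "lam p T \<in> \<real>" "lam p T \<in> real_interval (lam p 0) (lam q 0)"
    using real[of T] T01 T(2) less
    by (auto simp: real_interval_def image_iff complex_is_Real_iff complex_eq_iff intro!: bexI[of _ "Re (lam p T)"])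
  then have mT: "multiple_real_at c lam k T"
    using mult2 lam_eigenvalue[OF hyps pq(1) T01(1)] by (simp add: multiple_real_at_def p_def q_def)
  have uniq: "t = T" if t: "t \<in> {0<..<1}" and m: "multiple_real_at c lam k t" for t
  proof (rule ccontr)
    assume ne: "t \<noteq> T"
    have t1: "t \<in> {0..1}" using t by auto
    have mr: "alg_mult c t (lam p t) \<ge> 2" "lam p t \<in> \<real>" using m by (simp_all add: multiple_real_at_def p_def)
    obtain n where n: "n \<ge> 1" "n \<noteq> p" "lam n t = lam p t"
      using alg_mult_ge_2_imp_coincidence[OF hyps t1 pq(1) mr(1)] by blast
    have lt: "t < T" using nonreal[of t] mr(2) t ne by (cases "t > T") auto
    show False
    proof (cases "t \<le> 1/2")
      case True
      then have th: "t \<in> {0..1/2}" "t \<in> {0<..1/2}" using t by auto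
      have k1: "k - 1 + 1 \<ge> k" by linarith
      have "n = 2 * (k - 1) \<or> n = 2 * (k - 1) + 1"
        using lam_strip[OF hyps n(1) k1 th(1)] lam_strip[OF hyps pq(1) k1 th(1)] n(3) pq(4) by simp
      then have "n = 2 * (k - 1)" using n(2) pq(4) by simp
      \<comment> \<open>The only possible partner here is the other path starting near (2k - 2)^2,
        and it moves left while \<open>lam p\<close> moves right.\<close>
      then have "Re (lam n t) < Re (lam n 0)" "Re (lam n 0) < Re (lam p 0)" "Re (lam p 0) < Re (lam p t)"
        using lam_lower_half_outward(3,4)[OF hyps k1 th(2)] lam_periodic_less[OF hyps, of "k - 1"] k_bounds(2)[OF hyps] pq(4)
        by auto
      then show False using n(3) by simp
    next
      case False
      then have th: "t \<in> {1/2..1}" using t by auto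
      have "n = 2 * k - 1 \<or> n = 2 * k"
        using lam_upper_half_strip[OF hyps n(1) th] lam_upper_half_strip[OF hyps pq(1) th] n(3) by (simp add: p_def)
      then have "n = q" using n(2) by (auto simp: p_def q_def)
      \<comment> \<open>Before \<open>T\<close> the first path is strictly below the collision value
        and the second strictly above it.\<close>
      moreover have "Re (lam p t) < Re (lam p T)" using path_p(3)[OF _ less(1)] real lt t by auto
      moreover have "Re (lam q T) < Re (lam q t)" using path_q(4)[OF _ less(2)] real lt t by auto
      ultimately show False using n(3) T(2) by simp
    qed
  qed
  have split: "{0..1} = {0..T} \<union> {T<..1}" using T01 by auto
  have bands: "band lam n \<inter> \<real> = lam n ` {0..T}" "band lam n - \<real> = lam n ` {T<..1}" if "n = p \<or> n = q" for n
  proof -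
    have "band lam n = lam n ` {0..T} \<union> lam n ` {T<..1}"
      using band_eq_image[OF hyps, of n] that pq split by (auto simp: image_Un)
    moreover have "lam n ` {0..T} \<subseteq> \<real>" "lam n ` {T<..1} \<inter> \<real> = {}" using real nonreal that by auto
    ultimately show "band lam n \<inter> \<real> = lam n ` {0..T}" "band lam n - \<real> = lam n ` {T<..1}" by blast+
  qed
  have "lam p ` {0..T} = real_interval (lam p 0) (lam p T)" "lam q ` {0..T} = real_interval (lam q T) (lam q 0)"
    using path_p(1)[OF _ less(1)] path_q(2)[OF _ less(2)] real by auto
  note concl = mult2 T(2) bands[of p] bands[of q] this
  show ?thesis
  proof (intro conjI ballI impI)
    show "\<exists>!t. t \<in> {0<..<1} \<and> multiple_real_at c lam k t" using mT T01(2) uniq by blast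
  next
    fix t\<^sub>k assume "t\<^sub>k \<in> {0<..<1}" "multiple_real_at c lam k t\<^sub>k"
    then have e: "t\<^sub>k = T" by (rule uniq)
    show "alg_mult c t\<^sub>k (lam (2 * k - 1) t\<^sub>k) = 2"
      "lam (2 * k - 1) t\<^sub>k = lam (2 * k) t\<^sub>k"
      "band lam (2 * k - 1) \<inter> \<real> = lam (2 * k - 1) ` {0..t\<^sub>k}"
      "lam (2 * k - 1) ` {0..t\<^sub>k} = real_interval (lam (2 * k - 1) 0) (lam (2 * k - 1) t\<^sub>k)"
      "band lam (2 * k) \<inter> \<real> = lam (2 * k) ` {0..t\<^sub>k}"
      "lam (2 * k) ` {0..t\<^sub>k} = real_interval (lam (2 * k) t\<^sub>k) (lam (2 * k) 0)"
      "band lam (2 * k - 1) - \<real> = lam (2 * k - 1) ` {t\<^sub>k<..1}"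
      "band lam (2 * k) - \<real> = lam (2 * k) ` {t\<^sub>k<..1}"
      unfolding e using concl by (simp_all add: p_def q_def)
  qed
qed

end
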